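(* Suppose that $D_K(\mathbb{P},\mathbb{Q})<\infty$ and that there is some $g\in\mathcal{G}$ with $g=g_0$ almost surely. Let $\bar{\mathcal{G}}:=\{((g+g_0)/2)^{1/2}: g\in\mathcal{G}\}$ and suppose that for some constant $0<\gamma_{\bar{\mathcal{G}}}<2$, $$\mathcal{H}^B_\delta(\bar{\mathcal{G}},L_2(\mathbb{Q}))=O(\delta^{-\gamma_{\bar{\mathcal{G}}}})\qquad\text{for any }\delta>0 .$$ (a) If $\sup_{g\in\mathcal{G}}\|g\|_\infty<K_2$ for some constant $K_2<\infty$, then $$h_{\mathbb{Q}}(g_0,\widehat g_n)=O_{\mathbb{P}}\big(n^{-1/(\gamma_{\bar{\mathcal{G}}}+2)}\big).$$ (b) If there are constants $K_1,K_2$ with $0<K_1\le\inf_x g(x)$ and $\sup_x g(x)\le K_2$ for all $g\in\mathcal{G}$, then $$|\widehat D_K-D_K(\mathbb{P},\mathbb{Q})|=O_{\mathbb{P}}(n^{-1/2}).$$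
   Context: Setting: $\mathbb{P},\mathbb{Q}$ are probability distributions on a compact domain $\mathcal{X}\subset\mathbb{R}^d$, absolutely continuous with respect to Lebesgue measure $\mu$ with densities $p_0,q_0$; $\mathbb{P}$ is absolutely continuous with respect to $\mathbb{Q}$, and the two share the same support. Put $g_0:=p_0/q_0$ and $D_K(\mathbb{P},\mathbb{Q}):=\int p_0\log(p_0/q_0)\,d\mu$. Samples: $X^{(1)},\dots,X^{(n)}$ are i.i.d. from $\mathbb{P}$ and $Y^{(1)},\dots,Y^{(n)}$ are i.i.d. from $\mathbb{Q}$ (the two samples independent); $\mathbb{P}_n,\mathbb{Q}_n$ are the corresponding empirical distributions. Estimator E1: $\mathcal{G}$ is a fixed class of functions $g:\mathcal{X}\to\mathbb{R}_+$ and $$\widehat g_n\in\arg\max_{g\in\mathcal{G}}\Big\{\int\log g\,d\mathbb{P}_n-\int g\,d\mathbb{Q}_n\Big\},\qquad \widehat D_K=\int\log\widehat g_n\,d\mathbb{P}_n-\int\widehat g_n\,d\mathbb{Q}_n+1$$ (the maximum is assumed attained). Hellinger distance: $h_{\mathbb{Q}}^2(g_0,g):=\frac12\int(\sqrt{g_0}-\sqrt g)^2\,d\mathbb{Q}$. Bracketing entropy: $N^B_\delta(\mathcal{F},L_2(\mathbb{Q}))$ is the smallest $N$ for which there exist $N$ pairs of functions $\{f_j^L,f_j^U\}$ with $\|f_j^U-f_j^L\|_{L_2(\mathbb{Q})}\le\delta$ such that for each $f\in\mathcal{F}$ there is a $j$ with $f_j^L\le f\le f_j^U$; $\mathcal{H}^B_\delta:=\log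 N^B_\delta$. The bound $O(\delta^{-\gamma})$ means at most $A\delta^{-\gamma}$ for a constant $A$ independent of $\delta$. $Z_n=O_{\mathbb{P}}(a_n)$ means $Z_n/a_n$ is bounded in probability (under the law of the samples). *)

theory Defs
  imports "HOL-Probability.Probability"
begin

section \<open>Distributions on a compact domain\<close>

text \<open>A function on the domain is a total function of which only the restriction to the
  domain matters: all measures below have the domain itself as their space.\<close>

definition measure_support :: "'a::topological_space measure \<Rightarrow> 'a set" where
  "measure_support N =
     {x \<in> space N. \<forall>U. open U \<longrightarrow> x \<in> U \<longrightarrow> emeasure N (U \<inter> space N) \<noteq> 0}"

text \<open>The Kullback-Leibler divergence \<open>\<integral> p log (p/q) d\<mu>\<close> as an extended real: integral of the
  positive part minus integral of the negative part (the latter is always finite for probability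
  densities). The junk value of \<open>ln (p / 0)\<close> is harmless, because \<open>{p > 0, q = 0}\<close> is
  a null set when the first distribution is absolutely continuous with respect to the second.\<close>

definition KL_dens :: "'a measure \<Rightarrow> ('a \<Rightarrow> real) \<Rightarrow> ('a \<Rightarrow> real) \<Rightarrow> ereal" where
  "KL_dens \<mu> p q =
     enn2ereal (\<integral>\<^sup>+x. ennreal (p x * ln (p x / q x)) \<partial>\<mu>)
     - enn2ereal (\<integral>\<^sup>+x. ennreal (- (p x * ln (p x / q x))) \<partial>\<mu>)"

lemma KL_dens_integrable:
  assumes "integrable \<mu> (\<lambda>x. p x * ln (p x / q x))"
  shows "KL_dens \<mu> p q = ereal (LINT x|\<mu>. p x * ln (p x / q x))"
proof -
  let ?f = "\<lambda>x. p x * ln (p x / q x)"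
  have fin: "(\<integral>\<^sup>+x. ennreal (?f x) \<partial>\<mu>) \<noteq> \<infinity>" "(\<integral>\<^sup>+x. ennreal (- ?f x) \<partial>\<mu>) \<noteq> \<infinity>"
    using assms by (auto simp: real_integrable_def)
  show ?thesis
    unfolding KL_dens_def real_lebesgue_integral_def[OF assms]
    using fin
    by (cases "\<integral>\<^sup>+x. ennreal (?f x) \<partial>\<mu>"; cases "\<integral>\<^sup>+x. ennreal (- ?f x) \<partial>\<mu>")
       (auto simp: enn2ereal_ennreal)
qed

lemma KL_dens_eq_KL_divergence:
  assumes "sigma_finite_measure \<mu>"
    and "p \<in> borel_measurable \<mu>" "AE x in \<mu>. 0 \<le> p x"
    and "q \<in> borel_measurable \<mu>" "AE x in \<mu>. 0 \<le> q x"
    and "AE x in \<mu>. q x = 0 \<longrightarrow> p x = 0"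
    and "integrable \<mu> (\<lambda>x. p x * ln (p x / q x))"
  shows "KL_dens \<mu> p q = ereal (KL_divergence (exp 1) (density \<mu> q) (density \<mu> p))"
  using KL_dens_integrable[OF assms(7)]
    sigma_finite_measure.KL_density_density[OF assms(1), of "exp 1" q p] assms
  by (simp add: log_def)

definition hellinger :: "'a measure \<Rightarrow> ('a \<Rightarrow> real) \<Rightarrow> ('a \<Rightarrow> real) \<Rightarrow> real" where
  "hellinger Q f g = sqrt (1 / 2 * (LINT x|Q. (sqrt (f x) - sqrt (g x))\<^sup>2))"


section \<open>Bracketing entropy\<close>

text \<open>The integrability condition says that the bracket widths have finite norm; without it the
  Bochner integral would assign width \<open>0\<close> to a bracket of infinite width.\<close>

definition L2_bracket_cover ::
    "'a measure \<Rightarrow> real \<Rightarrow> ('a \<Rightarrow> real) set \<Rightarrow> nat \<Rightarrow> bool" where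
  "L2_bracket_cover Q \<delta> F N \<longleftrightarrow>
     (\<exists>(fL :: nat \<Rightarrow> 'a \<Rightarrow> real) (fU :: nat \<Rightarrow> 'a \<Rightarrow> real).
        (\<forall>j<N. fL j \<in> borel_measurable Q \<and> fU j \<in> borel_measurable Q \<and>
               integrable Q (\<lambda>x. (fU j x - fL j x)\<^sup>2) \<and>
               sqrt (LINT x|Q. (fU j x - fL j x)\<^sup>2) \<le> \<delta>) \<and>
        (\<forall>f\<in>F. \<exists>j<N. \<forall>x\<in>space Q. fL j x \<le> f x \<and> f x \<le> fU j x))"

definition bracketing_number :: "'a measure \<Rightarrow> real \<Rightarrow> ('a \<Rightarrow> real) set \<Rightarrow> enat" where
  "bracketing_number Q \<delta> F = Inf {enat N |N. L2_bracket_cover Q \<delta> F N}"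

definition bracketing_entropy :: "'a measure \<Rightarrow> real \<Rightarrow> ('a \<Rightarrow> real) set \<Rightarrow> ereal" where
  "bracketing_entropy Q \<delta> F =
     (case bracketing_number Q \<delta> F of enat N \<Rightarrow> ereal (ln (real N)) | \<infinity> \<Rightarrow> \<infinity>)"


section \<open>The estimator\<close>

text \<open>Members of the function class may vanish, and then \<open>log 0 = -\<infinity>\<close> is essential for the
  maximisation (in contrast to \<open>ln 0 = 0\<close> on type \<^typ>\<open>real\<close>).\<close>

definition elog :: "real \<Rightarrow> ereal" where
  "elog t = (if 0 < t then ereal (ln t) else - \<infinity>)"

text \<open>The criterion \<open>\<integral> log g dP\<^sub>n - \<integral> g dQ\<^sub>n\<close>, where \<open>P\<^sub>n\<close> and \<open>Q\<^sub>n\<close> are the empirical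
  distributions of \<open>x 0, \<dots>, x (n - 1)\<close> and \<open>y 0, \<dots>, y (n - 1)\<close>.\<close>

definition emp_criterion ::
    "nat \<Rightarrow> (nat \<Rightarrow> 'a) \<Rightarrow> (nat \<Rightarrow> 'a) \<Rightarrow> ('a \<Rightarrow> real) \<Rightarrow> ereal" where
  "emp_criterion n x y g =
     (\<Sum>i<n. elog (g (x i))) / ereal (real n) - ereal ((\<Sum>i<n. g (y i)) / real n)"


section \<open>Boundedness in probability\<close>

text \<open>No measurability of \<open>Z n\<close> is required (a maximiser need not depend measurably on the
  samples): the exceedance set has outer probability at most \<open>\<epsilon>\<close>, which is the usual notion
  if \<open>Z n\<close> is a random variable.\<close>

definition bounded_in_prob ::
    "'w measure \<Rightarrow> (nat \<Rightarrow> 'w \<Rightarrow> ereal) \<Rightarrow> (nat \<Rightarrow> real) \<Rightarrow> bool" where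
  "bounded_in_prob M Z a \<longleftrightarrow>
     (\<forall>\<epsilon>>0. \<exists>C::real. \<forall>n\<ge>1. \<exists>E\<in>sets M.
        {\<omega> \<in> space M. ereal (C * a n) < \<bar>Z n \<omega>\<bar>} \<subseteq> E \<and> measure M E \<le> \<epsilon>)"

end

theory Submission
  imports Defs
begin

text \<open>Let \<open>s = ((g + g\<^sub>0) / 2)^(1/2)\<close>. By concavity of the logarithm, half of the log-likelihood gain
  of \<open>g\<close> over \<open>g\<^sub>0\<close> is at most
  \<open>\<Sum>\<^sub>i (2 log (s / g\<^sub>0^(1/2)) (X\<^sub>i) - (s\<^sup>2 - g\<^sub>0) (Y\<^sub>i))\<close>, and this gain is nonnegative at the estimator.
  Put \<open>\<delta> = n^(-1/(\<gamma>+2))\<close>, the scale at which the bracketing entropy is of order \<open>n \<delta>\<^sup>2\<close>, and replace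
  \<open>s\<close> by a representative \<open>c\<close> of its bracket of width \<open>\<delta>\<close>. Three facts together bound the sum by
  \<open>- n d\<^sup>2 / 16 + C n \<delta>\<^sup>2\<close>, uniformly in \<open>s\<close>, where \<open>d\<close> is the \<open>L\<^sub>2(Q)\<close> distance of \<open>s\<close> and \<open>g\<^sub>0^(1/2)\<close>:

  \<^item> a Chernoff bound and a union bound over the \<open>exp (O(n \<delta>\<^sup>2))\<close> centers \<open>c\<close>, using the negative drift
    of the log-likelihood (where a bracket is wide compared with \<open>g\<^sub>0^(1/2)\<close>, \<open>c\<close> is increased by the width
    inside the logarithm, which keeps the exponential moment under control);

  \<^item> the remaining increment from \<open>c\<close> to \<open>s\<close> is linearized, hence bounded, and its centered sum is
    at most \<open>C n \<delta>\<^sup>2\<close> by truncated chaining over the scales \<open>2^(-k) \<delta>\<close>; the sum over the scales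
    converges because \<open>\<gamma> < 2\<close>;

  \<^item> the mean of the increment is of order \<open>\<delta> d + \<delta>\<^sup>2\<close>.

  Hence \<open>d = O(\<delta>)\<close>, which is (a), and the likelihood gain per observation is \<open>O(\<delta>\<^sup>2)\<close>, which is
  \<open>o(n^(-1/2))\<close>, so that (b) reduces to the fluctuation of the criterion at \<open>g\<^sub>0\<close>.\<close>

section \<open>Tail bounds for independent samples\<close>

text \<open>For \<open>x = - y < 0\<close> the product \<open>(1 - y + y^2) * (1 + y)\<close> equals
  \<open>1 + y^3\<close>, hence is at least 1, and \<open>1 + y \<le> exp y\<close>. For
  \<open>0 \<le> x\<close> this is the usual quadratic bound.\<close>

lemma exp_le_one_plus_square:
  fixes x :: real
  assumes "x \<le> 1"
  shows "exp x \<le> 1 + x + x\<^sup>2"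
proof (cases "0 \<le> x")
  case True
  then show ?thesis using assms exp_bound by blast
next
  case False
  define y where "y = - x"
  have y: "y > 0" using False by (simp add: y_def)
  have "1 \<le> (1 - y + y\<^sup>2) * (1 + y)"
    using y by (simp add: algebra_simps power2_eq_square power3_eq_cube)
  also have "\<dots> \<le> (1 - y + y\<^sup>2) * exp y"
  proof (rule mult_left_mono)
    have "0 \<le> (1 - y)\<^sup>2" by simp
    then show "0 \<le> 1 - y + y\<^sup>2" using y by (simp add: power2_eq_square algebra_simps)
  qed (rule exp_ge_add_one_self)
  finally have "exp (- y) \<le> 1 - y + y\<^sup>2"
    by (simp add: exp_minus field_simps)
  then show ?thesis by (simp add: y_def)
qed

lemma integrable_of_bounded:
  fixes f :: "'a \<Rightarrow> real"
  assumes "prob_space D" "f \<in> borel_measurable D" "\<And>z. z \<in> space D \<Longrightarrow> \<bar>f z\<bar> \<le> a"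
  shows "integrable D f"
proof -
  interpret prob_space D by fact
  show ?thesis
    by (rule integrable_const_bound[where B=a]) (use assms in auto)
qed

text \<open>Applied to pairs of one \<open>X\<close> and one \<open>Y\<close> observation, so that
  both samples together form a single i.i.d. sequence whose common law \<open>D\<close> is a product
  measure.\<close>

locale iid_sequence = prob_space M for M :: "'w measure" +
  fixes D :: "'z measure" and Z :: "nat \<Rightarrow> 'w \<Rightarrow> 'z"
  assumes indep: "indep_vars (\<lambda>_. D) Z UNIV"
    and distr_eq: "distr M D (Z i) = D"
begin

lemma Z_measurable [measurable]: "Z i \<in> measurable M D"
  using indep unfolding indep_vars_def2 by blast

lemma Z_space: "\<omega> \<in> space M \<Longrightarrow> Z i \<omega> \<in> space D"
  by (rule measurable_space[OF Z_measurable])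

lemma prob_space_D: "prob_space D"
  using prob_space_distr[OF Z_measurable, of 0] by (simp add: distr_eq)

lemma integral_Z:
  fixes \<phi> :: "'z \<Rightarrow> real"
  assumes "\<phi> \<in> borel_measurable D"
  shows "expectation (\<lambda>\<omega>. \<phi> (Z i \<omega>)) = (LINT z|D. \<phi> z)"
  using integral_distr[OF Z_measurable assms, of i] by (simp add: distr_eq)

lemma integrable_Z:
  fixes \<phi> :: "'z \<Rightarrow> real"
  assumes "integrable D \<phi>"
  shows "integrable M (\<lambda>\<omega>. \<phi> (Z i \<omega>))"
  using integrable_distr[OF Z_measurable, of i \<phi>] assms by (simp add: distr_eq)

text \<open>Markov's inequality for the exponential of the sum, whose mean factorizes by
  independence. The tilt \<open>l\<close> stays free because centers and chaining links call for
  different choices.\<close>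

lemma chernoff:
  fixes \<phi> :: "'z \<Rightarrow> real"
  assumes \<phi>: "\<phi> \<in> borel_measurable D" and l: "0 < l"
    and int: "integrable D (\<lambda>z. exp (l * \<phi> z))"
    and le: "(LINT z|D. exp (l * \<phi> z)) \<le> exp m"
  shows "prob {\<omega> \<in> space M. t \<le> (\<Sum>i<n. \<phi> (Z i \<omega>))} \<le> exp (real n * m - l * t)"
proof -
  note [measurable] = \<phi>
  let ?E = "\<lambda>i \<omega>. exp (l * \<phi> (Z i \<omega>))"
  have ind: "indep_vars (\<lambda>_. borel) ?E {..<n}"
    by (rule indep_vars_subset[OF indep_vars_compose2[OF indep]]) auto
  have intE: "integrable M (?E i)" for i
    by (rule integrable_Z[OF int])
  have prod: "(\<Prod>i<n. ?E i \<omega>) = exp (l * (\<Sum>i<n. \<phi> (Z i \<omega>)))" for \<omega>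
    by (simp add: exp_sum sum_distrib_left)
  have intp: "integrable M (\<lambda>\<omega>. \<Prod>i<n. ?E i \<omega>)"
    by (cases "n = 0") (auto intro!: indep_vars_integrable ind intE)
  have e0: "0 \<le> (LINT z|D. exp (l * \<phi> z))" by (rule integral_nonneg_AE) auto
  have "prob {\<omega> \<in> space M. t \<le> (\<Sum>i<n. \<phi> (Z i \<omega>))} = prob {\<omega> \<in> space M. exp (l * t) \<le> (\<Prod>i<n. ?E i \<omega>)}"
    unfolding prod using l by simp
  also have "\<dots> \<le> expectation (\<lambda>\<omega>. \<Prod>i<n. ?E i \<omega>) / exp (l * t)"
    by (rule integral_Markov_inequality_measure[where A = "{}", OF intp]) (auto intro!: prod_nonneg)
  also have "expectation (\<lambda>\<omega>. \<Prod>i<n. ?E i \<omega>) = (\<Prod>i<n. expectation (?E i))"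
    by (cases "n = 0") (auto intro!: indep_vars_lebesgue_integral ind intE simp: prob_space)
  also have "\<dots> = (LINT z|D. exp (l * \<phi> z)) ^ n"
    using integral_Z[of "\<lambda>z. exp (l * \<phi> z)"] by simp
  also have "\<dots> \<le> exp m ^ n" by (rule power_mono[OF le e0])
  finally show ?thesis
    by (simp add: exp_of_nat_mult[symmetric] exp_diff divide_right_mono)
qed

definition deviation :: "nat \<Rightarrow> ('z \<Rightarrow> real) \<Rightarrow> 'w \<Rightarrow> real" where
  "deviation n \<phi> \<omega> = (\<Sum>i<n. \<phi> (Z i \<omega>)) - real n * (LINT z|D. \<phi> z)"

text \<open>Chernoff bound with tilt \<open>1 / a\<close>, for which the exponent stays at most 1
  and the quadratic bound on \<open>exp\<close> applies. The raw second moment suffices: the mean is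
  carried into the exponent by \<open>1 + x \<le> exp x\<close> and cancels against the
  centering.\<close>

lemma deviation_tail:
  fixes \<phi> :: "'z \<Rightarrow> real"
  assumes \<phi>: "\<phi> \<in> borel_measurable D" and b: "\<And>z. z \<in> space D \<Longrightarrow> \<bar>\<phi> z\<bar> \<le> a" and a: "0 < a"
    and v: "(LINT z|D. (\<phi> z)\<^sup>2) \<le> v"
  shows "prob {\<omega> \<in> space M. t \<le> deviation n \<phi> \<omega>} \<le> exp (real n * v / a\<^sup>2 - t / a)"
proof -
  interpret D: prob_space D by (rule prob_space_D)
  note [measurable] = \<phi>
  have i1: "integrable D \<phi>" by (rule D.integrable_const_bound[where B=a]) (use b in auto)
  have i2: "integrable D (\<lambda>z. (\<phi> z)\<^sup>2)"
    by (rule D.integrable_const_bound[where B="a\<^sup>2"]) (use b abs_le_square_iff in fastforce)+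
  let ?m = "LINT z|D. \<phi> z"
  have le: "exp ((1 / a) * \<phi> z) \<le> 1 + (1 / a) * \<phi> z + (1 / a\<^sup>2) * (\<phi> z)\<^sup>2" if "z \<in> space D" for z
    using exp_le_one_plus_square[of "(1 / a) * \<phi> z"] b[OF that] a
    by (simp add: power_divide field_simps)
  have ie: "integrable D (\<lambda>z. exp ((1 / a) * \<phi> z))"
    by (rule D.integrable_const_bound[where B="exp 1"]) (use b a in \<open>auto simp: abs_le_iff field_simps\<close>)
  have "(LINT z|D. exp ((1 / a) * \<phi> z)) \<le> (LINT z|D. 1 + (1 / a) * \<phi> z + (1 / a\<^sup>2) * (\<phi> z)\<^sup>2)"
    by (rule integral_mono_AE[OF ie]) (use i1 i2 le in auto)
  also have "\<dots> = 1 + (1 / a) * ?m + (1 / a\<^sup>2) * (LINT z|D. (\<phi> z)\<^sup>2)"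
    using i1 i2 by (simp add: D.prob_space)
  also have "\<dots> \<le> 1 + ((1 / a) * ?m + (1 / a\<^sup>2) * v)"
    using mult_left_mono[OF v, of "1 / a\<^sup>2"] by simp
  also have "\<dots> \<le> exp ((1 / a) * ?m + (1 / a\<^sup>2) * v)"
    using exp_ge_add_one_self by simp
  finally have "prob {\<omega> \<in> space M. t + real n * ?m \<le> (\<Sum>i<n. \<phi> (Z i \<omega>))} \<le>
      exp (real n * ((1 / a) * ?m + (1 / a\<^sup>2) * v) - (1 / a) * (t + real n * ?m))"
    using a by (intro chernoff \<phi> ie) auto
  also have "real n * ((1 / a) * ?m + (1 / a\<^sup>2) * v) - (1 / a) * (t + real n * ?m) = real n * v / a\<^sup>2 - t / a"
    by (simp add: algebra_simps add_divide_distrib)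
  finally show ?thesis
    by (simp add: deviation_def le_diff_eq)
qed

lemma deviation_measurable [measurable]:
  assumes [measurable]: "\<phi> \<in> borel_measurable D"
  shows "deviation n \<phi> \<in> borel_measurable M"
  unfolding deviation_def[abs_def] by measurable

lemma deviation_add:
  assumes "integrable D f" "integrable D g"
  shows "deviation n (\<lambda>z. f z + g z) \<omega> = deviation n f \<omega> + deviation n g \<omega>"
  using assms by (simp add: deviation_def sum.distrib algebra_simps)

text \<open>Serves for the links cut by the truncation, which are known only through a dominating
  function: the sums compare directly, and each of the two means costs at most \<open>n\<close>
  times the mean of \<open>g\<close>.\<close>

lemma deviation_le:
  assumes f: "integrable D f" and g: "integrable D g" and fg: "\<And>z. z \<in> space D \<Longrightarrow> \<bar>f z\<bar> \<le> g z"
    and \<omega>: "\<omega> \<in> space M"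
  shows "deviation n f \<omega> \<le> deviation n g \<omega> + 2 * real n * (LINT z|D. g z)"
proof -
  have "(\<Sum>i<n. f (Z i \<omega>)) \<le> (\<Sum>i<n. g (Z i \<omega>))"
    using fg Z_space[OF \<omega>] by (intro sum_mono) (meson abs_le_D1)
  moreover have "- (LINT z|D. g z) \<le> (LINT z|D. f z)"
    using integral_mono_AE[of D "\<lambda>z. - g z" f] f g fg by (force simp: abs_le_iff)
  from mult_left_mono[OF this, of "real n"] have "- (real n * (LINT z|D. g z)) \<le> real n * (LINT z|D. f z)" by simp
  ultimately show ?thesis by (simp add: deviation_def)
qed

lemma prob_UN_le:
  assumes "finite J" "\<And>j. j \<in> J \<Longrightarrow> E j \<in> events" "\<And>j. j \<in> J \<Longrightarrow> prob (E j) \<le> e"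
  shows "prob (\<Union>j\<in>J. E j) \<le> real (card J) * e"
proof -
  have "prob (\<Union>j\<in>J. E j) \<le> (\<Sum>j\<in>J. prob (E j))"
    using assms by (intro finite_measure_subadditive_finite) auto
  also have "\<dots> \<le> real (card J) * e" using sum_bounded_above[of J "\<lambda>j. prob (E j)" e] assms(3) by simp
  finally show ?thesis .
qed

end

section \<open>Truncated chaining\<close>

lemma geometric_sum_le:
  fixes r :: real
  assumes "0 \<le> r" "r < 1"
  shows "(\<Sum>k<N. r ^ k) \<le> 1 / (1 - r)"
proof -
  have "(1 - r) * (\<Sum>k<N. r ^ k) = 1 - r ^ N" by (simp add: one_diff_power_eq)
  then have "(1 - r) * (\<Sum>k<N. r ^ k) \<le> 1" using assms by simp
  then show ?thesis using assms by (simp add: field_simps)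
qed

lemma exp_minus_le_inverse:
  fixes x :: real
  assumes "0 < x"
  shows "exp (- x) \<le> 1 / x"
proof -
  have "x \<le> exp x" using exp_ge_add_one_self[of x] by linarith
  then show ?thesis using assms by (simp add: exp_minus field_simps)
qed

context iid_sequence
begin

text \<open>The map \<open>rep k\<close> picks a representative of the cell of level \<open>k\<close>, and \<open>W k t\<close> is the width of the
  cell of \<open>t\<close>. At each point the chain is followed only up to the first level whose width exceeds
  \<open>a q\<^sup>k\<close>: up to there all links are bounded by \<open>a q\<^sup>k\<close>, and the link that is cut has mean at most
  \<open>L v / (4\<^sup>k a q\<^sup>k)\<close> by Markov's inequality. With \<open>p = 2^\<gamma>\<close>, the identities \<open>r = p q\<close> and \<open>4 q r = 1\<close>
  balance entropy, variance and range on every level.\<close>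

lemma chaining:
  fixes F :: "'t \<Rightarrow> 'z \<Rightarrow> real" and W :: "nat \<Rightarrow> 't \<Rightarrow> 'z \<Rightarrow> real" and rep :: "nat \<Rightarrow> 't \<Rightarrow> 't"
  assumes rep_in: "\<And>k t. t \<in> T \<Longrightarrow> rep k t \<in> T"
    and rep_rep: "\<And>j k t. t \<in> T \<Longrightarrow> j \<le> k \<Longrightarrow> rep j (rep k t) = rep j t"
    and W_rep: "\<And>j k t. t \<in> T \<Longrightarrow> j \<le> k \<Longrightarrow> W j (rep k t) = W j t"
    and fin: "\<And>k. finite (rep k ` T)"
    and card: "\<And>k. real (card (rep k ` T)) \<le> exp (B * p ^ k * (real n * v))"
    and F_meas: "\<And>t. t \<in> T \<Longrightarrow> F t \<in> borel_measurable D"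
    and W_meas: "\<And>k t. t \<in> T \<Longrightarrow> W k t \<in> borel_measurable D"
    and F_le_W: "\<And>k t z. t \<in> T \<Longrightarrow> z \<in> space D \<Longrightarrow> \<bar>F t z - F (rep k t) z\<bar> \<le> W k t z"
    and W_mono: "\<And>k t z. t \<in> T \<Longrightarrow> z \<in> space D \<Longrightarrow> W (Suc k) t z \<le> W k t z"
    and W_0: "\<And>t z. t \<in> T \<Longrightarrow> z \<in> space D \<Longrightarrow> W 0 t z \<le> a"
    and W_L2: "\<And>k t. t \<in> T \<Longrightarrow> (LINT z|D. (W k t z)\<^sup>2) \<le> L * v / 4 ^ k"
    and params: "0 < q" "q < 1" "0 < r" "r < 1" "1 < p" "r = p * q" "4 * q * r = 1"
    and a: "0 < a" and nv: "1 \<le> real n * v" and C: "0 \<le> C" and m: "m = C / a - L / a\<^sup>2 - B * p" "0 < m"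
  shows "\<exists>E\<in>events. prob E \<le> 2 / (m * (1 - 1 / p)) \<and>
    (\<forall>\<omega>\<in>space M - E. \<forall>t\<in>T. deviation n (\<lambda>z. F t z - F (rep 0 t) z) \<omega>
        \<le> (2 * C / (1 - r) + 2 * L / (a * (1 - r)) + 1) * (real n * v))"
proof (cases "T = {}")
  case True
  then show ?thesis using params m by (intro bexI[of _ "{}"]) (auto simp: field_simps)
next
  case False
  interpret D: prob_space D by (rule prob_space_D)
  have "0 < real n * v" using nv by linarith
  then have v: "0 < v" and n: "0 < real n" by (auto simp: zero_less_mult_iff)
  have W_nonneg: "0 \<le> W k t z" if "t \<in> T" "z \<in> space D" for k t z
    using F_le_W[OF that, of k] by linarith
  obtain t0 where t0: "t0 \<in> T" using False by blast
  have "0 \<le> (LINT z|D. (W 0 t0 z)\<^sup>2)" by (rule integral_nonneg_AE) auto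
  also have "\<dots> \<le> L * v" using W_L2[OF t0, of 0] by simp
  finally have "0 \<le> L * v" .
  then have L: "0 \<le> L" using v by (simp add: zero_le_mult_iff)

  \<comment> \<open>\<open>A k t z\<close> says that the chain of \<open>t\<close> at the point
    \<open>z\<close> is still alive at level \<open>k\<close>. \<open>I\<close> is the link from
    level \<open>k\<close> to the next, \<open>R\<close> the error left while the chain is alive,
    \<open>R'\<close> the error at the moment of the cut, and \<open>J\<close> the width that
    dominates \<open>R'\<close>.\<close>
  define A where "A k t z \<longleftrightarrow> (\<forall>j\<le>k. W j t z \<le> a * q ^ j)" for k t z
  define I where "I k t z = (if A k t z then F (rep (Suc k) t) z - F (rep k t) z else 0)" for k t z
  define J where "J k t z = (if A k t z \<and> \<not> A (Suc k) t z then W (Suc k) t z else 0)" for k t z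
  define R where "R k t z = (if A k t z then F t z - F (rep k t) z else 0)" for k t z
  define R' where "R' k t z = (if A k t z \<and> \<not> A (Suc k) t z then F t z - F (rep (Suc k) t) z else 0)" for k t z

  have A_rep: "A k (rep (Suc k) t) z = A k t z" "A (Suc k) (rep (Suc k) t) z = A (Suc k) t z"
    if "t \<in> T" for k t z
    using W_rep[OF that, of _ "Suc k"] by (auto simp: A_def)
  \<comment> \<open>The functions of level \<open>k\<close> depend on \<open>t\<close> only through
    its cell of level \<open>Suc k\<close>, so a union bound over the finitely many representatives
    of that level covers all of \<open>T\<close>.\<close>
  have I_rep: "I k (rep (Suc k) t) = I k t" and J_rep: "J k (rep (Suc k) t) = J k t" if "t \<in> T" for k t
    using that by (auto simp: I_def J_def A_rep W_rep rep_rep fun_eq_iff)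
  have A_0: "A 0 t z" if "t \<in> T" "z \<in> space D" for t z
    using W_0[OF that] by (simp add: A_def)
  have A_Suc: "A (Suc k) t z \<Longrightarrow> A k t z" for k t z by (auto simp: A_def)
  have A_le: "W k t z \<le> a * q ^ k" if "A k t z" for k t z using that by (auto simp: A_def)

  have A_meas: "Measurable.pred D (A k t)" if "t \<in> T" for k t
    unfolding A_def[abs_def] using W_meas[OF that] by measurable
  have I_meas: "I k t \<in> borel_measurable D" and J_meas: "J k t \<in> borel_measurable D"
    and R_meas: "R k t \<in> borel_measurable D" and R'_meas: "R' k t \<in> borel_measurable D"
    if t: "t \<in> T" for k t
  proof -
    note [measurable] = A_meas[OF t] F_meas[OF t] W_meas[OF t] F_meas[OF rep_in[OF t]]
    show "I k t \<in> borel_measurable D" unfolding I_def[abs_def] by measurable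
    show "J k t \<in> borel_measurable D" unfolding J_def[abs_def] by measurable
    show "R k t \<in> borel_measurable D" unfolding R_def[abs_def] by measurable
    show "R' k t \<in> borel_measurable D" unfolding R'_def[abs_def] by measurable
  qed

  have I_W: "\<bar>I k t z\<bar> \<le> W k t z" if "t \<in> T" "z \<in> space D" for k t z
    using F_le_W[OF rep_in[OF that(1), of "Suc k"] that(2), of k] W_nonneg[OF that] that
    by (auto simp: I_def rep_rep W_rep)
  have I_le: "\<bar>I k t z\<bar> \<le> a * q ^ k" if "t \<in> T" "z \<in> space D" for k t z
    using I_W[OF that, of k] A_le[of k t z] a params by (cases "A k t z") (auto simp: I_def)
  have J_W: "\<bar>J k t z\<bar> \<le> W (Suc k) t z" if "t \<in> T" "z \<in> space D" for k t z
    using W_nonneg[OF that] by (auto simp: J_def)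
  have J_le: "\<bar>J k t z\<bar> \<le> a * q ^ k" if "t \<in> T" "z \<in> space D" for k t z
  proof (cases "A k t z")
    case True
    then show ?thesis
      using A_le[OF True] W_mono[OF that, of k] J_W[OF that, of k] by linarith
  qed (use a params in \<open>auto simp: J_def\<close>)
  have R_le: "\<bar>R k t z\<bar> \<le> a * q ^ k" if "t \<in> T" "z \<in> space D" for k t z
    using F_le_W[OF that, of k] A_le[of k t z] a params by (auto simp: R_def)
  have R'_J: "\<bar>R' k t z\<bar> \<le> J k t z" if "t \<in> T" "z \<in> space D" for k t z
    using F_le_W[OF that, of "Suc k"] by (auto simp: R'_def J_def)
  have W_le: "\<bar>W k t z\<bar> \<le> a" if "t \<in> T" "z \<in> space D" for k t z
  proof -
    have "W k t z \<le> a"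
      by (induction k) (use W_0[OF that] W_mono[OF that] order_trans in blast)+
    then show ?thesis using W_nonneg[OF that, of k] by simp
  qed
  note int_b = integrable_of_bounded[OF prob_space_D]
  have I_int: "integrable D (I k t)" and J_int: "integrable D (J k t)" and R_int: "integrable D (R k t)"
    if "t \<in> T" for k t
    using int_b[OF I_meas[OF that] I_le[OF that]] int_b[OF J_meas[OF that] J_le[OF that]]
      int_b[OF R_meas[OF that] R_le[OF that]] by blast+
  have R'_int: "integrable D (R' k t)" if "t \<in> T" for k t
    using int_b[OF R'_meas[OF that], of k "a * q ^ k"] R'_J[OF that, of _ k] J_le[OF that, of _ k] by force
  have W2_int: "integrable D (\<lambda>z. (W k t z)\<^sup>2)" if "t \<in> T" for k t
  proof (rule int_b)
    show "(\<lambda>z. (W k t z)\<^sup>2) \<in> borel_measurable D" using W_meas[OF that] by measurable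
    show "\<bar>(W k t z)\<^sup>2\<bar> \<le> a\<^sup>2" if "z \<in> space D" for z
      using power_mono[OF W_le[OF \<open>t \<in> T\<close> that, of k], of 2] by simp
  qed

  \<comment> \<open>The mean of a cut link carries the factor \<open>1 / (4^k q^k)\<close>, and the
    variance term of its tail bound the factor \<open>1 / (4^k q^(2k))\<close>. The balance
    conditions turn them into \<open>r^k\<close>, which is summable, and \<open>p^k\<close>, the
    growth of the entropy.\<close>
  have r_eq: "1 / (4 ^ k * q ^ k) = r ^ k" for k
  proof -
    have "(4 * q * r) ^ k = 1" using params by simp
    then show ?thesis using params by (simp add: power_mult_distrib field_simps)
  qed
  have p_eq: "1 / (4 ^ k * (q ^ k)\<^sup>2) = p ^ k" for k
  proof -
    have "r ^ k = p ^ k * q ^ k" using params by (simp add: power_mult_distrib)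
    then have "p ^ k = r ^ k / q ^ k" using params by simp
    also have "\<dots> = 1 / (4 ^ k * (q ^ k)\<^sup>2)" unfolding r_eq[symmetric] by (simp add: power2_eq_square)
    finally show ?thesis by simp
  qed

  have sq_le: "(LINT z|D. (\<phi> z)\<^sup>2) \<le> L * v / 4 ^ k"
    if t: "t \<in> T" and \<phi>: "\<And>z. z \<in> space D \<Longrightarrow> \<bar>\<phi> z\<bar> \<le> W k t z" for \<phi> k t
  proof -
    have "(LINT z|D. (\<phi> z)\<^sup>2) \<le> (LINT z|D. (W k t z)\<^sup>2)"
      by (rule integral_mono_AE'[OF W2_int[OF t]])
        (use \<phi> abs_le_square_iff W_le[OF t] in \<open>fastforce intro!: AE_I2\<close>)+
    with W_L2[OF t, of k] show ?thesis by linarith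
  qed
  have J_mean: "(LINT z|D. J k t z) \<le> L * v * r ^ k / a" if t: "t \<in> T" for k t
  proof -
    have "(LINT z|D. J k t z) \<le> (LINT z|D. (W (Suc k) t z)\<^sup>2 / (a * q ^ Suc k))"
    proof (rule integral_mono_AE[OF J_int[OF t]])
      show "integrable D (\<lambda>z. (W (Suc k) t z)\<^sup>2 / (a * q ^ Suc k))" using W2_int[OF t] by simp
      show "AE z in D. J k t z \<le> (W (Suc k) t z)\<^sup>2 / (a * q ^ Suc k)"
      proof (rule AE_I2)
        fix z assume z: "z \<in> space D"
        have aq: "0 < a * q ^ Suc k" using a params by simp
        show "J k t z \<le> (W (Suc k) t z)\<^sup>2 / (a * q ^ Suc k)"
        proof (cases "A k t z \<and> \<not> A (Suc k) t z")
          case True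
          \<comment> \<open>The chain is alive at level \<open>k\<close> but not at the next, so it
            is the width of level \<open>Suc k\<close> that exceeds its threshold. Multiplying by
            this width gives the Markov-type bound.\<close>
          then have "a * q ^ Suc k < W (Suc k) t z"
            by (auto simp: A_def le_Suc_eq)
          then have "W (Suc k) t z * (a * q ^ Suc k) \<le> W (Suc k) t z * W (Suc k) t z"
            using W_nonneg[OF t z] by (intro mult_left_mono) auto
          then show ?thesis using True aq by (simp add: J_def power2_eq_square pos_le_divide_eq)
        qed (use aq in \<open>auto simp: J_def\<close>)
      qed
    qed
    also have "\<dots> = (LINT z|D. (W (Suc k) t z)\<^sup>2) / (a * q ^ Suc k)" by simp
    also have "\<dots> \<le> (L * v / 4 ^ Suc k) / (a * q ^ Suc k)"
      by (rule divide_right_mono[OF W_L2[OF t]]) (use a params in simp)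
    also have "\<dots> = (L * v / a) * (1 / (4 ^ Suc k * q ^ Suc k))" by simp
    also have "\<dots> = (L * v / a) * r ^ Suc k" unfolding r_eq ..
    also have "\<dots> \<le> (L * v / a) * r ^ k"
      using L v a params by (intro mult_left_mono power_decreasing) auto
    finally show ?thesis by simp
  qed

  \<comment> \<open>The allowances decay like \<open>r^k\<close> and thus have a finite sum, while
    relative to the range \<open>a * q^k\<close> they grow like \<open>p^k\<close> and keep up with
    the entropy.\<close>
  define u where "u k = real n * (C * v * r ^ k)" for k
  define bad where "bad k = (\<Union>t\<in>rep (Suc k) ` T. {\<omega> \<in> space M. u k \<le> deviation n (I k t) \<omega>})
      \<union> (\<Union>t\<in>rep (Suc k) ` T. {\<omega> \<in> space M. u k \<le> deviation n (J k t) \<omega>})" for k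
  have bad_ev: "bad k \<in> events" for k
  proof -
    have "{\<omega> \<in> space M. u k \<le> deviation n \<phi> \<omega>} \<in> events" if [measurable]: "\<phi> \<in> borel_measurable D" for \<phi>
      by measurable
    then show ?thesis unfolding bad_def
      using fin[of "Suc k"] I_meas J_meas rep_in by (intro sets.Un sets.finite_UN) auto
  qed
  have tail: "prob {\<omega> \<in> space M. u k \<le> deviation n \<phi> \<omega>} \<le> exp (- (real n * v * p ^ k * (C / a - L / a\<^sup>2)))"
    if "t \<in> T" "\<phi> \<in> borel_measurable D" "\<And>z. z \<in> space D \<Longrightarrow> \<bar>\<phi> z\<bar> \<le> a * q ^ k"
      "(LINT z|D. (\<phi> z)\<^sup>2) \<le> L * v / 4 ^ k" for k \<phi> t
  proof -
    have "prob {\<omega> \<in> space M. u k \<le> deviation n \<phi> \<omega>} \<le> exp (real n * (L * v / 4 ^ k) / (a * q ^ k)\<^sup>2 - u k / (a * q ^ k))"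
      using that a params by (intro deviation_tail) auto
    also have "real n * (L * v / 4 ^ k) / (a * q ^ k)\<^sup>2 = real n * v * L / a\<^sup>2 * (1 / (4 ^ k * (q ^ k)\<^sup>2))"
      by (simp add: power_mult_distrib mult_ac)
    also have "\<dots> = real n * v * p ^ k * (L / a\<^sup>2)" unfolding p_eq by simp
    also have "u k / (a * q ^ k) = real n * v * p ^ k * (C / a)"
      using params by (simp add: u_def power_mult_distrib)
    finally show ?thesis by (simp add: algebra_simps)
  qed
  have bad_le: "prob (bad k) \<le> 2 / m * (1 / p) ^ k" for k
  proof -
    let ?e = "exp (- (real n * v * p ^ k * (C / a - L / a\<^sup>2)))"
    have b: "prob (\<Union>t\<in>rep (Suc k) ` T. {\<omega> \<in> space M. u k \<le> deviation n (G t) \<omega>}) \<le> real (card (rep (Suc k) ` T)) * ?e"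
      if G: "\<And>t. t \<in> T \<Longrightarrow> G t \<in> borel_measurable D" "\<And>t z. t \<in> T \<Longrightarrow> z \<in> space D \<Longrightarrow> \<bar>G t z\<bar> \<le> a * q ^ k"
      "\<And>t. t \<in> T \<Longrightarrow> (LINT z|D. (G t z)\<^sup>2) \<le> L * v / 4 ^ k" for G
    proof (rule prob_UN_le[OF fin])
      fix t assume "t \<in> rep (Suc k) ` T"
      then have t: "t \<in> T" using rep_in by auto
      note [measurable] = G(1)[OF t]
      show "{\<omega> \<in> space M. u k \<le> deviation n (G t) \<omega>} \<in> events" by measurable
      show "prob {\<omega> \<in> space M. u k \<le> deviation n (G t) \<omega>} \<le> ?e" by (rule tail[OF t]) (use G t in auto)
    qed
    have J2: "(LINT z|D. (J k t z)\<^sup>2) \<le> L * v / 4 ^ k" if t: "t \<in> T" for t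
    proof (rule sq_le[OF t])
      fix z assume z: "z \<in> space D"
      show "\<bar>J k t z\<bar> \<le> W k t z" using J_W[OF t z, of k] W_mono[OF t z, of k] by linarith
    qed
    have "prob (bad k) \<le> real (card (rep (Suc k) ` T)) * ?e + real (card (rep (Suc k) ` T)) * ?e"
      unfolding bad_def
    proof (rule order_trans[OF measure_Un_le add_mono])
      have ev: "(\<Union>t\<in>rep (Suc k) ` T. {\<omega> \<in> space M. u k \<le> deviation n (G t) \<omega>}) \<in> events"
        if "\<And>t. t \<in> T \<Longrightarrow> G t \<in> borel_measurable D" for G
      proof (rule sets.finite_UN[OF fin])
        fix t assume "t \<in> rep (Suc k) ` T"
        then have [measurable]: "G t \<in> borel_measurable D" using rep_in that by auto
        show "{\<omega> \<in> space M. u k \<le> deviation n (G t) \<omega>} \<in> events" by measurable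
      qed
      show "(\<Union>t\<in>rep (Suc k) ` T. {\<omega> \<in> space M. u k \<le> deviation n (I k t) \<omega>}) \<in> events"
        by (rule ev[OF I_meas])
      show "(\<Union>t\<in>rep (Suc k) ` T. {\<omega> \<in> space M. u k \<le> deviation n (J k t) \<omega>}) \<in> events"
        by (rule ev[OF J_meas])
      show "prob (\<Union>t\<in>rep (Suc k) ` T. {\<omega> \<in> space M. u k \<le> deviation n (I k t) \<omega>}) \<le> real (card (rep (Suc k) ` T)) * ?e"
        by (rule b[OF I_meas I_le]) (auto intro!: sq_le I_W)
      show "prob (\<Union>t\<in>rep (Suc k) ` T. {\<omega> \<in> space M. u k \<le> deviation n (J k t) \<omega>}) \<le> real (card (rep (Suc k) ` T)) * ?e"
        by (rule b[OF J_meas J_le]) (auto intro!: J2)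
    qed
    also have "\<dots> = 2 * (real (card (rep (Suc k) ` T)) * ?e)" by simp
    also have "\<dots> \<le> 2 * (exp (B * p ^ Suc k * (real n * v)) * ?e)"
      by (intro mult_left_mono mult_right_mono card) auto
    \<comment> \<open>The union runs over the representatives of level \<open>Suc k\<close>, so the
      entropy exceeds the scale \<open>p^k\<close> by one factor \<open>p\<close>; this is the term
      \<open>B * p\<close> in \<open>m\<close>.\<close>
    also have "exp (B * p ^ Suc k * (real n * v)) * ?e = exp (- (m * p ^ k * (real n * v)))"
      unfolding exp_add[symmetric] m by (simp add: algebra_simps)
    also have "exp (- (m * p ^ k * (real n * v))) \<le> exp (- (m * p ^ k))"
    proof -
      have "m * p ^ k * 1 \<le> m * p ^ k * (real n * v)" using nv m params by (intro mult_left_mono) auto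
      then show ?thesis by simp
    qed
    also have "\<dots> \<le> 1 / (m * p ^ k)" using m params by (intro exp_minus_le_inverse) auto
    finally show ?thesis by (simp add: power_one_over)
  qed

  \<comment> \<open>Finitely many levels suffice: an uncut remainder is bounded by
    \<open>a * q^N\<close>, so once \<open>2 * a * q^N < v\<close> its centered sum is at most
    \<open>n * v\<close> on every sample.\<close>
  have "(\<lambda>N. 2 * a * q ^ N) \<longlonglongrightarrow> 2 * a * 0"
    using params by (intro tendsto_mult_left LIMSEQ_realpow_zero) auto
  then have "\<forall>\<^sub>F N in sequentially. 2 * a * q ^ N < v"
    using v by (intro order_tendstoD) auto
  then obtain N where N: "2 * a * q ^ N < v" by (auto simp: eventually_sequentially)

  define E where "E = (\<Union>k<N. bad k)"
  have E_ev: "E \<in> events" unfolding E_def using bad_ev by auto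
  have "prob E \<le> (\<Sum>k<N. prob (bad k))"
    unfolding E_def using bad_ev by (intro finite_measure_subadditive_finite) auto
  also have "\<dots> \<le> (\<Sum>k<N. 2 / m * (1 / p) ^ k)" by (rule sum_mono[OF bad_le])
  also have "\<dots> = 2 / m * (\<Sum>k<N. (1 / p) ^ k)" by (simp add: sum_distrib_left)
  also have "\<dots> \<le> 2 / m * (1 / (1 - 1 / p))"
    using m params by (intro mult_left_mono geometric_sum_le) auto
  finally have E_le: "prob E \<le> 2 / (m * (1 - 1 / p))" by simp

  have step: "deviation n (R 0 t) \<omega> \<le> (\<Sum>k<K. deviation n (I k t) \<omega> + deviation n (J k t) \<omega> + 2 * real n * (LINT z|D. J k t z))
      + deviation n (R K t) \<omega>" if t: "t \<in> T" and \<omega>: "\<omega> \<in> space M" for t \<omega> K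
  proof (induction K)
    case (Suc K)
    \<comment> \<open>If the chain is alive at level \<open>K\<close>, follow the link; the rest of
      the error is either still alive at level \<open>Suc K\<close> or is cut there.\<close>
    have "R K t z = I K t z + (R' K t z + R (Suc K) t z)" for z
      using A_Suc[of K t z] by (auto simp: R_def I_def R'_def)
    then have "R K t = (\<lambda>z. I K t z + (R' K t z + R (Suc K) t z))" by auto
    then have "deviation n (R K t) \<omega> = deviation n (I K t) \<omega> + (deviation n (R' K t) \<omega> + deviation n (R (Suc K) t) \<omega>)"
      using I_int[OF t] R'_int[OF t] R_int[OF t] by (simp add: deviation_add)
    moreover have "deviation n (R' K t) \<omega> \<le> deviation n (J K t) \<omega> + 2 * real n * (LINT z|D. J K t z)"
      by (rule deviation_le[OF R'_int[OF t] J_int[OF t] R'_J[OF t] \<omega>])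
    ultimately show ?case using Suc by simp
  qed simp

  have main: "deviation n (\<lambda>z. F t z - F (rep 0 t) z) \<omega>
        \<le> (2 * C / (1 - r) + 2 * L / (a * (1 - r)) + 1) * (real n * v)"
    if \<omega>: "\<omega> \<in> space M" "\<omega> \<notin> E" and t: "t \<in> T" for \<omega> t
  proof -
    \<comment> \<open>Nothing is cut at level 0, because \<open>W 0\<close> is at most
      \<open>a\<close>.\<close>
    have "deviation n (\<lambda>z. F t z - F (rep 0 t) z) \<omega> = deviation n (R 0 t) \<omega>"
      using A_0[OF t] Z_space[OF \<omega>(1)] unfolding deviation_def
      by (auto simp: R_def intro!: sum.cong arg_cong2[of _ _ _ _ "(-)"] arg_cong2[of _ _ _ _ "(*)"] Bochner_Integration.integral_cong)
    also have "\<dots> \<le> (\<Sum>k<N. deviation n (I k t) \<omega> + deviation n (J k t) \<omega> + 2 * real n * (LINT z|D. J k t z))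
      + deviation n (R N t) \<omega>" by (rule step[OF t \<omega>(1)])
    also have "\<dots> \<le> (\<Sum>k<N. (2 * C + 2 * L / a) * (real n * v) * r ^ k) + real n * v"
    proof (intro add_mono sum_mono)
      fix k assume "k \<in> {..<N}"
      then have nb: "\<omega> \<notin> bad k" using \<omega> by (auto simp: E_def)
      then have "\<not> u k \<le> deviation n (I k (rep (Suc k) t)) \<omega>" "\<not> u k \<le> deviation n (J k (rep (Suc k) t)) \<omega>"
        using \<omega> t unfolding bad_def by blast+
      then have "deviation n (I k t) \<omega> \<le> u k" "deviation n (J k t) \<omega> \<le> u k"
        by (simp_all add: I_rep[OF t] J_rep[OF t])
      moreover have "real n * (LINT z|D. J k t z) \<le> real n * (L * v * r ^ k / a)"
        by (intro mult_left_mono J_mean[OF t]) simp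
      ultimately have "deviation n (I k t) \<omega> + deviation n (J k t) \<omega> + 2 * real n * (LINT z|D. J k t z)
        \<le> 2 * u k + 2 * (real n * (L * v * r ^ k / a))" by linarith
      also have "\<dots> = (2 * C + 2 * L / a) * (real n * v) * r ^ k"
        by (simp add: u_def algebra_simps)
      finally show "deviation n (I k t) \<omega> + deviation n (J k t) \<omega> + 2 * real n * (LINT z|D. J k t z)
        \<le> (2 * C + 2 * L / a) * (real n * v) * r ^ k" .
    next
      have "(\<Sum>i<n. R N t (Z i \<omega>)) \<le> (\<Sum>i<n. a * q ^ N)"
        using R_le[OF t Z_space[OF \<omega>(1)]] by (intro sum_mono) (meson abs_le_D1)
      moreover have "- (a * q ^ N) \<le> (LINT z|D. R N t z)"
      proof (rule D.integral_ge_const[OF R_int[OF t]])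
        show "AE z in D. - (a * q ^ N) \<le> R N t z" using R_le[OF t, of _ N] by (intro AE_I2) (meson abs_le_D2 minus_le_iff)
      qed
      from mult_left_mono[OF this, of "real n"] have "- (real n * (a * q ^ N)) \<le> real n * (LINT z|D. R N t z)" by simp
      ultimately have "deviation n (R N t) \<omega> \<le> real n * (2 * a * q ^ N)" by (simp add: deviation_def)
      also have "\<dots> \<le> real n * v" using N by (intro mult_left_mono) auto
      finally show "deviation n (R N t) \<omega> \<le> real n * v" .
    qed
    also have "(\<Sum>k<N. (2 * C + 2 * L / a) * (real n * v) * r ^ k) = (2 * C + 2 * L / a) * (real n * v) * (\<Sum>k<N. r ^ k)"
      by (simp add: sum_distrib_left)
    also have "\<dots> \<le> (2 * C + 2 * L / a) * (real n * v) * (1 / (1 - r))"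
      using params C L a n v by (intro mult_left_mono geometric_sum_le) auto
    also have "\<dots> + real n * v = (2 * C / (1 - r) + 2 * L / (a * (1 - r)) + 1) * (real n * v)"
      by (simp add: algebra_simps add_divide_distrib)
    finally show ?thesis by simp
  qed
  show ?thesis using E_ev E_le main by blast
qed

end

section \<open>The log-likelihood near a center\<close>

lemma distr_pair_snd:
  assumes "prob_space N" "prob_space N'"
  shows "distr (N \<Otimes>\<^sub>M N') N' snd = N'"
proof (rule measure_eqI)
  interpret N: prob_space N by fact
  interpret N': prob_space N' by fact
  fix A assume "A \<in> sets (distr (N \<Otimes>\<^sub>M N') N' snd)"
  then have A: "A \<in> sets N'" by simp
  have "snd -` A \<inter> space (N \<Otimes>\<^sub>M N') = space N \<times> A"
    using sets.sets_into_space[OF A] by (auto simp: space_pair_measure)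
  then show "emeasure (distr (N \<Otimes>\<^sub>M N') N' snd) A = emeasure N' A"
    using A by (simp add: emeasure_distr N'.emeasure_pair_measure_Times N.emeasure_space_1)
qed simp

text \<open>Bernoulli's inequality for \<open>v powr \<theta>\<close>, obtained from the convexity
  of \<open>exp\<close> on the segment between 0 and \<open>ln v\<close>.\<close>

lemma exp_times_ln_le:
  fixes v :: real
  assumes "0 < v" "0 \<le> \<theta>" "\<theta> \<le> 1"
  shows "exp (\<theta> * ln v) \<le> 1 + \<theta> * (v - 1)"
proof -
  have "exp ((1 - \<theta>) *\<^sub>R 0 + \<theta> *\<^sub>R ln v) \<le> (1 - \<theta>) * exp 0 + \<theta> * exp (ln v)"
    by (rule convex_onD[OF exp_convex]) (use assms in auto)
  then show ?thesis using assms by (simp add: algebra_simps)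
qed

text \<open>Pointwise form of the mean of \<open>increment\<close>, with \<open>r\<close> the root
  of the true ratio and \<open>w\<close> the bracket width. The linearized logarithm and the
  difference of squares cancel to first order at \<open>c = r\<close>. The factor
  \<open>1 / 8\<close> is small enough to be absorbed by the negative drift at the center.\<close>

lemma mean_increment_bound:
  fixes s c r w :: real
  assumes "0 \<le> s" "0 \<le> c" "0 \<le> r" "r\<^sup>2 \<le> 2 * c\<^sup>2" "\<bar>s - c\<bar> \<le> w"
  shows "r\<^sup>2 * (if 0 < r \<and> w \<le> r then 2 * (s / c - 1) else 0) - (s\<^sup>2 - c\<^sup>2) \<le> (c - r)\<^sup>2 / 8 + 75 * w\<^sup>2"
proof -
  define e where "e = \<bar>c - r\<bar>"
  have e: "c - r \<le> e" "0 \<le> e" by (simp_all add: e_def)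
  have w: "0 \<le> w" using assms by linarith
  have "(r\<^sup>2 * (if 0 < r \<and> w \<le> r then 2 * (s / c - 1) else 0) - (s\<^sup>2 - c\<^sup>2)) \<le> w * (6 * e + 3 * w)"
  proof (cases "0 < r \<and> w \<le> r")
    case True
    then have "0 < r\<^sup>2" by simp
    then have "c \<noteq> 0" using assms(4) by auto
    then have c: "0 < c" using assms by (simp add: less_le)
    have "r\<^sup>2 \<le> 4 * c\<^sup>2" using assms(4) zero_le_power2[of c] by linarith
    then have "r\<^sup>2 \<le> (2 * c)\<^sup>2" by (simp add: power_mult_distrib)
    then have r2c: "r \<le> 2 * c" by (rule power2_le_imp_le) (use assms(2) in simp)
    \<comment> \<open>The factorization exhibits the cancellation: besides \<open>s - c\<close>
      there remains a factor that is linear in \<open>r - c\<close> and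
      \<open>s - c\<close>.\<close>
    have eq: "r\<^sup>2 * (2 * (s / c - 1)) - (s\<^sup>2 - c\<^sup>2) = (s - c) * (2 * (r - c) * ((r + c) / c) - (s - c))"
      using c by (simp add: field_simps power2_eq_square)
    have "(r + c) / c \<le> 3" using r2c c by (simp add: pos_divide_le_eq)
    moreover have "0 \<le> (r + c) / c" using assms c by simp
    ultimately have "\<bar>2 * (r - c) * ((r + c) / c)\<bar> \<le> 2 * e * 3"
      unfolding abs_mult e_def by (intro mult_mono) (auto simp: abs_minus_commute)
    then have "\<bar>2 * (r - c) * ((r + c) / c) - (s - c)\<bar> \<le> 6 * e + 3 * w" using assms(5) w by linarith
    then have "\<bar>(s - c) * (2 * (r - c) * ((r + c) / c) - (s - c))\<bar> \<le> w * (6 * e + 3 * w)"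
      unfolding abs_mult using assms w by (intro mult_mono) auto
    then show ?thesis using True eq by simp
  next
    case False
    then have rw: "r \<le> w" using assms w by auto
    have "- (s\<^sup>2 - c\<^sup>2) = (c - s) * (s + c)" by (simp add: power2_eq_square algebra_simps)
    also have "\<dots> \<le> \<bar>c - s\<bar> * (s + c)" using assms by (intro mult_right_mono) auto
    also have "\<dots> \<le> w * (6 * e + 3 * w)"
    proof (intro mult_mono)
      show "s + c \<le> 6 * e + 3 * w" using abs_le_D1[OF assms(5)] e rw by linarith
    qed (use assms w in \<open>auto simp: abs_minus_commute\<close>)
    finally show ?thesis using False by auto
  qed
  also have "\<dots> \<le> e\<^sup>2 / 8 + 75 * w\<^sup>2"
  proof -
    \<comment> \<open>Equivalent to \<open>6 * e * w \<le> e^2 / 8 + 72 * w^2\<close>; together with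
      \<open>3 * w^2\<close> this yields the constant 75.\<close>
    have "0 \<le> (e - 24 * w)\<^sup>2" by simp
    then show ?thesis by (simp add: power2_eq_square algebra_simps)
  qed
  finally show ?thesis by (simp add: e_def)
qed

text \<open>Here \<open>T\<close> stands for the class of all
  \<open>s = ((g + g0) / 2)^(1/2)\<close>. What is kept of this form is \<open>T_ge\<close>: the
  quotient of \<open>sqrt g0\<close> by \<open>s\<close> is bounded although \<open>s\<close> itself
  may come close to 0. The bounds hold at every point, so \<open>g0\<close> is to be read as a
  version chosen from the function class.\<close>

locale density_class =
  fixes Q :: "'a measure" and g0 :: "'a \<Rightarrow> real" and b :: real and T :: "('a \<Rightarrow> real) set"
  assumes prob_Q: "prob_space Q"
    and g0_meas [measurable]: "g0 \<in> borel_measurable Q"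
    and g0_nonneg: "x \<in> space Q \<Longrightarrow> 0 \<le> g0 x"
    and g0_le: "x \<in> space Q \<Longrightarrow> g0 x \<le> b\<^sup>2"
    and prob_P: "prob_space (density Q g0)"
    and b: "1 \<le> b"
    and T_meas: "s \<in> T \<Longrightarrow> s \<in> borel_measurable Q"
    and T_nonneg: "s \<in> T \<Longrightarrow> x \<in> space Q \<Longrightarrow> 0 \<le> s x"
    and T_le: "s \<in> T \<Longrightarrow> x \<in> space Q \<Longrightarrow> s x \<le> b"
    and T_ge: "s \<in> T \<Longrightarrow> x \<in> space Q \<Longrightarrow> g0 x \<le> 2 * (s x)\<^sup>2"
begin

abbreviation "P \<equiv> density Q g0"
abbreviation "D \<equiv> P \<Otimes>\<^sub>M Q"

definition dist2 :: "('a \<Rightarrow> real) \<Rightarrow> real" where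
  "dist2 s = (LINT x|Q. (s x - sqrt (g0 x))\<^sup>2)"

lemma sqrt_g0_le: "x \<in> space Q \<Longrightarrow> sqrt (g0 x) \<le> b"
  using g0_le[of x] b by (simp add: real_le_lsqrt)

lemma T_pos: "s \<in> T \<Longrightarrow> x \<in> space Q \<Longrightarrow> 0 < g0 x \<Longrightarrow> 0 < s x"
  using T_ge[of s x] T_nonneg[of s x] by (cases "s x = 0") auto

lemma integrable_Q:
  "f \<in> borel_measurable Q \<Longrightarrow> (\<And>x. x \<in> space Q \<Longrightarrow> \<bar>f x\<bar> \<le> a) \<Longrightarrow> integrable Q (f :: 'a \<Rightarrow> real)"
  by (rule integrable_of_bounded[OF prob_Q])

lemma integral_P:
  fixes f :: "'a \<Rightarrow> real"
  assumes [measurable]: "f \<in> borel_measurable Q"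
  shows "(LINT x|P. f x) = (LINT x|Q. g0 x * f x)"
  using integral_density[of f Q g0] g0_nonneg by (auto intro: AE_I2)

lemma integrable_P:
  fixes f :: "'a \<Rightarrow> real"
  assumes [measurable]: "f \<in> borel_measurable Q"
  shows "integrable P f \<longleftrightarrow> integrable Q (\<lambda>x. g0 x * f x)"
  using integrable_density[of f Q g0] g0_nonneg by (auto intro: AE_I2)

lemma integral_g0: "(LINT x|Q. g0 x) = 1"
  using integral_P[of "\<lambda>_. 1"] prob_space.prob_space[OF prob_P] by simp

lemma AE_P_pos: "AE x in P. 0 < g0 x"
  by (subst AE_density) (auto intro!: AE_I2)

lemma fst_measurable_D: "f \<in> borel_measurable Q \<Longrightarrow> (\<lambda>z. f (fst z)) \<in> borel_measurable D"
  by (rule measurable_compose[OF measurable_fst]) simp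

lemma snd_measurable_D: "f \<in> borel_measurable Q \<Longrightarrow> (\<lambda>z. f (snd z)) \<in> borel_measurable D"
  by (rule measurable_compose[OF measurable_snd]) simp

lemma integral_fst:
  fixes f :: "'a \<Rightarrow> real"
  assumes "f \<in> borel_measurable Q"
  shows "(LINT z|D. f (fst z)) = (LINT x|P. f x)" "integrable D (\<lambda>z. f (fst z)) \<longleftrightarrow> integrable P f"
  using integral_distr[of fst D P f] integrable_distr_eq[of fst D P f] assms
    prob_space.distr_pair_fst[OF prob_Q, of P] by simp_all

lemma integral_snd:
  fixes f :: "'a \<Rightarrow> real"
  assumes "f \<in> borel_measurable Q"
  shows "(LINT z|D. f (snd z)) = (LINT x|Q. f x)" "integrable D (\<lambda>z. f (snd z)) \<longleftrightarrow> integrable Q f"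
  using integral_distr[of snd D Q f] integrable_distr_eq[of snd D Q f] assms
    distr_pair_snd[OF prob_P prob_Q] by simp_all

lemma space_D: "z \<in> space D \<Longrightarrow> fst z \<in> space Q \<and> snd z \<in> space Q"
  by (auto simp: space_pair_measure)

lemma dist2_integrable:
  assumes "s \<in> T" shows "integrable Q (\<lambda>x. (s x - sqrt (g0 x))\<^sup>2)"
proof (rule integrable_Q[of _ "b\<^sup>2"])
  note [measurable] = T_meas[OF assms]
  show "(\<lambda>x. (s x - sqrt (g0 x))\<^sup>2) \<in> borel_measurable Q" by measurable
  fix x assume "x \<in> space Q"
  then have "\<bar>s x - sqrt (g0 x)\<bar> \<le> b"
    using T_nonneg[OF assms, of x] T_le[OF assms, of x] g0_nonneg[of x] sqrt_g0_le[of x] real_sqrt_ge_zero[of "g0 x"] by linarith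
  then show "\<bar>(s x - sqrt (g0 x))\<^sup>2\<bar> \<le> b\<^sup>2" using power_mono[of "\<bar>s x - sqrt (g0 x)\<bar>" b 2] by simp
qed

lemma dist2_nonneg: "0 \<le> dist2 s" unfolding dist2_def by (rule integral_nonneg_AE) auto

definition envelope :: "('a \<Rightarrow> real) \<Rightarrow> ('a \<Rightarrow> real) \<Rightarrow> 'a \<Rightarrow> real" where
  "envelope c w x = c x + (if w x \<le> sqrt (g0 x) then 0 else w x)"

text \<open>\<open>center_loss\<close> and \<open>increment\<close> split the summand of the log-likelihood at \<open>s\<close>: where the width \<open>w\<close>
  exceeds \<open>g0^(1/2)\<close>, the logarithm is not linearized but absorbed by \<open>envelope\<close>. In all three, the
  value where \<open>g0\<close> vanishes is irrelevant, because this is a null set of \<open>density Q g0\<close>.\<close>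

definition center_loss :: "('a \<Rightarrow> real) \<Rightarrow> ('a \<Rightarrow> real) \<Rightarrow> 'a \<times> 'a \<Rightarrow> real" where
  "center_loss c w z = 2 * ln (envelope c w (fst z) / sqrt (g0 (fst z))) - ((c (snd z))\<^sup>2 - g0 (snd z))"

definition increment :: "('a \<Rightarrow> real) \<Rightarrow> ('a \<Rightarrow> real) \<Rightarrow> ('a \<Rightarrow> real) \<Rightarrow> 'a \<times> 'a \<Rightarrow> real" where
  "increment s c w z = (if 0 < g0 (fst z) \<and> w (fst z) \<le> sqrt (g0 (fst z)) then 2 * (s (fst z) / c (fst z) - 1) else 0)
     - ((s (snd z))\<^sup>2 - (c (snd z))\<^sup>2)"

text \<open>Where the width is at most \<open>sqrt g0\<close>, the logarithm is linearized by
  \<open>ln (s / c) \<le> s / c - 1\<close>; elsewhere \<open>s \<le> c + w\<close> and monotonicity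
  of \<open>ln\<close> suffice.\<close>

lemma loss_le:
  assumes "s \<in> T" "c \<in> T" "z \<in> space D" "0 < g0 (fst z)" "\<bar>s (fst z) - c (fst z)\<bar> \<le> w (fst z)"
  shows "2 * ln (s (fst z) / sqrt (g0 (fst z))) - ((s (snd z))\<^sup>2 - g0 (snd z)) \<le> center_loss c w z + increment s c w z"
proof -
  define x where "x = fst z"
  have x: "x \<in> space Q" "0 < g0 x" using assms space_D by (auto simp: x_def)
  have pos: "0 < s x" "0 < c x" "0 < sqrt (g0 x)" using T_pos assms(1,2) x by auto
  have "ln (s x / sqrt (g0 x)) \<le> ln (envelope c w x / sqrt (g0 x)) + (if w x \<le> sqrt (g0 x) then s x / c x - 1 else 0)"
  proof (cases "w x \<le> sqrt (g0 x)")
    case True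
    have "ln (s x / c x) \<le> s x / c x - 1" using pos by (intro ln_le_minus_one) auto
    then show ?thesis using True pos by (simp add: envelope_def ln_div)
  next
    case False
    then have "s x \<le> envelope c w x" using assms(5) by (simp add: envelope_def x_def)
    then show ?thesis using False pos by (simp add: divide_right_mono)
  qed
  then have "2 * ln (s x / sqrt (g0 x)) \<le> 2 * ln (envelope c w x / sqrt (g0 x))
      + (if 0 < g0 x \<and> w x \<le> sqrt (g0 x) then 2 * (s x / c x - 1) else 0)" using x by (simp split: if_splits)
  then show ?thesis unfolding center_loss_def increment_def x_def[symmetric] by linarith
qed

text \<open>Writing the \<open>P\<close>-part as a \<open>Q\<close>-integral with weight
  \<open>g0\<close> puts both parts under one integral, so that their first-order terms cancel
  pointwise by \<open>mean_increment_bound\<close>.\<close>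

lemma increment_mean:
  assumes sc: "s \<in> T" "c \<in> T" and w_meas [measurable]: "w \<in> borel_measurable Q"
    and w: "\<And>x. x \<in> space Q \<Longrightarrow> \<bar>s x - c x\<bar> \<le> w x" "\<And>x. x \<in> space Q \<Longrightarrow> w x \<le> b"
    and v: "(LINT x|Q. (w x)\<^sup>2) \<le> v"
  shows "(LINT z|D. increment s c w z) \<le> dist2 c / 8 + 75 * v"
proof -
  note [measurable] = sc[THEN T_meas]
  define f where "f x = (if 0 < g0 x \<and> w x \<le> sqrt (g0 x) then 2 * (s x / c x - 1) else 0)" for x
  have f_meas [measurable]: "f \<in> borel_measurable Q" unfolding f_def[abs_def] by measurable
  have w_nonneg: "0 \<le> w x" if "x \<in> space Q" for x using w(1)[OF that] by linarith
  have f_le: "\<bar>f x\<bar> \<le> 3" if x: "x \<in> space Q" for x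
  proof (cases "0 < g0 x \<and> w x \<le> sqrt (g0 x)")
    case True
    have c: "0 < c x" using T_pos[OF sc(2) x] True by simp
    have "g0 x \<le> 2 * (c x)\<^sup>2" by (rule T_ge[OF sc(2) x])
    \<comment> \<open>\<open>3 / 2\<close> is a rational upper bound for the square root of
      2.\<close>
    also have "\<dots> \<le> (3 / 2 * c x)\<^sup>2" by (simp add: power2_eq_square)
    finally have "sqrt (g0 x) \<le> 3 / 2 * c x" using c by (intro real_le_lsqrt) auto
    then have "\<bar>s x - c x\<bar> \<le> 3 / 2 * c x" using w(1)[OF x] True by linarith
    then have "\<bar>(s x - c x) / c x\<bar> \<le> 3 / 2" using c by (simp add: field_simps)
    moreover have "(s x - c x) / c x = s x / c x - 1" using c by (simp add: field_simps)
    ultimately have "\<bar>s x / c x - 1\<bar> \<le> 3 / 2" by simp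
    moreover have "\<bar>2 * u\<bar> = 2 * \<bar>u\<bar>" for u :: real by (simp add: abs_mult)
    ultimately have "\<bar>2 * (s x / c x - 1)\<bar> \<le> 2 * (3 / 2)" by (metis mult_left_mono zero_le_numeral)
    then show ?thesis using True unfolding f_def by (simp only: if_True simp_thms)
  qed (auto simp: f_def)
  have sq_le: "\<bar>(t x)\<^sup>2\<bar> \<le> b\<^sup>2" if "t \<in> T" "x \<in> space Q" for t x
    using T_le[OF that] T_nonneg[OF that] power_mono[of "t x" b 2] by simp
  have int_sq: "integrable Q (\<lambda>x. (t x)\<^sup>2)" if t: "t \<in> T" for t
    by (rule integrable_Q[OF _ sq_le[OF t]]) (use T_meas[OF t] in measurable)
  have int_f: "integrable P f"
    by (rule integrable_of_bounded[OF prob_P, of _ 3]) (use f_le in auto)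
  have int_w: "integrable Q (\<lambda>x. (w x)\<^sup>2)"
  proof (rule integrable_Q)
    fix x assume x: "x \<in> space Q"
    show "\<bar>(w x)\<^sup>2\<bar> \<le> b\<^sup>2" using w_nonneg[OF x] w(2)[OF x] power_mono[of "w x" b 2] by simp
  qed measurable
  have "(LINT z|D. increment s c w z) = (LINT z|D. f (fst z)) - (LINT z|D. (s (snd z))\<^sup>2 - (c (snd z))\<^sup>2)"
    unfolding increment_def f_def[symmetric]
    by (rule Bochner_Integration.integral_diff)
      (use integral_fst(2)[OF f_meas] integral_snd(2)[of "\<lambda>x. (s x)\<^sup>2 - (c x)\<^sup>2"] int_f int_sq[OF sc(1)] int_sq[OF sc(2)] in auto)
  also have "\<dots> = (LINT x|Q. g0 x * f x) - (LINT x|Q. (s x)\<^sup>2 - (c x)\<^sup>2)"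
    using integral_fst(1)[OF f_meas] integral_snd(1)[of "\<lambda>x. (s x)\<^sup>2 - (c x)\<^sup>2"] integral_P[OF f_meas] by simp
  also have "\<dots> = (LINT x|Q. g0 x * f x - ((s x)\<^sup>2 - (c x)\<^sup>2))"
    using int_f int_sq[OF sc(1)] int_sq[OF sc(2)] by (simp add: integrable_P)
  also have "\<dots> \<le> (LINT x|Q. (c x - sqrt (g0 x))\<^sup>2 / 8 + 75 * (w x)\<^sup>2)"
  proof (rule integral_mono_AE)
    show "integrable Q (\<lambda>x. g0 x * f x - ((s x)\<^sup>2 - (c x)\<^sup>2))"
      using int_f int_sq[OF sc(1)] int_sq[OF sc(2)] by (simp add: integrable_P)
    show "integrable Q (\<lambda>x. (c x - sqrt (g0 x))\<^sup>2 / 8 + 75 * (w x)\<^sup>2)"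
      using dist2_integrable[OF sc(2)] int_w by simp
    show "AE x in Q. g0 x * f x - ((s x)\<^sup>2 - (c x)\<^sup>2) \<le> (c x - sqrt (g0 x))\<^sup>2 / 8 + 75 * (w x)\<^sup>2"
    proof (rule AE_I2)
      fix x assume x: "x \<in> space Q"
      show "g0 x * f x - ((s x)\<^sup>2 - (c x)\<^sup>2) \<le> (c x - sqrt (g0 x))\<^sup>2 / 8 + 75 * (w x)\<^sup>2"
        using mean_increment_bound[of "s x" "c x" "sqrt (g0 x)" "w x"] T_nonneg[OF sc(1) x] T_nonneg[OF sc(2) x]
          g0_nonneg[OF x] T_ge[OF sc(2) x] w(1)[OF x] by (simp add: f_def)
    qed
  qed
  also have "\<dots> = dist2 c / 8 + 75 * (LINT x|Q. (w x)\<^sup>2)"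
    using dist2_integrable[OF sc(2)] int_w by (simp add: dist2_def)
  finally show ?thesis using v by linarith
qed

text \<open>The \<open>X\<close>-part contributes the affinity of \<open>c\<close> and
  \<open>sqrt g0\<close>, by Bernoulli's inequality, and the \<open>Y\<close>-part the squared norm
  of \<open>c\<close>; their combination is \<open>dist2 c\<close>, which gives the drift. The
  enlargement by the width costs only its squared norm \<open>v\<close>.\<close>

lemma center_loss_exp:
  assumes c: "c \<in> T" and w_meas [measurable]: "w \<in> borel_measurable Q"
    and w: "\<And>x. x \<in> space Q \<Longrightarrow> 0 \<le> w x" "\<And>x. x \<in> space Q \<Longrightarrow> w x \<le> b"
    and v: "(LINT x|Q. (w x)\<^sup>2) \<le> v" and l: "l = 1 / (16 * b\<^sup>2)"
  shows "center_loss c w \<in> borel_measurable D" "integrable D (\<lambda>z. exp (l * center_loss c w z))"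
    "(LINT z|D. exp (l * center_loss c w z)) \<le> exp (- l * dist2 c / 2 + 2 * l * v)"
proof -
  note [measurable] = T_meas[OF c]
  define h where "h x = envelope c w x / sqrt (g0 x)" for x
  have h_meas [measurable]: "h \<in> borel_measurable Q" unfolding h_def[abs_def] envelope_def[abs_def] by measurable
  define k where "k x = (c x)\<^sup>2 - g0 x" for x
  have k_meas [measurable]: "k \<in> borel_measurable Q" unfolding k_def[abs_def] by measurable
  have loss: "center_loss c w z = 2 * ln (h (fst z)) - k (snd z)" for z
    by (simp add: center_loss_def h_def k_def)
  have fm [measurable]: "(\<lambda>z. h (fst z)) \<in> borel_measurable D" "(\<lambda>z. k (snd z)) \<in> borel_measurable D"
    using fst_measurable_D[OF h_meas] snd_measurable_D[OF k_meas] .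
  show cm [measurable]: "center_loss c w \<in> borel_measurable D"
    unfolding loss[abs_def] by measurable
  have b2: "1 \<le> b\<^sup>2" using b by simp
  have l0: "0 < l" "l \<le> 1 / 16" proof -
    have "0 < b\<^sup>2" using b2 by linarith
    then show "0 < l" "l \<le> 1 / 16" unfolding l using b2 by (simp_all add: pos_divide_le_eq)
  qed
  \<comment> \<open>Both exponents are doubled, because the product of the two exponentials is split
    below by the arithmetic-geometric mean inequality.\<close>
  define e1 where "e1 x = exp (4 * l * ln (h x))" for x
  define e2 where "e2 x = exp (- (2 * l * k x))" for x
  have em [measurable]: "e1 \<in> borel_measurable Q" "e2 \<in> borel_measurable Q"
    unfolding e1_def[abs_def] e2_def[abs_def] by measurable
  have c_b: "0 \<le> c x" "c x \<le> b" "0 \<le> sqrt (g0 x)" "sqrt (g0 x) \<le> b" if "x \<in> space Q" for x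
    using T_nonneg[OF c that] T_le[OF c that] g0_nonneg[OF that] sqrt_g0_le[OF that] by auto
  have cr_le: "c x * sqrt (g0 x) \<le> b * b" if "x \<in> space Q" for x
    using c_b[OF that] by (intro mult_mono) auto
  have int_cr: "integrable Q (\<lambda>x. c x * sqrt (g0 x))"
    by (rule integrable_Q[of _ "b * b"]) (use cr_le c_b in \<open>auto simp: abs_mult\<close>)
  have c2_le: "(c x)\<^sup>2 \<le> b\<^sup>2" if "x \<in> space Q" for x
    using c_b[OF that] by (intro power_mono) auto
  have int_c2: "integrable Q (\<lambda>x. (c x)\<^sup>2)"
    by (rule integrable_Q[of _ "b\<^sup>2"]) (use c2_le in auto)
  have int_g0: "integrable Q g0"
    by (rule integrable_Q[of _ "b\<^sup>2"]) (use g0_le g0_nonneg in auto)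
  have int_w: "integrable Q (\<lambda>x. (w x)\<^sup>2)"
  proof (rule integrable_Q)
    fix x assume x: "x \<in> space Q"
    show "\<bar>(w x)\<^sup>2\<bar> \<le> b\<^sup>2" using w(1)[OF x] w(2)[OF x] power_mono[of "w x" b 2] by simp
  qed measurable
  have gh: "g0 x * h x = envelope c w x * sqrt (g0 x)" if "x \<in> space Q" for x
    using g0_nonneg[OF that] by (cases "g0 x = 0") (auto simp: h_def field_simps)
  have env_nonneg: "0 \<le> envelope c w x" if "x \<in> space Q" for x
    using c_b[OF that] w(1)[OF that] by (simp add: envelope_def)
  \<comment> \<open>The width is added only where it exceeds \<open>sqrt g0\<close>; there the extra
    term \<open>w * sqrt g0\<close> is at most \<open>w^2\<close>, of second order.\<close>
  have gh_le: "g0 x * h x \<le> c x * sqrt (g0 x) + (w x)\<^sup>2" if "x \<in> space Q" for x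
  proof (cases "w x \<le> sqrt (g0 x)")
    case True then show ?thesis by (simp add: gh[OF that] envelope_def)
  next
    case False
    then have "w x * sqrt (g0 x) \<le> w x * w x" using w(1)[OF that] by (intro mult_left_mono) auto
    then show ?thesis using False by (simp add: gh[OF that] envelope_def algebra_simps power2_eq_square)
  qed
  have int_gh: "integrable Q (\<lambda>x. g0 x * h x)"
  proof (rule Bochner_Integration.integrable_bound[of _ "\<lambda>x. c x * sqrt (g0 x) + (w x)\<^sup>2"])
    show "AE x in Q. norm (g0 x * h x) \<le> norm (c x * sqrt (g0 x) + (w x)\<^sup>2)"
      using gh_le env_nonneg c_b by (intro AE_I2) (simp add: gh)
  qed (use int_cr int_w in auto)
  have int_h: "integrable P h" using int_gh by (simp add: integrable_P)
  have h_mean: "(LINT x|P. h x) \<le> (LINT x|Q. c x * sqrt (g0 x)) + v"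
  proof -
    have "(LINT x|P. h x) \<le> (LINT x|Q. c x * sqrt (g0 x) + (w x)\<^sup>2)"
      unfolding integral_P[OF h_meas]
      by (rule integral_mono_AE[OF int_gh]) (use gh_le int_cr int_w in auto)
    then show ?thesis using int_cr int_w v by simp
  qed

  interpret P': prob_space P by (rule prob_P)
  interpret Q': prob_space Q by (rule prob_Q)
  have "AE x in P. x \<in> space Q" using AE_space[of P] by simp
  with AE_P_pos have e1_le: "AE x in P. e1 x \<le> 1 + 4 * l * (h x - 1)"
  proof eventually_elim
    case (elim x)
    then have "0 < h x" using T_pos[OF c] w(1) by (auto simp: h_def envelope_def intro!: divide_pos_pos add_pos_nonneg)
    then show ?case unfolding e1_def using l0 by (intro exp_times_ln_le) auto
  qed
  have int_e1: "integrable P e1"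
  proof (rule Bochner_Integration.integrable_bound[of _ "\<lambda>x. 1 + 4 * l * (h x - 1)"])
    show "AE x in P. norm (e1 x) \<le> norm (1 + 4 * l * (h x - 1))"
      using e1_le by eventually_elim (auto simp: e1_def)
  qed (use int_h in auto)
  have "(LINT x|P. e1 x) \<le> (LINT x|P. 1 + 4 * l * (h x - 1))"
    by (rule integral_mono_AE[OF int_e1 _ e1_le]) (use int_h in auto)
  also have "\<dots> = 1 + 4 * l * ((LINT x|P. h x) - 1)"
    using int_h P'.prob_space by simp
  also have "\<dots> \<le> 1 + 4 * l * ((LINT x|Q. c x * sqrt (g0 x)) + v - 1)"
    using h_mean l0 by (intro add_mono mult_left_mono) auto
  finally have e1_mean: "(LINT x|P. e1 x) \<le> 1 + 4 * l * ((LINT x|Q. c x * sqrt (g0 x)) + v - 1)" .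
  have k_le: "\<bar>k x\<bar> \<le> b\<^sup>2" if "x \<in> space Q" for x
    using g0_nonneg[OF that] g0_le[OF that] c2_le[OF that] zero_le_power2[of "c x"] unfolding k_def by linarith
  have lk: "\<bar>2 * l * k x\<bar> \<le> 1" if "x \<in> space Q" for x
  proof -
    have "2 * l * \<bar>k x\<bar> \<le> 2 * l * b\<^sup>2" using k_le[OF that] l0 by (intro mult_left_mono) auto
    also have "\<dots> \<le> 1" using l b2 by simp
    finally show ?thesis using l0 by (simp add: abs_mult)
  qed
  have int_e2: "integrable Q e2"
    by (rule integrable_Q[of _ "exp 1"]) (use lk in \<open>auto simp: e2_def abs_le_iff\<close>)
  have k2_le: "(k x)\<^sup>2 \<le> 4 * b\<^sup>2 * (c x - sqrt (g0 x))\<^sup>2" if "x \<in> space Q" for x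
  proof -
    have "k x = (c x - sqrt (g0 x)) * (c x + sqrt (g0 x))"
      using g0_nonneg[OF that] by (simp add: k_def algebra_simps power2_eq_square)
    moreover have "(c x + sqrt (g0 x))\<^sup>2 \<le> (2 * b)\<^sup>2" using c_b[OF that] by (intro power_mono) auto
    from mult_left_mono[OF this, of "(c x - sqrt (g0 x))\<^sup>2"]
    have "(c x - sqrt (g0 x))\<^sup>2 * (c x + sqrt (g0 x))\<^sup>2 \<le> 4 * b\<^sup>2 * (c x - sqrt (g0 x))\<^sup>2"
      by (simp add: power_mult_distrib mult.commute)
    ultimately show ?thesis by (simp add: power_mult_distrib)
  qed
  note int_d = dist2_integrable[OF c]
  have int_k: "integrable Q k" unfolding k_def[abs_def] using int_c2 int_g0 by simp
  have e2_le: "e2 x \<le> 1 - 2 * l * k x + 16 * l\<^sup>2 * b\<^sup>2 * (c x - sqrt (g0 x))\<^sup>2" if "x \<in> space Q" for x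
  proof -
    have "e2 x \<le> 1 + (- (2 * l * k x)) + (- (2 * l * k x))\<^sup>2"
      unfolding e2_def using lk[OF that] by (intro exp_le_one_plus_square) auto
    also have "(- (2 * l * k x))\<^sup>2 = 4 * l\<^sup>2 * (k x)\<^sup>2" by (simp add: power_mult_distrib)
    also have "\<dots> \<le> 4 * l\<^sup>2 * (4 * b\<^sup>2 * (c x - sqrt (g0 x))\<^sup>2)"
      using k2_le[OF that] by (intro mult_left_mono) auto
    finally show ?thesis by (simp add: algebra_simps)
  qed
  have "(LINT x|Q. e2 x) \<le> (LINT x|Q. 1 - 2 * l * k x + 16 * l\<^sup>2 * b\<^sup>2 * (c x - sqrt (g0 x))\<^sup>2)"
    by (rule integral_mono_AE[OF int_e2]) (use e2_le int_k int_d in auto)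
  also have "\<dots> = 1 - 2 * l * (LINT x|Q. k x) + 16 * l\<^sup>2 * b\<^sup>2 * dist2 c"
    using int_k int_d by (simp add: dist2_def Q'.prob_space)
  also have "(LINT x|Q. k x) = (LINT x|Q. (c x)\<^sup>2) - 1"
    unfolding k_def using int_c2 int_g0 integral_g0 by simp
  \<comment> \<open>The choice of \<open>l\<close> makes the quadratic remainder half as large as
    the linear gain, which leaves a drift of \<open>l * dist2 c / 2\<close>.\<close>
  also have "16 * l\<^sup>2 * b\<^sup>2 * dist2 c = l * dist2 c"
    using l b2 by (simp add: power2_eq_square)
  finally have e2_mean: "(LINT x|Q. e2 x) \<le> 1 - 2 * l * ((LINT x|Q. (c x)\<^sup>2) - 1) + l * dist2 c" .

  have d_eq: "dist2 c = (LINT x|Q. (c x)\<^sup>2) - 2 * (LINT x|Q. c x * sqrt (g0 x)) + 1"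
  proof -
    have "dist2 c = (LINT x|Q. (c x)\<^sup>2 - 2 * (c x * sqrt (g0 x)) + g0 x)"
      unfolding dist2_def using g0_nonneg by (intro Bochner_Integration.integral_cong) (auto simp: power2_diff)
    then show ?thesis using int_c2 int_cr int_g0 integral_g0 by simp
  qed
  have exp_le: "exp (l * center_loss c w z) \<le> e1 (fst z) / 2 + e2 (snd z) / 2" for z
  proof -
    define u where "u = exp (2 * l * ln (h (fst z)))"
    define u' where "u' = exp (- (l * k (snd z)))"
    have "exp (l * center_loss c w z) = u * u'"
      by (simp add: loss u_def u'_def exp_add[symmetric] algebra_simps)
    also have "\<dots> \<le> u\<^sup>2 / 2 + u'\<^sup>2 / 2" using sum_squares_bound[of u u'] by (simp add: field_simps)
    also have "u\<^sup>2 = e1 (fst z)" by (simp add: u_def e1_def exp_double[symmetric])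
    also have "u'\<^sup>2 = e2 (snd z)" by (simp add: u'_def e2_def exp_double[symmetric])
    finally show ?thesis .
  qed
  have int_s: "integrable D (\<lambda>z. e1 (fst z) / 2 + e2 (snd z) / 2)"
    using integral_fst(2)[OF em(1)] integral_snd(2)[OF em(2)] int_e1 int_e2 by simp
  show int_l: "integrable D (\<lambda>z. exp (l * center_loss c w z))"
    by (rule Bochner_Integration.integrable_bound[OF int_s]) (use exp_le in \<open>auto simp: e1_def e2_def\<close>)
  have "(LINT z|D. exp (l * center_loss c w z)) \<le> (LINT z|D. e1 (fst z) / 2 + e2 (snd z) / 2)"
    by (rule integral_mono_AE[OF int_l int_s]) (use exp_le in auto)
  also have "\<dots> = (LINT x|P. e1 x) / 2 + (LINT x|Q. e2 x) / 2"
    using integral_fst[OF em(1)] integral_snd[OF em(2)] int_e1 int_e2 by simp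
  also have "\<dots> \<le> (1 + 4 * l * ((LINT x|Q. c x * sqrt (g0 x)) + v - 1)) / 2
      + (1 - 2 * l * ((LINT x|Q. (c x)\<^sup>2) - 1) + l * dist2 c) / 2"
    using e1_mean e2_mean by (intro add_mono divide_right_mono) auto
  also have "\<dots> = 1 + (- l * dist2 c / 2 + 2 * l * v)"
    unfolding d_eq by (simp add: field_simps)
  also have "\<dots> \<le> exp (- l * dist2 c / 2 + 2 * l * v)" by (rule exp_ge_add_one_self)
  finally show "(LINT z|D. exp (l * center_loss c w z)) \<le> exp (- l * dist2 c / 2 + 2 * l * v)" .
qed

end

section \<open>Range and second moment of the chaining links\<close>

context density_class
begin

text \<open>Bounds the difference of two increments with the same center: 3 is twice the bound
  \<open>3 / 2\<close> on \<open>sqrt g0 / c\<close>, and \<open>2 * b\<close> bounds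
  \<open>s + s'\<close>. The region is fixed by the coarsest width \<open>w0\<close>, as in
  \<open>increment\<close>, while \<open>w\<close> shrinks along the chain.\<close>

definition width :: "('a \<Rightarrow> real) \<Rightarrow> ('a \<Rightarrow> real) \<Rightarrow> 'a \<times> 'a \<Rightarrow> real" where
  "width w0 w z = (if 0 < g0 (fst z) \<and> w0 (fst z) \<le> sqrt (g0 (fst z)) then 3 * w (fst z) / sqrt (g0 (fst z)) else 0)
     + 2 * b * w (snd z)"

lemma measurable_increment:
  assumes "s \<in> T" "c \<in> T" and [measurable]: "w \<in> borel_measurable Q"
  shows "increment s c w \<in> borel_measurable D"
proof -
  note [measurable] = assms(1,2)[THEN T_meas]
  have "(\<lambda>x. if 0 < g0 x \<and> w x \<le> sqrt (g0 x) then 2 * (s x / c x - 1) else 0) \<in> borel_measurable Q"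
    "(\<lambda>x. (s x)\<^sup>2 - (c x)\<^sup>2) \<in> borel_measurable Q" by measurable
  from borel_measurable_diff[OF fst_measurable_D[OF this(1)] snd_measurable_D[OF this(2)]]
  show ?thesis unfolding increment_def[abs_def] by simp
qed

lemma measurable_width:
  assumes [measurable]: "w0 \<in> borel_measurable Q" "w \<in> borel_measurable Q"
  shows "width w0 w \<in> borel_measurable D"
proof -
  have "(\<lambda>x. if 0 < g0 x \<and> w0 x \<le> sqrt (g0 x) then 3 * w x / sqrt (g0 x) else 0) \<in> borel_measurable Q"
    "(\<lambda>x. 2 * b * w x) \<in> borel_measurable Q" by measurable
  from borel_measurable_add[OF fst_measurable_D[OF this(1)] snd_measurable_D[OF this(2)]]
  show ?thesis unfolding width_def[abs_def] by simp
qed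

lemma increment_diff:
  assumes T: "s \<in> T" "s' \<in> T" "c \<in> T" and z: "z \<in> space D"
    and w: "\<And>x. x \<in> space Q \<Longrightarrow> \<bar>s x - s' x\<bar> \<le> w x"
  shows "\<bar>increment s c w0 z - increment s' c w0 z\<bar> \<le> width w0 w z"
proof -
  obtain x y where xy: "z = (x, y)" "x \<in> space Q" "y \<in> space Q" using z space_D by (cases z) auto
  have y: "\<bar>(s y)\<^sup>2 - (s' y)\<^sup>2\<bar> \<le> 2 * b * w y"
  proof -
    have "\<bar>(s y)\<^sup>2 - (s' y)\<^sup>2\<bar> = \<bar>s y + s' y\<bar> * \<bar>s y - s' y\<bar>"
      by (simp add: abs_mult[symmetric] power2_eq_square algebra_simps)
    also have "\<dots> \<le> (2 * b) * w y"
      using T_nonneg[of _ y] T_le[OF T(1), of y] T_le[OF T(2), of y] T xy w[of y] b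
      by (intro mult_mono) auto
    finally show ?thesis .
  qed
  have x: "\<bar>2 * (s x / c x - 1) - 2 * (s' x / c x - 1)\<bar> \<le> 3 * w x / sqrt (g0 x)" if g: "0 < g0 x"
  proof -
    have c: "0 < c x" using T_pos T xy g by auto
    have "g0 x \<le> 2 * (c x)\<^sup>2" by (rule T_ge[OF T(3) xy(2)])
    also have "\<dots> \<le> (3 / 2 * c x)\<^sup>2" by (simp add: power2_eq_square)
    finally have r: "sqrt (g0 x) \<le> 3 / 2 * c x" using c by (intro real_le_lsqrt) auto
    have w0: "0 \<le> w x" using w[OF xy(2)] by linarith
    have "2 * (s x / c x - 1) - 2 * (s' x / c x - 1) = 2 * (s x - s' x) / c x"
      using c by (simp add: field_simps)
    then have "\<bar>2 * (s x / c x - 1) - 2 * (s' x / c x - 1)\<bar> = 2 * \<bar>s x - s' x\<bar> / c x"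
      using c by (simp only: abs_mult abs_divide abs_numeral abs_of_pos)
    also have "\<dots> \<le> 2 * w x / c x" using w[OF xy(2)] c by (intro divide_right_mono) auto
    also have "\<dots> \<le> 3 * w x / sqrt (g0 x)"
    proof -
      have "w x * sqrt (g0 x) \<le> w x * (3 / 2 * c x)" using r w0 by (rule mult_left_mono)
      then show ?thesis using c g by (simp add: field_simps)
    qed
    finally show ?thesis .
  qed
  show ?thesis
  proof (cases "0 < g0 x \<and> w0 x \<le> sqrt (g0 x)")
    case True
    have "increment s c w0 z - increment s' c w0 z
        = (2 * (s x / c x - 1) - 2 * (s' x / c x - 1)) - ((s y)\<^sup>2 - (s' y)\<^sup>2)"
      unfolding increment_def xy(1) fst_conv snd_conv if_P[OF True] by simp
    then show ?thesis using x y True unfolding width_def xy(1) fst_conv snd_conv if_P[OF True] by linarith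
  next
    case False
    have "increment s c w0 z - increment s' c w0 z = - ((s y)\<^sup>2 - (s' y)\<^sup>2)"
      unfolding increment_def xy(1) fst_conv snd_conv if_not_P[OF False] by simp
    then show ?thesis using y unfolding width_def xy(1) fst_conv snd_conv if_not_P[OF False] by linarith
  qed
qed

text \<open>On the region of linearization the ratio of \<open>w\<close> to \<open>sqrt g0\<close>
  is at most 1; this provides the bounded range with which the chaining starts.\<close>

lemma width_le:
  assumes z: "z \<in> space D" and w: "\<And>x. x \<in> space Q \<Longrightarrow> 0 \<le> w x" "\<And>x. x \<in> space Q \<Longrightarrow> w x \<le> b"
  shows "width w w z \<le> 3 + 2 * b\<^sup>2"
proof -
  obtain x y where xy: "z = (x, y)" "x \<in> space Q" "y \<in> space Q" using z space_D by (cases z) auto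
  have "2 * b * w y \<le> 2 * b * b" using w(2)[OF xy(3)] b by (intro mult_left_mono) auto
  moreover have "3 * w x / sqrt (g0 x) \<le> 3" if "0 < g0 x" "w x \<le> sqrt (g0 x)"
    using that by (simp add: field_simps)
  ultimately show ?thesis unfolding width_def xy(1) by (auto simp: power2_eq_square)
qed

text \<open>Under \<open>P\<close> the weight \<open>g0\<close> cancels the squared denominator
  \<open>sqrt g0\<close>, so the second moment is governed by the \<open>L2(Q)\<close> norm of the
  width alone.\<close>

lemma width_L2:
  assumes [measurable]: "w0 \<in> borel_measurable Q" "w \<in> borel_measurable Q"
    and w: "\<And>x. x \<in> space Q \<Longrightarrow> 0 \<le> w x" "\<And>x. x \<in> space Q \<Longrightarrow> w x \<le> b"
  shows "(LINT z|D. (width w0 w z)\<^sup>2) \<le> (18 + 8 * b\<^sup>2) * (LINT x|Q. (w x)\<^sup>2)"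
proof -
  define f where "f x = (if 0 < g0 x \<and> w0 x \<le> sqrt (g0 x) then 3 * w x / sqrt (g0 x) else 0)" for x
  have [measurable]: "f \<in> borel_measurable Q" unfolding f_def[abs_def] by measurable
  have gf: "g0 x * (f x)\<^sup>2 \<le> 9 * (w x)\<^sup>2" if "x \<in> space Q" for x
    using g0_nonneg[OF that] by (simp add: f_def power_divide power_mult_distrib)
  have wb: "(w x)\<^sup>2 \<le> b\<^sup>2" if "x \<in> space Q" for x using w[OF that] by (intro power_mono) auto
  have int_w: "integrable Q (\<lambda>x. (w x)\<^sup>2)" by (rule integrable_Q[of _ "b\<^sup>2"]) (use wb in auto)
  have int_gf: "integrable Q (\<lambda>x. g0 x * (f x)\<^sup>2)"
    by (rule Bochner_Integration.integrable_bound[of _ "\<lambda>x. 9 * (w x)\<^sup>2"]) (use int_w gf g0_nonneg in \<open>auto simp: abs_mult\<close>)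
  then have int_f: "integrable P (\<lambda>x. (f x)\<^sup>2)" by (simp add: integrable_P)
  have m: "(\<lambda>x. (f x)\<^sup>2) \<in> borel_measurable Q" "(\<lambda>x. (2 * b * w x)\<^sup>2) \<in> borel_measurable Q" by measurable
  have int_2: "integrable Q (\<lambda>x. (2 * b * w x)\<^sup>2)" using int_w by (simp add: power_mult_distrib)
  have int_D: "integrable D (\<lambda>z. 2 * (f (fst z))\<^sup>2 + 2 * (2 * b * w (snd z))\<^sup>2)"
    using integral_fst(2)[OF m(1)] integral_snd(2)[OF m(2)] int_f int_2 by simp
  have "(LINT z|D. (width w0 w z)\<^sup>2) \<le> (LINT z|D. 2 * (f (fst z))\<^sup>2 + 2 * (2 * b * w (snd z))\<^sup>2)"
  proof (rule integral_mono_AE'[OF int_D])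
    have "(width w0 w z)\<^sup>2 \<le> 2 * (f (fst z))\<^sup>2 + 2 * (2 * b * w (snd z))\<^sup>2" for z
    proof -
      have "(u + v)\<^sup>2 \<le> 2 * u\<^sup>2 + 2 * v\<^sup>2" for u v :: real
        using sum_squares_bound[of u v] by (simp add: power2_sum)
      then show ?thesis unfolding width_def f_def[symmetric] .
    qed
    then show "AE z in D. (width w0 w z)\<^sup>2 \<le> 2 * (f (fst z))\<^sup>2 + 2 * (2 * b * w (snd z))\<^sup>2" by simp
  qed simp
  also have "\<dots> = 2 * (LINT x|P. (f x)\<^sup>2) + 2 * (LINT x|Q. (2 * b * w x)\<^sup>2)"
    using integral_fst[OF m(1)] integral_snd[OF m(2)] int_f int_2 by simp
  also have "(LINT x|P. (f x)\<^sup>2) = (LINT x|Q. g0 x * (f x)\<^sup>2)" by (rule integral_P) measurable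
  also have "\<dots> \<le> (LINT x|Q. 9 * (w x)\<^sup>2)"
    by (rule integral_mono_AE[OF int_gf]) (use int_w gf in auto)
  finally show ?thesis by (simp add: power_mult_distrib algebra_simps)
qed

lemma dist2_le_double:
  assumes sc: "s \<in> T" "c \<in> T" and [measurable]: "w \<in> borel_measurable Q"
    and w: "\<And>x. x \<in> space Q \<Longrightarrow> \<bar>s x - c x\<bar> \<le> w x" "\<And>x. x \<in> space Q \<Longrightarrow> w x \<le> b"
  shows "dist2 s \<le> 2 * dist2 c + 2 * (LINT x|Q. (w x)\<^sup>2)"
proof -
  have int_w: "integrable Q (\<lambda>x. (w x)\<^sup>2)"
  proof (rule integrable_Q)
    fix x assume x: "x \<in> space Q"
    have "0 \<le> w x" using w(1)[OF x] by linarith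
    then show "\<bar>(w x)\<^sup>2\<bar> \<le> b\<^sup>2" using w(2)[OF x] power_mono[of "w x" b 2] by simp
  qed measurable
  have "dist2 s \<le> (LINT x|Q. 2 * (c x - sqrt (g0 x))\<^sup>2 + 2 * (w x)\<^sup>2)"
    unfolding dist2_def
  proof (rule integral_mono_AE[OF dist2_integrable[OF sc(1)]])
    show "AE x in Q. (s x - sqrt (g0 x))\<^sup>2 \<le> 2 * (c x - sqrt (g0 x))\<^sup>2 + 2 * (w x)\<^sup>2"
    proof (rule AE_I2)
      fix x assume x: "x \<in> space Q"
      have "(s x - c x)\<^sup>2 \<le> (w x)\<^sup>2" using w(1)[OF x] abs_le_square_iff[of "s x - c x" "w x"] by auto
      moreover have "0 \<le> ((s x - c x) - (c x - sqrt (g0 x)))\<^sup>2" by simp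
      ultimately show "(s x - sqrt (g0 x))\<^sup>2 \<le> 2 * (c x - sqrt (g0 x))\<^sup>2 + 2 * (w x)\<^sup>2"
        by (simp add: power2_eq_square algebra_simps)
    qed
  qed (use dist2_integrable[OF sc(2)] int_w in auto)
  then show ?thesis using dist2_integrable[OF sc(2)] int_w by (simp add: dist2_def)
qed

text \<open>A bracketing cover, remembered only through the bracket assigned to each function and the
  bracket widths.\<close>

definition L2_cells :: "real \<Rightarrow> nat \<Rightarrow> (('a \<Rightarrow> real) \<Rightarrow> nat) \<Rightarrow> (nat \<Rightarrow> 'a \<Rightarrow> real) \<Rightarrow> bool" where
  "L2_cells \<delta> N idx \<Delta> \<longleftrightarrow> (\<forall>s\<in>T. idx s < N) \<and>
     (\<forall>i<N. \<Delta> i \<in> borel_measurable Q \<and> integrable Q (\<lambda>x. (\<Delta> i x)\<^sup>2) \<and> (LINT x|Q. (\<Delta> i x)\<^sup>2) \<le> \<delta>\<^sup>2) \<and>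
     (\<forall>s\<in>T. \<forall>s'\<in>T. idx s = idx s' \<longrightarrow> (\<forall>x\<in>space Q. \<bar>s x - s' x\<bar> \<le> \<Delta> (idx s) x))"

end

section \<open>Nested cells from the brackets of all scales\<close>

locale cell_chain = density_class Q g0 b T
  for Q :: "'a measure" and g0 :: "'a \<Rightarrow> real" and b :: real and T :: "('a \<Rightarrow> real) set" +
  fixes \<delta> :: real and N :: "nat \<Rightarrow> nat" and idx :: "nat \<Rightarrow> ('a \<Rightarrow> real) \<Rightarrow> nat" and \<Delta> :: "nat \<Rightarrow> nat \<Rightarrow> 'a \<Rightarrow> real"
  assumes cells: "L2_cells (\<delta> / 2 ^ k) (N k) (idx k) (\<Delta> k)"
begin

text \<open>Brackets of different levels need not be nested; a cell of level \<open>k\<close> therefore fixes the brackets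
  of all levels up to \<open>k\<close>, and its width \<open>w k\<close> is their minimum, truncated at the bound \<open>b\<close>.\<close>

definition key :: "nat \<Rightarrow> ('a \<Rightarrow> real) \<Rightarrow> nat \<Rightarrow> nat" where
  "key k s = restrict (\<lambda>j. idx j s) {..k}"

definition rep :: "nat \<Rightarrow> ('a \<Rightarrow> real) \<Rightarrow> 'a \<Rightarrow> real" where
  "rep k s = inv_into T (key k) (key k s)"

primrec w :: "nat \<Rightarrow> ('a \<Rightarrow> real) \<Rightarrow> 'a \<Rightarrow> real" where
  "w 0 s x = min (\<Delta> 0 (idx 0 s) x) b"
| "w (Suc k) s x = min (w k s x) (\<Delta> (Suc k) (idx (Suc k) s) x)"

lemma idx_less: "s \<in> T \<Longrightarrow> idx k s < N k"
  using cells[of k] by (simp add: L2_cells_def)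

lemma \<Delta>_props:
  assumes "s \<in> T"
  shows "\<Delta> k (idx k s) \<in> borel_measurable Q" "integrable Q (\<lambda>x. (\<Delta> k (idx k s) x)\<^sup>2)"
    "(LINT x|Q. (\<Delta> k (idx k s) x)\<^sup>2) \<le> (\<delta> / 2 ^ k)\<^sup>2"
  using cells[of k] idx_less[OF assms, of k] unfolding L2_cells_def by blast+

lemma \<Delta>_ge:
  assumes "s \<in> T" "s' \<in> T" "idx k s = idx k s'" "x \<in> space Q"
  shows "\<bar>s x - s' x\<bar> \<le> \<Delta> k (idx k s) x"
  using cells[of k] assms unfolding L2_cells_def by blast

lemma rep_in: "s \<in> T \<Longrightarrow> rep k s \<in> T"
  unfolding rep_def by (rule inv_into_into) simp

lemma key_rep: "s \<in> T \<Longrightarrow> key k (rep k s) = key k s"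
  unfolding rep_def by (rule f_inv_into_f[of "key k s" "key k" T]) simp

lemma idx_rep: "s \<in> T \<Longrightarrow> j \<le> k \<Longrightarrow> idx j (rep k s) = idx j s"
  using fun_cong[OF key_rep[of s k], of j] by (simp add: key_def)

text \<open>An equality of functions and not merely of cells: \<open>rep j\<close> depends on its
  argument only through \<open>key j\<close>, which \<open>rep k\<close> preserves for
  \<open>j \<le> k\<close>.\<close>

lemma rep_rep: "s \<in> T \<Longrightarrow> j \<le> k \<Longrightarrow> rep j (rep k s) = rep j s"
  unfolding rep_def[of j] by (rule arg_cong[where f = "inv_into T (key j)"])
    (auto simp: key_def idx_rep restrict_def)

lemma w_cong: "(\<And>j. j \<le> k \<Longrightarrow> idx j s = idx j s') \<Longrightarrow> w k s = w k s'"
  by (induction k) (auto simp: fun_eq_iff)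

lemma w_rep: "s \<in> T \<Longrightarrow> j \<le> k \<Longrightarrow> w j (rep k s) = w j s"
  by (rule w_cong) (simp add: idx_rep)

lemma w_meas:
  assumes s: "s \<in> T" shows "w k s \<in> borel_measurable Q"
proof (induction k)
  case 0
  have "w 0 s = (\<lambda>x. min (\<Delta> 0 (idx 0 s) x) b)" by auto
  then show ?case using \<Delta>_props(1)[OF s, of 0] by simp
next
  case (Suc k)
  have "w (Suc k) s = (\<lambda>x. min (w k s x) (\<Delta> (Suc k) (idx (Suc k) s) x))" by auto
  then show ?case using \<Delta>_props(1)[OF s, of "Suc k"] Suc by simp
qed

lemma w_le: "w k s x \<le> b" by (induction k) (auto intro: min.coboundedI1)

text \<open>The truncation at \<open>b\<close> respects the bound because all members of
  \<open>T\<close> take values between 0 and \<open>b\<close>.\<close>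

lemma w_ge:
  assumes "s \<in> T" "s' \<in> T" "\<And>j. j \<le> k \<Longrightarrow> idx j s = idx j s'" "x \<in> space Q"
  shows "\<bar>s x - s' x\<bar> \<le> w k s x"
  using assms(3)
proof (induction k)
  case 0
  have "\<bar>s x - s' x\<bar> \<le> b" using T_nonneg[OF assms(1,4)] T_le[OF assms(1,4)] T_nonneg[OF assms(2,4)] T_le[OF assms(2,4)]
    by linarith
  then show ?case using \<Delta>_ge[OF assms(1,2) _ assms(4), of 0] 0 by simp
next
  case (Suc k)
  then show ?case using \<Delta>_ge[OF assms(1,2) _ assms(4), of "Suc k"] by simp
qed

lemma w_ge_rep: "s \<in> T \<Longrightarrow> x \<in> space Q \<Longrightarrow> \<bar>s x - rep k s x\<bar> \<le> w k s x"
  by (rule w_ge) (simp_all add: rep_in idx_rep)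

lemma w_nonneg: "s \<in> T \<Longrightarrow> x \<in> space Q \<Longrightarrow> 0 \<le> w k s x"
  using w_ge_rep[of s x k] by linarith

lemma w_L2:
  assumes s: "s \<in> T" shows "(LINT x|Q. (w k s x)\<^sup>2) \<le> \<delta>\<^sup>2 / 4 ^ k"
proof -
  have "(LINT x|Q. (w k s x)\<^sup>2) \<le> (LINT x|Q. (\<Delta> k (idx k s) x)\<^sup>2)"
  proof (rule integral_mono_AE'[OF \<Delta>_props(2)[OF s]])
    have "(w k s x)\<^sup>2 \<le> (\<Delta> k (idx k s) x)\<^sup>2" if "x \<in> space Q" for x
      using w_nonneg[OF s that, of k] by (intro power_mono) (cases k; simp)+
    then show "AE x in Q. (w k s x)\<^sup>2 \<le> (\<Delta> k (idx k s) x)\<^sup>2" by (rule AE_I2)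
  qed simp
  also have "\<dots> \<le> (\<delta> / 2 ^ k)\<^sup>2" by (rule \<Delta>_props(3)[OF s])
  also have "\<dots> = \<delta>\<^sup>2 / 4 ^ k" by (simp add: power_divide power2_eq_square power_mult_distrib[symmetric])
  finally show ?thesis .
qed

text \<open>A cell of level \<open>k\<close> is determined by its tuple of bracket indices up to
  \<open>k\<close>, whence the product of the bracket numbers.\<close>

lemma rep_image:
  "finite (rep k ` T)" "card (rep k ` T) \<le> (\<Prod>j\<le>k. N j)"
proof -
  have sub: "key k ` T \<subseteq> (\<Pi>\<^sub>E j\<in>{..k}. {..<N j})"
  proof
    fix f assume "f \<in> key k ` T"
    then obtain s where "s \<in> T" "f = key k s" by blast
    then show "f \<in> (\<Pi>\<^sub>E j\<in>{..k}. {..<N j})"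
      unfolding key_def by (auto intro!: PiE_I simp: idx_less)
  qed
  have fin: "finite (\<Pi>\<^sub>E j\<in>{..k}. {..<N j})" by (intro finite_PiE) auto
  have eq: "rep k ` T = inv_into T (key k) ` (key k ` T)" by (auto simp: rep_def)
  show "finite (rep k ` T)" unfolding eq using finite_subset[OF sub fin] by simp
  have "card (rep k ` T) \<le> card (key k ` T)"
    unfolding eq using finite_subset[OF sub fin] by (rule card_image_le)
  also have "\<dots> \<le> card (\<Pi>\<^sub>E j\<in>{..k}. {..<N j})" by (rule card_mono[OF fin sub])
  finally show "card (rep k ` T) \<le> (\<Prod>j\<le>k. N j)" by (simp add: card_PiE)
qed

end

section \<open>Uniform bound on the log-likelihood\<close>

locale sampled_chain = cell_chain Q g0 b T \<delta> N idx \<Delta> + iid_sequence M "density Q g0 \<Otimes>\<^sub>M Q" Z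
  for Q :: "'a measure" and g0 b T \<delta> N idx \<Delta> and M :: "'w measure" and Z
begin

text \<open>The exponential moment allows the drift \<open>- dist2 / 2\<close>, of which only half
  is claimed; the rest makes the exponent smaller still. The excess \<open>C0 - 2\<close>,
  multiplied by the tilt \<open>l\<close>, outweighs the entropy constant \<open>B\<close> in the
  union bound.\<close>

lemma center_tail:
  assumes l: "l = 1 / (16 * b\<^sup>2)" and n: "1 \<le> real n * \<delta>\<^sup>2"
    and card: "real (card (rep 0 ` T)) \<le> exp (B * (real n * \<delta>\<^sup>2))"
    and m0: "m0 = l * (C0 - 2) - B" "0 < m0"
  shows "\<exists>E\<in>events. prob E \<le> 1 / m0 \<and> (\<forall>\<omega>\<in>space M - E. \<forall>s\<in>T.
    (\<Sum>i<n. center_loss (rep 0 s) (w 0 s) (Z i \<omega>)) \<le> real n * (- dist2 (rep 0 s) / 4 + C0 * \<delta>\<^sup>2))"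
proof -
  define t where "t c = real n * (- dist2 c / 4 + C0 * \<delta>\<^sup>2)" for c
  \<comment> \<open>The event belongs to the center and its own width; it covers every
    \<open>s\<close> in the cell because \<open>w 0\<close> is constant on cells of level 0.\<close>
  define bad where "bad c = {\<omega> \<in> space M. t c \<le> (\<Sum>i<n. center_loss c (w 0 c) (Z i \<omega>))}" for c
  define E where "E = (\<Union>c\<in>rep 0 ` T. bad c)"
  have l0: "0 < l" using l b by simp
  have c: "bad c \<in> events" "prob (bad c) \<le> exp (- l * (C0 - 2) * (real n * \<delta>\<^sup>2))" if c: "c \<in> T" for c
  proof -
    note le = center_loss_exp[OF c w_meas[OF c, of 0] w_nonneg[OF c, of _ 0] w_le w_L2[OF c, of 0] l]
    note [measurable] = le(1)
    show "bad c \<in> events" unfolding bad_def by measurable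
    have "prob (bad c) \<le> exp (real n * (- l * dist2 c / 2 + 2 * l * (\<delta>\<^sup>2 / 4 ^ 0)) - l * t c)"
      unfolding bad_def by (rule chernoff[OF le(1) l0 le(2) le(3)])
    also have "\<dots> = exp (- (l * real n * dist2 c / 4) + - l * (C0 - 2) * (real n * \<delta>\<^sup>2))"
      by (simp add: t_def field_simps)
    also have "\<dots> \<le> exp (- l * (C0 - 2) * (real n * \<delta>\<^sup>2))" using l0 dist2_nonneg[of c] by simp
    finally show "prob (bad c) \<le> exp (- l * (C0 - 2) * (real n * \<delta>\<^sup>2))" .
  qed
  have "prob E \<le> real (card (rep 0 ` T)) * exp (- l * (C0 - 2) * (real n * \<delta>\<^sup>2))"
    unfolding E_def by (rule prob_UN_le[OF rep_image(1)]) (use c rep_in in auto)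
  also have "\<dots> \<le> exp (B * (real n * \<delta>\<^sup>2)) * exp (- l * (C0 - 2) * (real n * \<delta>\<^sup>2))"
    by (rule mult_right_mono[OF card]) simp
  also have "\<dots> = exp (- (m0 * (real n * \<delta>\<^sup>2)))"
    unfolding exp_add[symmetric] m0 by (simp add: algebra_simps)
  also have "\<dots> \<le> exp (- m0)" using mult_left_mono[OF n, of m0] m0(2) by simp
  also have "\<dots> \<le> 1 / m0" by (rule exp_minus_le_inverse[OF m0(2)])
  finally have "prob E \<le> 1 / m0" .
  moreover have "E \<in> events" unfolding E_def using c rep_in by (intro sets.finite_UN rep_image) auto
  moreover have "(\<Sum>i<n. center_loss (rep 0 s) (w 0 s) (Z i \<omega>)) \<le> t (rep 0 s)"
    if "\<omega> \<in> space M - E" "s \<in> T" for \<omega> s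
  proof -
    have "\<omega> \<notin> bad (rep 0 s)" using that by (auto simp: E_def)
    then show ?thesis using that by (auto simp: bad_def w_rep)
  qed
  ultimately show ?thesis unfolding t_def by blast
qed

text \<open>Chaining controls the centered increments and \<open>increment_mean\<close> their mean;
  76 is the 1 from the former plus the 75 from the latter.\<close>

lemma increment_bound:
  assumes params: "0 < q" "q < 1" "0 < r" "r < 1" "1 < p" "r = p * q" "4 * q * r = 1"
    and card: "\<And>k. real (card (rep k ` T)) \<le> exp (B * p ^ k * (real n * \<delta>\<^sup>2))"
    and n: "1 \<le> real n * \<delta>\<^sup>2" and a: "a = 3 + 2 * b\<^sup>2" and L: "L = 18 + 8 * b\<^sup>2" and C: "0 \<le> C"
    and m: "m = C / a - L / a\<^sup>2 - B * p" "0 < m"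
  shows "\<exists>E\<in>events. prob E \<le> 2 / (m * (1 - 1 / p)) \<and> (\<forall>\<omega>\<in>space M - E. \<forall>s\<in>T.
    (\<Sum>i<n. increment s (rep 0 s) (w 0 s) (Z i \<omega>)) \<le> real n * (dist2 (rep 0 s) / 8)
      + (2 * C / (1 - r) + 2 * L / (a * (1 - r)) + 76) * (real n * \<delta>\<^sup>2))"
proof -
  define F where "F s = increment s (rep 0 s) (w 0 s)" for s
  define W where "W k s = width (w 0 s) (w k s)" for k s
  have a0: "0 < a" using a by (simp add: add_pos_nonneg)
  \<comment> \<open>All functions along one chain share the center \<open>rep 0 s\<close>, so their
    differences fall under \<open>increment_diff\<close>.\<close>
  have F_rep: "F (rep k s) = increment (rep k s) (rep 0 s) (w 0 s)" if "s \<in> T" for k s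
    using that by (simp add: F_def rep_rep w_rep)
  have "\<exists>E\<in>events. prob E \<le> 2 / (m * (1 - 1 / p)) \<and> (\<forall>\<omega>\<in>space M - E. \<forall>s\<in>T.
     deviation n (\<lambda>z. F s z - F (rep 0 s) z) \<omega> \<le> (2 * C / (1 - r) + 2 * L / (a * (1 - r)) + 1) * (real n * \<delta>\<^sup>2))"
  proof (rule chaining[where W = W and q = q and p = p and B = B and v = "\<delta>\<^sup>2"])
    show "F s \<in> borel_measurable D" if "s \<in> T" for s
      unfolding F_def using that by (intro measurable_increment rep_in w_meas)
    show "W k s \<in> borel_measurable D" if "s \<in> T" for k s
      unfolding W_def using that by (intro measurable_width w_meas)
    show "W j (rep k s) = W j s" if "s \<in> T" "j \<le> k" for j k s
      using that by (simp add: W_def w_rep)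
    show "\<bar>F s z - F (rep k s) z\<bar> \<le> W k s z" if "s \<in> T" "z \<in> space D" for k s z
      unfolding F_rep[OF that(1)] W_def unfolding F_def using that by (intro increment_diff rep_in w_ge_rep)
    show "W (Suc k) s z \<le> W k s z" if s: "s \<in> T" and z: "z \<in> space D" for k s z
      unfolding W_def width_def using b by (intro add_mono) (auto intro!: divide_right_mono mult_left_mono)
    show "W 0 s z \<le> a" if "s \<in> T" "z \<in> space D" for s z
      unfolding W_def a using that by (intro width_le w_nonneg w_le)
    show "(LINT z|D. (W k s z)\<^sup>2) \<le> L * \<delta>\<^sup>2 / 4 ^ k" if s: "s \<in> T" for k s
    proof -
      have "(LINT z|D. (W k s z)\<^sup>2) \<le> L * (LINT x|Q. (w k s x)\<^sup>2)"
        unfolding W_def L by (rule width_L2[OF w_meas[OF s] w_meas[OF s] w_nonneg[OF s] w_le])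
      also have "\<dots> \<le> L * (\<delta>\<^sup>2 / 4 ^ k)" using L by (intro mult_left_mono w_L2[OF s]) (simp add: add_nonneg_nonneg)
      finally show ?thesis by simp
    qed
  qed (use rep_in rep_rep rep_image(1) card params a0 n C m in \<open>simp_all\<close>)
  then obtain E where E: "E \<in> events" "prob E \<le> 2 / (m * (1 - 1 / p))"
    "\<And>\<omega> s. \<omega> \<in> space M - E \<Longrightarrow> s \<in> T \<Longrightarrow>
      deviation n (\<lambda>z. F s z - F (rep 0 s) z) \<omega> \<le> (2 * C / (1 - r) + 2 * L / (a * (1 - r)) + 1) * (real n * \<delta>\<^sup>2)"
    by blast
  have "(\<Sum>i<n. F s (Z i \<omega>)) \<le> real n * (dist2 (rep 0 s) / 8)
      + (2 * C / (1 - r) + 2 * L / (a * (1 - r)) + 76) * (real n * \<delta>\<^sup>2)"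
    if \<omega>: "\<omega> \<in> space M - E" and s: "s \<in> T" for \<omega> s
  proof -
    \<comment> \<open>The increment vanishes at the center: \<open>c / c - 1 = 0\<close>, since
      \<open>c\<close> is positive wherever \<open>g0\<close> is.\<close>
    have zero: "F (rep 0 s) z = 0" if "z \<in> space D" for z
      using T_pos[OF rep_in[OF s, of 0], of "fst z"] space_D[OF that] unfolding F_rep[OF s] increment_def by auto
    have "(LINT z|D. F s z - F (rep 0 s) z) = (LINT z|D. F s z)"
      by (rule Bochner_Integration.integral_cong) (simp_all add: zero)
    then have "deviation n (\<lambda>z. F s z - F (rep 0 s) z) \<omega> = (\<Sum>i<n. F s (Z i \<omega>)) - real n * (LINT z|D. F s z)"
      using \<omega> Z_space by (simp add: deviation_def zero)
    moreover have "(LINT z|D. F s z) \<le> dist2 (rep 0 s) / 8 + 75 * \<delta>\<^sup>2"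
      unfolding F_def using w_L2[OF s, of 0]
      by (intro increment_mean s rep_in w_meas w_ge_rep w_le) auto
    from mult_left_mono[OF this, of "real n"]
    have "real n * (LINT z|D. F s z) \<le> real n * (dist2 (rep 0 s) / 8) + 75 * (real n * \<delta>\<^sup>2)"
      by (simp add: algebra_simps)
    ultimately show ?thesis using E(3)[OF \<omega> s] by (simp add: algebra_simps)
  qed
  with E(1,2) show ?thesis unfolding F_def by blast
qed

lemma AE_Z_pos: "AE \<omega> in M. \<forall>i. 0 < g0 (fst (Z i \<omega>))"
proof -
  have "AE z in D. 0 < g0 (fst z)"
  proof (rule AE_distrD[OF measurable_fst])
    show "AE x in distr D P fst. 0 < g0 x"
      unfolding prob_space.distr_pair_fst[OF prob_Q] by (rule AE_P_pos)
  qed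
  then have "AE \<omega> in M. 0 < g0 (fst (Z i \<omega>))" for i
    by (intro AE_distrD[OF Z_measurable[of i], of "\<lambda>z. 0 < g0 (fst z)", unfolded distr_eq])
  then show ?thesis by (simp add: AE_all_countable)
qed

text \<open>The drift \<open>- 1 / 4\<close> at the center and the loss \<open>1 / 8\<close> of the
  increment leave \<open>- 1 / 8\<close>. Passing from the center to \<open>s\<close> halves this to
  \<open>- 1 / 16\<close> and costs one further \<open>\<delta>^2\<close>, which raises 76 to
  77.\<close>

lemma likelihood_bound:
  assumes params: "0 < q" "q < 1" "0 < r" "r < 1" "1 < p" "r = p * q" "4 * q * r = 1"
    and card: "\<And>k. real (card (rep k ` T)) \<le> exp (B * p ^ k * (real n * \<delta>\<^sup>2))"
    and n: "1 \<le> real n * \<delta>\<^sup>2" and a: "a = 3 + 2 * b\<^sup>2" and L: "L = 18 + 8 * b\<^sup>2" and C: "0 \<le> C"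
    and m: "m = C / a - L / a\<^sup>2 - B * p" "0 < m"
    and l: "l = 1 / (16 * b\<^sup>2)" and m0: "m0 = l * (C0 - 2) - B" "0 < m0"
    and C': "C' = C0 + 2 * C / (1 - r) + 2 * L / (a * (1 - r)) + 77"
  shows "\<exists>E\<in>events. prob E \<le> 1 / m0 + 2 / (m * (1 - 1 / p)) \<and> (\<forall>\<omega>\<in>space M - E. \<forall>s\<in>T.
    (\<Sum>i<n. 2 * ln (s (fst (Z i \<omega>)) / sqrt (g0 (fst (Z i \<omega>)))) - ((s (snd (Z i \<omega>)))\<^sup>2 - g0 (snd (Z i \<omega>))))
      \<le> - (real n * dist2 s / 16) + C' * (real n * \<delta>\<^sup>2))"
proof -
  have card0: "real (card (rep 0 ` T)) \<le> exp (B * (real n * \<delta>\<^sup>2))" using card[of 0] by simp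
  obtain E1 where E1: "E1 \<in> events" "prob E1 \<le> 1 / m0" "\<And>\<omega> s. \<omega> \<in> space M - E1 \<Longrightarrow> s \<in> T \<Longrightarrow>
    (\<Sum>i<n. center_loss (rep 0 s) (w 0 s) (Z i \<omega>)) \<le> real n * (- dist2 (rep 0 s) / 4 + C0 * \<delta>\<^sup>2)"
    using center_tail[OF l n card0 m0] by blast
  obtain E2 where E2: "E2 \<in> events" "prob E2 \<le> 2 / (m * (1 - 1 / p))" "\<And>\<omega> s. \<omega> \<in> space M - E2 \<Longrightarrow> s \<in> T \<Longrightarrow>
    (\<Sum>i<n. increment s (rep 0 s) (w 0 s) (Z i \<omega>)) \<le> real n * (dist2 (rep 0 s) / 8)
      + (2 * C / (1 - r) + 2 * L / (a * (1 - r)) + 76) * (real n * \<delta>\<^sup>2)"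
    using increment_bound[OF params card n a L C m] by blast
  obtain E0 where E0: "E0 \<in> events" "prob E0 = 0" "\<And>\<omega>. \<omega> \<in> space M - E0 \<Longrightarrow> \<forall>i. 0 < g0 (fst (Z i \<omega>))"
  proof -
    obtain N0 where "{\<omega> \<in> space M. \<not> (\<forall>i. 0 < g0 (fst (Z i \<omega>)))} \<subseteq> N0" "emeasure M N0 = 0" "N0 \<in> events"
      using AE_Z_pos by (rule AE_E)
    then show ?thesis using that[of N0] by (auto simp: measure_def)
  qed
  define E where "E = E0 \<union> (E1 \<union> E2)"
  have "prob E \<le> prob E0 + (prob E1 + prob E2)"
    unfolding E_def using E0 E1 E2
    by (intro order_trans[OF measure_Un_le] add_left_mono measure_Un_le) auto
  then have E_le: "prob E \<le> 1 / m0 + 2 / (m * (1 - 1 / p))" using E0(2) E1(2) E2(2) by linarith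
  have "(\<Sum>i<n. 2 * ln (s (fst (Z i \<omega>)) / sqrt (g0 (fst (Z i \<omega>)))) - ((s (snd (Z i \<omega>)))\<^sup>2 - g0 (snd (Z i \<omega>))))
      \<le> - (real n * dist2 s / 16) + C' * (real n * \<delta>\<^sup>2)" (is "?S \<le> _")
    if \<omega>: "\<omega> \<in> space M - E" and s: "s \<in> T" for \<omega> s
  proof -
    have "?S \<le> (\<Sum>i<n. center_loss (rep 0 s) (w 0 s) (Z i \<omega>) + increment s (rep 0 s) (w 0 s) (Z i \<omega>))"
    proof (rule sum_mono)
      fix i
      have z: "Z i \<omega> \<in> space D" using \<omega> Z_space by blast
      show "2 * ln (s (fst (Z i \<omega>)) / sqrt (g0 (fst (Z i \<omega>)))) - ((s (snd (Z i \<omega>)))\<^sup>2 - g0 (snd (Z i \<omega>)))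
        \<le> center_loss (rep 0 s) (w 0 s) (Z i \<omega>) + increment s (rep 0 s) (w 0 s) (Z i \<omega>)"
        using E0(3)[of \<omega>] \<omega> space_D[OF z]
        by (intro loss_le s rep_in z w_ge_rep) (auto simp: E_def)
    qed
    also have "\<dots> \<le> real n * (- dist2 (rep 0 s) / 4 + C0 * \<delta>\<^sup>2) + (real n * (dist2 (rep 0 s) / 8)
      + (2 * C / (1 - r) + 2 * L / (a * (1 - r)) + 76) * (real n * \<delta>\<^sup>2))"
      unfolding sum.distrib using \<omega> s by (intro add_mono E1(3) E2(3)) (auto simp: E_def)
    also have "\<dots> = - (real n * (dist2 (rep 0 s) / 8)) + (C' - 1) * (real n * \<delta>\<^sup>2)"
      unfolding C' by (simp add: algebra_simps)
    also have "\<dots> \<le> - (real n * (dist2 s / 16 - \<delta>\<^sup>2)) + (C' - 1) * (real n * \<delta>\<^sup>2)"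
    proof -
      have "dist2 s \<le> 2 * dist2 (rep 0 s) + 2 * (LINT x|Q. (w 0 s x)\<^sup>2)"
        by (intro dist2_le_double s rep_in w_meas w_ge_rep w_le)
      then have "dist2 s / 16 - \<delta>\<^sup>2 \<le> dist2 (rep 0 s) / 8" using w_L2[OF s, of 0] zero_le_power2[of \<delta>]
        unfolding power_0 div_by_1 by linarith
      from mult_left_mono[OF this, of "real n"] show ?thesis by simp
    qed
    also have "\<dots> = - (real n * dist2 s / 16) + C' * (real n * \<delta>\<^sup>2)" by (simp add: algebra_simps)
    finally show ?thesis .
  qed
  moreover have "E \<in> events" unfolding E_def using E0 E1 E2 by auto
  ultimately show ?thesis using E_le by blast
qed

text \<open>Halving the scale multiplies the entropy bound by \<open>p\<close>, so the sum over all
  levels up to \<open>k\<close> is a geometric sum dominated by its last term; this costs the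
  constant factor \<open>p / (p - 1)\<close>.\<close>

lemma card_bound:
  assumes N: "\<And>k. real (N k) \<le> exp (A * (\<delta> / 2 ^ k) powr (- \<gamma>))" and A: "0 \<le> A" and \<delta>: "0 < \<delta>"
    and p: "p = 2 powr \<gamma>" "1 < p"
  shows "real (card (rep k ` T)) \<le> exp (A * p / (p - 1) * p ^ k * \<delta> powr (- \<gamma>))"
proof -
  have pj: "(\<delta> / 2 ^ j) powr (- \<gamma>) = p ^ j * \<delta> powr (- \<gamma>)" for j
  proof -
    have "(2 ^ j) powr (- \<gamma>) = inverse (p ^ j)"
      unfolding p(1) by (simp add: powr_minus powr_realpow[symmetric] powr_powr mult.commute)
    then show ?thesis using \<delta> by (simp add: powr_divide divide_inverse[of _ "inverse _"])
  qed
  have "real (card (rep k ` T)) \<le> real (\<Prod>j\<le>k. N j)" using rep_image(2)[of k] of_nat_le_iff by blast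
  also have "\<dots> = (\<Prod>j\<le>k. real (N j))" by simp
  also have "\<dots> \<le> (\<Prod>j\<le>k. exp (A * (\<delta> / 2 ^ j) powr (- \<gamma>)))" by (intro prod_mono) (simp add: N)
  also have "\<dots> = exp (A * \<delta> powr (- \<gamma>) * (\<Sum>j\<le>k. p ^ j))"
    unfolding pj by (simp add: exp_sum[symmetric] sum_distrib_left mult_ac)
  also have "\<dots> \<le> exp (A * \<delta> powr (- \<gamma>) * (p / (p - 1) * p ^ k))"
  proof -
    have "(1 - p) * (\<Sum>j\<le>k. p ^ j) = 1 - p * p ^ k"
      using one_diff_power_eq[of p "Suc k"] by (simp add: lessThan_Suc_atMost)
    then have "(p - 1) * (\<Sum>j\<le>k. p ^ j) = p * p ^ k - 1" by (simp add: algebra_simps)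
    then have "(\<Sum>j\<le>k. p ^ j) \<le> p / (p - 1) * p ^ k" using p by (simp add: field_simps)
    then show ?thesis unfolding exp_le_cancel_iff using A by (intro mult_left_mono) auto
  qed
  finally show ?thesis by (simp add: mult_ac)
qed

end

text \<open>Only the scale \<delta> and the cells are chosen anew for each \<open>n\<close>; every
  constant is fixed beforehand from \<open>A\<close>, \<open>b\<close>, \<gamma> and
  \<epsilon>.\<close>

lemma (in density_class) uniform_likelihood_bound:
  fixes \<gamma> :: real
  assumes \<gamma>: "0 < \<gamma>" "\<gamma> < 2" and A: "0 \<le> A"
    and entropy: "\<And>\<delta>. 0 < \<delta> \<Longrightarrow> \<exists>N idx \<Delta>. real N \<le> exp (A * \<delta> powr (- \<gamma>)) \<and> L2_cells \<delta> N idx \<Delta>"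
    and iid: "iid_sequence M D Z" and \<epsilon>: "0 < \<epsilon>"
  shows "\<exists>C\<ge>0. \<forall>n\<ge>1. \<exists>E\<in>sets M. measure M E \<le> \<epsilon> \<and> (\<forall>\<omega>\<in>space M - E. \<forall>s\<in>T.
    (\<Sum>i<n. 2 * ln (s (fst (Z i \<omega>)) / sqrt (g0 (fst (Z i \<omega>)))) - ((s (snd (Z i \<omega>)))\<^sup>2 - g0 (snd (Z i \<omega>))))
      \<le> - (real n * dist2 s / 16) + C * (real n * real n powr (- 2 / (\<gamma> + 2))))"
proof -
  interpret iid_sequence M D Z by (rule iid)
  \<comment> \<open>The solution of \<open>r = p * q\<close> and \<open>4 * q * r = 1\<close> for
    \<open>p = 2 powr \<gamma>\<close>. The condition \<open>r < 1\<close> is exactly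
    \<open>\<gamma> < 2\<close>.\<close>
  define p where "p = 2 powr \<gamma>"
  define q :: real where "q = 2 powr (- 1 - \<gamma> / 2)"
  define r :: real where "r = 2 powr (\<gamma> / 2 - 1)"
  have four: "(4 :: real) = 2 powr 2" by simp
  have params: "0 < q" "q < 1" "0 < r" "r < 1" "1 < p" "r = p * q" "4 * q * r = 1"
  proof -
    show "0 < q" "0 < r" by (simp_all add: q_def r_def)
    show "q < 1" "r < 1" unfolding q_def r_def using \<gamma> by (simp_all add: powr_less_one)
    show "1 < p" unfolding p_def using \<gamma> by simp
    show "r = p * q" unfolding p_def q_def r_def powr_add[symmetric] by simp
    show "4 * q * r = 1" unfolding four q_def r_def powr_add[symmetric] by simp
  qed
  define B where "B = A * p / (p - 1)"
  have B: "0 \<le> B" using A params by (simp add: B_def)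
  define a where "a = 3 + 2 * b\<^sup>2"
  define L where "L = 18 + 8 * b\<^sup>2"
  define l where "l = 1 / (16 * b\<^sup>2)"
  \<comment> \<open>\<open>m\<close> and \<open>m0\<close> make each of the two failure
    probabilities \<epsilon> / 2; \<open>C\<close> and \<open>C0\<close> then solve the equations
    relating them to these margins.\<close>
  define m where "m = 4 / (\<epsilon> * (1 - 1 / p))"
  define C where "C = a * (m + L / a\<^sup>2 + B * p)"
  define m0 where "m0 = 2 / \<epsilon>"
  define C0 where "C0 = 2 + (m0 + B) / l"
  define C' where "C' = C0 + 2 * C / (1 - r) + 2 * L / (a * (1 - r)) + 77"
  have a0: "0 < a" and L0: "0 \<le> L" and l0: "0 < l" using b by (auto simp: a_def L_def l_def add_pos_nonneg)
  have m1: "0 < m" "0 < m0" using params \<epsilon> by (auto simp: m_def m0_def)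
  have C1: "0 \<le> C" "0 \<le> C0" using a0 L0 l0 m1 B params by (auto simp: C_def C0_def)
  have mC: "m = C / a - L / a\<^sup>2 - B * p" "m0 = l * (C0 - 2) - B" using a0 l0 by (auto simp: C_def C0_def)
  have me: "1 / m0 + 2 / (m * (1 - 1 / p)) = \<epsilon>" proof -
    define u where "u = 1 - 1 / p"
    have "0 < u" using params by (simp add: u_def)
    then show ?thesis using \<epsilon> unfolding m_def m0_def u_def[symmetric] by (simp add: field_simps)
  qed
  have "0 \<le> C'" unfolding C'_def using C1 a0 L0 params by (intro add_nonneg_nonneg) auto
  moreover have "\<exists>E\<in>sets M. measure M E \<le> \<epsilon> \<and> (\<forall>\<omega>\<in>space M - E. \<forall>s\<in>T.
    (\<Sum>i<n. 2 * ln (s (fst (Z i \<omega>)) / sqrt (g0 (fst (Z i \<omega>)))) - ((s (snd (Z i \<omega>)))\<^sup>2 - g0 (snd (Z i \<omega>))))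
      \<le> - (real n * dist2 s / 16) + C' * (real n * real n powr (- 2 / (\<gamma> + 2))))" if n: "1 \<le> n" for n :: nat
  proof -
    define \<delta> where "\<delta> = real n powr (- 1 / (\<gamma> + 2))"
    have \<delta>: "0 < \<delta>" using n by (simp add: \<delta>_def)
    have d2: "\<delta>\<^sup>2 = real n powr (- 2 / (\<gamma> + 2))"
      using \<gamma> n unfolding \<delta>_def power2_eq_square powr_add[symmetric] by (simp add: field_simps)
    have nd: "real n * \<delta>\<^sup>2 = real n powr (\<gamma> / (\<gamma> + 2))"
    proof -
      have "real n * \<delta>\<^sup>2 = real n powr (1 + - 2 / (\<gamma> + 2))" unfolding d2 powr_add using n by simp
      also have "1 + - 2 / (\<gamma> + 2) = \<gamma> / (\<gamma> + 2)" using \<gamma> by (simp add: field_simps)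
      finally show ?thesis .
    qed
    \<comment> \<open>The equation that determines the rate: the entropy scale equals the exponent
      \<open>n * \<delta>^2\<close>.\<close>
    have dg: "\<delta> powr (- \<gamma>) = real n * \<delta>\<^sup>2" unfolding nd unfolding \<delta>_def powr_powr by simp
    have n1: "1 \<le> real n * \<delta>\<^sup>2" unfolding nd using n \<gamma> by (intro ge_one_powr_ge_zero) auto
    have "\<forall>k. \<exists>N idx \<Delta>. real N \<le> exp (A * (\<delta> / 2 ^ k) powr (- \<gamma>)) \<and> L2_cells (\<delta> / 2 ^ k) N idx \<Delta>"
      using entropy \<delta> by simp
    then obtain N idx \<Delta> where cov: "\<And>k. real (N k) \<le> exp (A * (\<delta> / 2 ^ k) powr (- \<gamma>))"
      "\<And>k. L2_cells (\<delta> / 2 ^ k) (N k) (idx k) (\<Delta> k)" by metis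
    interpret sampled_chain Q g0 b T \<delta> N idx \<Delta> M Z
      by unfold_locales (rule cov)
    have card: "real (card (rep k ` T)) \<le> exp (B * p ^ k * (real n * \<delta>\<^sup>2))" for k
      using card_bound[OF cov(1) A \<delta> p_def params(5), of k] unfolding dg B_def .
    show ?thesis
      using likelihood_bound[OF params card n1 a_def L_def C1(1) mC(1) m1(1) l_def mC(2) m1(2) C'_def]
      unfolding me d2 .
  qed
  ultimately show ?thesis by blast
qed

section \<open>The maximum likelihood estimator\<close>

lemma emp_criterion_pos:
  assumes "\<And>i. i < n \<Longrightarrow> 0 < g (x i)" "1 \<le> n"
  shows "emp_criterion n x y g = ereal ((\<Sum>i<n. ln (g (x i)) - g (y i)) / real n)"
proof -
  have "(\<Sum>i<n. elog (g (x i))) = (\<Sum>i<n. ereal (ln (g (x i))))"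
    using assms by (intro sum.cong) (auto simp: elog_def)
  then show ?thesis using assms(2) by (simp add: emp_criterion_def sum_subtractf diff_divide_distrib)
qed

text \<open>A single summand \<open>- \<infinity>\<close> decides the sum because no other summand
  is \<open>\<infinity>\<close>; on extended reals \<open>- \<infinity> + \<infinity>\<close> would
  be \<open>\<infinity>\<close>.\<close>

lemma emp_criterion_nonpos:
  assumes "i < n" "g (x i) \<le> 0"
  shows "emp_criterion n x y g = - \<infinity>"
proof -
  have "(\<Sum>j\<in>{..<n} - {i}. elog (g (x j))) \<noteq> \<infinity>"
    unfolding sum_Pinfty by (auto simp: elog_def)
  moreover have "(\<Sum>j<n. elog (g (x j))) = elog (g (x i)) + (\<Sum>j\<in>{..<n} - {i}. elog (g (x j)))"
    using assms by (intro sum.remove) auto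
  ultimately have "(\<Sum>j<n. elog (g (x j))) = - \<infinity>"
    using assms by (simp add: elog_def)
  then show ?thesis using assms by (simp add: emp_criterion_def)
qed

text \<open>The competitor \<open>h\<close> has a finite criterion, so that of the maximizer is not
  \<open>- \<infinity>\<close>. This forces positivity at the sample points and turns the comparison
  into one of real numbers.\<close>

lemma arg_max_criterion:
  assumes "is_arg_max (emp_criterion n x y) (\<lambda>g. g \<in> \<G>) g" "h \<in> \<G>" "1 \<le> n"
    and h: "\<And>i. i < n \<Longrightarrow> 0 < h (x i)"
  shows "\<And>i. i < n \<Longrightarrow> 0 < g (x i)" "(\<Sum>i<n. ln (h (x i)) - h (y i)) \<le> (\<Sum>i<n. ln (g (x i)) - g (y i))"
proof -
  have le: "emp_criterion n x y h \<le> emp_criterion n x y g"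
    using assms(1,2) by (auto simp: is_arg_max_def not_less)
  show pos: "0 < g (x i)" if "i < n" for i
  proof (rule ccontr)
    assume "\<not> 0 < g (x i)"
    then have "emp_criterion n x y g = - \<infinity>" using that by (intro emp_criterion_nonpos[of i]) auto
    then show False using le emp_criterion_pos[of n h x y] h assms(3) by simp
  qed
  show "(\<Sum>i<n. ln (h (x i)) - h (y i)) \<le> (\<Sum>i<n. ln (g (x i)) - g (y i))"
    using le emp_criterion_pos[of n h x y] emp_criterion_pos[of n g x y] h pos assms(3)
    by (simp add: divide_le_cancel)
qed

text \<open>Concavity of the logarithm, as the arithmetic-geometric mean inequality. It replaces
  \<open>g\<close>, which may be arbitrarily small, by a mean that is at least
  \<open>h / 2\<close>.\<close>

lemma ln_mean_ge:
  fixes g h :: real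
  assumes "0 < g" "0 < h"
  shows "(ln g - ln h) / 2 \<le> 2 * ln (sqrt ((g + h) / 2) / sqrt h)"
proof -
  have "g * h \<le> ((g + h) / 2)\<^sup>2"
    using zero_le_power2[of "g - h"] by (simp add: power2_eq_square algebra_simps)
  then have "ln (g * h) \<le> ln (((g + h) / 2)\<^sup>2)" using assms by (intro ln_mono) auto
  then have "ln g + ln h \<le> 2 * ln ((g + h) / 2)"
    using assms by (simp add: ln_mult ln_realpow)
  moreover have "2 * ln (sqrt ((g + h) / 2) / sqrt h) = ln ((g + h) / 2) - ln h"
    using assms by (simp add: ln_div ln_sqrt)
  moreover have "(x - y) / 2 \<le> w" if "x + y \<le> 2 * z" "w = z - y" for x y z w :: real
    using that by (simp add: field_simps)
  ultimately show ?thesis by blast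
qed

text \<open>With \<open>m\<close> the root of the mean,
  \<open>(a - c) * (a + c) = 2 * (m - c) * (m + c)\<close>, and
  \<open>m + c \<le> 2 * (a + c)\<close>. This carries the rate from \<open>s\<close> back to the
  Hellinger distance of \<open>g\<close>.\<close>

lemma sqrt_diff_le_sqrt_mean:
  fixes g h :: real
  assumes "0 \<le> g" "0 \<le> h"
  shows "(sqrt h - sqrt g)\<^sup>2 \<le> 16 * (sqrt ((g + h) / 2) - sqrt h)\<^sup>2"
proof -
  define a where "a = sqrt g"
  define c where "c = sqrt h"
  define m where "m = sqrt ((g + h) / 2)"
  have nn: "0 \<le> a" "0 \<le> c" "0 \<le> m" using assms by (simp_all add: a_def c_def m_def)
  have sq: "a\<^sup>2 = g" "c\<^sup>2 = h" "m\<^sup>2 = (a\<^sup>2 + c\<^sup>2) / 2" using assms by (simp_all add: a_def c_def m_def)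
  have "m\<^sup>2 \<le> a\<^sup>2 + c\<^sup>2" unfolding sq(3) using zero_le_power2[of a] zero_le_power2[of c] by (simp add: field_simps)
  moreover have "0 \<le> a * c" using nn by simp
  ultimately have "m\<^sup>2 \<le> (a + c)\<^sup>2" by (simp add: power2_sum)
  then have mle: "m \<le> a + c" by (rule power2_le_imp_le) (use nn in simp)
  have "\<bar>a - c\<bar> \<le> 4 * \<bar>m - c\<bar>"
  proof (cases "a + c = 0")
    case True
    then have "a = 0" "c = 0" using nn by auto
    then show ?thesis by simp
  next
    case False
    have "(a - c) * (a + c) = 2 * ((m - c) * (m + c))"
      using sq(3) by (simp add: power2_eq_square algebra_simps)
    then have "\<bar>a - c\<bar> * (a + c) = 2 * (\<bar>m - c\<bar> * (m + c))"
      using nn by (metis abs_mult abs_numeral abs_of_nonneg add_nonneg_nonneg)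
    also have "\<dots> \<le> 2 * (\<bar>m - c\<bar> * (2 * (a + c)))"
      using mle nn by (intro mult_left_mono) auto
    also have "\<dots> = 4 * \<bar>m - c\<bar> * (a + c)" by (simp add: algebra_simps)
    finally have "\<bar>a - c\<bar> * (a + c) \<le> 4 * \<bar>m - c\<bar> * (a + c)" .
    then show ?thesis using False nn by (simp add: mult_le_cancel_right)
  qed
  then have "\<bar>c - a\<bar>\<^sup>2 \<le> (4 * \<bar>m - c\<bar>)\<^sup>2" by (intro power_mono) auto
  then show ?thesis unfolding a_def[symmetric] c_def[symmetric] m_def[symmetric]
    by (simp add: power_mult_distrib)
qed

section \<open>From entropy, samples and densities to the abstract setting\<close>

lemma bracketing_entropy_cover:
  assumes "bracketing_entropy Q \<delta> F \<le> ereal c" "F \<noteq> {}"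
  obtains N where "real N \<le> exp c" "L2_bracket_cover Q \<delta> F N"
proof -
  obtain N where N: "bracketing_number Q \<delta> F = enat N"
    using assms(1) by (auto simp: bracketing_entropy_def split: enat.splits)
  let ?S = "{enat N |N. L2_bracket_cover Q \<delta> F N}"
  \<comment> \<open>The infimum of the empty set is infinite, so a finite bracketing number is
    attained by some cover.\<close>
  have "?S \<noteq> {}" using N unfolding bracketing_number_def by (auto simp: Inf_enat_def split: if_splits)
  then have "Inf ?S \<in> ?S" unfolding Inf_enat_def by (auto intro: LeastI)
  then have cov: "L2_bracket_cover Q \<delta> F N" using N unfolding bracketing_number_def by auto
  then have "0 < N" using assms(2) unfolding L2_bracket_cover_def by (metis ex_in_conv gr_zeroI not_less0)
  moreover have "ln (real N) \<le> c" using assms(1) N by (simp add: bracketing_entropy_def)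
  ultimately have "real N \<le> exp c" by (metis exp_le_cancel_iff exp_ln of_nat_0_less_iff)
  with cov show ?thesis using that by blast
qed

text \<open>The joint family is grouped into the disjoint blocks of \<open>Inl i\<close> and
  \<open>Inr i\<close>: the blocks are independent of each other, and independence inside a block
  makes its law a product.\<close>

lemma iid_sequence_pairs:
  assumes M: "prob_space M"
    and X: "\<And>i. X i \<in> measurable M R" "\<And>i. distr M R (X i) = P"
    and Y: "\<And>i. Y i \<in> measurable M R" "\<And>i. distr M R (Y i) = Q"
    and indep: "prob_space.indep_vars M (\<lambda>_. R) (case_sum X Y) (UNIV :: (nat + nat) set)"
  shows "iid_sequence M (P \<Otimes>\<^sub>M Q) (\<lambda>i \<omega>. (X i \<omega>, Y i \<omega>))"
proof -
  interpret prob_space M by (rule M)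
  have sets: "sets P = sets R" "sets Q = sets R" using X(2)[of 0] Y(2)[of 0] by auto
  have sets_PQ: "sets (P \<Otimes>\<^sub>M Q) = sets (R \<Otimes>\<^sub>M R)" by (rule sets_pair_measure_cong[OF sets])
  let ?K = "\<lambda>i :: nat. {Inl i, Inr i :: nat + nat}"
  have "indep_vars (\<lambda>i. PiM (?K i) (\<lambda>_. R)) (\<lambda>i \<omega>. restrict (\<lambda>j. case_sum X Y j \<omega>) (?K i)) UNIV"
    by (rule indep_vars_restrict[OF indep]) (auto simp: disjoint_family_on_def)
  then have "indep_vars (\<lambda>_. P \<Otimes>\<^sub>M Q)
      (\<lambda>i \<omega>. (\<lambda>f. (f (Inl i), f (Inr i))) (restrict (\<lambda>j. case_sum X Y j \<omega>) (?K i))) UNIV"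
  proof (rule indep_vars_compose2)
    fix i
    have "(\<lambda>f. (f (Inl i), f (Inr i))) \<in> measurable (PiM (?K i) (\<lambda>_. R)) (R \<Otimes>\<^sub>M R)"
      by (intro measurable_Pair measurable_component_singleton) auto
    then show "(\<lambda>f. (f (Inl i), f (Inr i))) \<in> measurable (PiM (?K i) (\<lambda>_. R)) (P \<Otimes>\<^sub>M Q)"
      using measurable_cong_sets[OF refl sets_PQ] by blast
  qed
  then have iv: "indep_vars (\<lambda>_. P \<Otimes>\<^sub>M Q) (\<lambda>i \<omega>. (X i \<omega>, Y i \<omega>)) UNIV" by simp
  have "distr M (P \<Otimes>\<^sub>M Q) (\<lambda>\<omega>. (X i \<omega>, Y i \<omega>)) = P \<Otimes>\<^sub>M Q" for i
  proof -
    have "indep_var (PiM {Inl i} (\<lambda>_. R)) (\<lambda>\<omega>. restrict (\<lambda>j. case_sum X Y j \<omega>) {Inl i})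
        (PiM {Inr i} (\<lambda>_. R)) (\<lambda>\<omega>. restrict (\<lambda>j. case_sum X Y j \<omega>) {Inr i})"
      by (rule indep_var_restrict[OF indep]) auto
    from indep_var_compose[OF this, of "\<lambda>f. f (Inl i)" R "\<lambda>f. f (Inr i)" R]
    have "indep_var R (X i) R (Y i)" by (simp add: comp_def measurable_component_singleton)
    then have "P \<Otimes>\<^sub>M Q = distr M (R \<Otimes>\<^sub>M R) (\<lambda>\<omega>. (X i \<omega>, Y i \<omega>))"
      unfolding indep_var_distribution_eq X(2) Y(2) by simp
    also have "\<dots> = distr M (P \<Otimes>\<^sub>M Q) (\<lambda>\<omega>. (X i \<omega>, Y i \<omega>))" by (rule distr_cong) (simp_all add: sets_PQ)
    finally show ?thesis by simp
  qed
  with iv show ?thesis by unfold_locales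
qed

text \<open>The brackets are given for the quotient \<open>g0\<close>, the cells are wanted for its
  version \<open>g1\<close>. On the null set where the two differ the width is set to
  \<open>b\<close>, which bounds every difference in \<open>T\<close> and leaves the
  \<open>L2(Q)\<close> norm unchanged.\<close>

lemma L2_cells_of_bracket_cover:
  fixes Q :: "'a measure" and \<G> :: "('a \<Rightarrow> real) set" and g0 g1 :: "'a \<Rightarrow> real"
  defines "T \<equiv> (\<lambda>g x. sqrt ((g x + g1 x) / 2)) ` \<G>"
  assumes T: "density_class Q g1 b T" and g0: "g0 \<in> borel_measurable Q" and eq: "AE x in Q. g1 x = g0 x"
    and cov: "L2_bracket_cover Q \<delta> ((\<lambda>g x. sqrt ((g x + g0 x) / 2)) ` \<G>) N"
  shows "\<exists>idx \<Delta>. density_class.L2_cells Q T \<delta> N idx \<Delta>"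
proof -
  interpret density_class Q g1 b T by (rule T)
  note [measurable] = g0
  obtain fL fU where f: "\<And>j. j < N \<Longrightarrow> fL j \<in> borel_measurable Q" "\<And>j. j < N \<Longrightarrow> fU j \<in> borel_measurable Q"
      "\<And>j. j < N \<Longrightarrow> integrable Q (\<lambda>x. (fU j x - fL j x)\<^sup>2)"
      "\<And>j. j < N \<Longrightarrow> sqrt (LINT x|Q. (fU j x - fL j x)\<^sup>2) \<le> \<delta>"
    and br: "\<forall>f\<in>(\<lambda>g x. sqrt ((g x + g0 x) / 2)) ` \<G>. \<exists>j<N. \<forall>x\<in>space Q. fL j x \<le> f x \<and> f x \<le> fU j x"
    using cov unfolding L2_bracket_cover_def by blast
  define \<Delta> where "\<Delta> j x = (if g1 x = g0 x then fU j x - fL j x else b)" for j x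
  have "\<exists>j<N. \<forall>x\<in>space Q. g1 x = g0 x \<longrightarrow> fL j x \<le> s x \<and> s x \<le> fU j x" if s: "s \<in> T" for s
  proof -
    obtain g where g: "g \<in> \<G>" "s = (\<lambda>x. sqrt ((g x + g1 x) / 2))" using s by (auto simp: T_def)
    from bspec[OF br imageI[OF g(1)]] obtain j where "j < N" "\<forall>x\<in>space Q. fL j x \<le> sqrt ((g x + g0 x) / 2) \<and> sqrt ((g x + g0 x) / 2) \<le> fU j x"
      by auto
    then show ?thesis unfolding g(2) by (intro exI[of _ j]) simp
  qed
  then obtain idx where idx: "\<And>s. s \<in> T \<Longrightarrow> idx s < N"
    "\<And>s x. s \<in> T \<Longrightarrow> x \<in> space Q \<Longrightarrow> g1 x = g0 x \<Longrightarrow> fL (idx s) x \<le> s x \<and> s x \<le> fU (idx s) x" by metis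
  have "L2_cells \<delta> N idx \<Delta>"
    unfolding L2_cells_def
  proof (intro conjI ballI allI impI)
    fix j assume j: "j < N"
    note [measurable] = f(1,2)[OF j]
    show m: "\<Delta> j \<in> borel_measurable Q" unfolding \<Delta>_def[abs_def] by measurable
    note [measurable] = m
    have ae: "AE x in Q. (\<Delta> j x)\<^sup>2 = (fU j x - fL j x)\<^sup>2" using eq by eventually_elim (simp add: \<Delta>_def)
    show "integrable Q (\<lambda>x. (\<Delta> j x)\<^sup>2)"
      using integrable_cong_AE[of "\<lambda>x. (\<Delta> j x)\<^sup>2" Q "\<lambda>x. (fU j x - fL j x)\<^sup>2"] ae f(3)[OF j] by simp
    have "(LINT x|Q. (\<Delta> j x)\<^sup>2) = (LINT x|Q. (fU j x - fL j x)\<^sup>2)"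
      by (rule integral_cong_AE) (use ae in auto)
    also have "\<dots> \<le> \<delta>\<^sup>2" by (rule sqrt_le_D[OF f(4)[OF j]])
    finally show "(LINT x|Q. (\<Delta> j x)\<^sup>2) \<le> \<delta>\<^sup>2" .
  next
    fix s s' x assume s: "s \<in> T" "s' \<in> T" and i: "idx s = idx s'" and x: "x \<in> space Q"
    show "\<bar>s x - s' x\<bar> \<le> \<Delta> (idx s) x"
    proof (cases "g1 x = g0 x")
      case True
      then show ?thesis using idx(2)[OF s(1) x True] idx(2)[OF s(2) x True] i unfolding \<Delta>_def by auto
    next
      case False
      then show ?thesis using T_nonneg[OF s(1) x] T_le[OF s(1) x] T_nonneg[OF s(2) x] T_le[OF s(2) x]
        unfolding \<Delta>_def by auto
    qed
  qed (use idx in auto)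
  then show ?thesis by blast
qed

text \<open>The tail bound is used with range parameter \<open>\<beta> * sqrt n\<close> in place of
  \<beta>. The variance term then equals 1, the exponent becomes \<open>- 2 / \<epsilon>\<close>,
  and each sign has failure probability at most \<open>\<epsilon> / 2\<close>.\<close>

lemma (in iid_sequence) deviation_bounded:
  assumes \<phi>: "\<phi> \<in> borel_measurable D" and b: "\<And>z. z \<in> space D \<Longrightarrow> \<bar>\<phi> z\<bar> \<le> \<beta>" and \<beta>: "0 < \<beta>" and \<epsilon>: "0 < \<epsilon>"
  shows "\<exists>C\<ge>0. \<forall>n\<ge>1. \<exists>E\<in>events. prob E \<le> \<epsilon> \<and> (\<forall>\<omega>\<in>space M - E. \<bar>deviation n \<phi> \<omega>\<bar> \<le> C * sqrt (real n))"
proof -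
  interpret D: prob_space D by (rule prob_space_D)
  define C where "C = \<beta> * (1 + 2 / \<epsilon>)"
  have "\<exists>E\<in>events. prob E \<le> \<epsilon> \<and> (\<forall>\<omega>\<in>space M - E. \<bar>deviation n \<phi> \<omega>\<bar> \<le> C * sqrt (real n))" if n: "1 \<le> n" for n
  proof -
    define t where "t = C * sqrt (real n)"
    have tail: "prob {\<omega> \<in> space M. t \<le> deviation n \<psi> \<omega>} \<le> \<epsilon> / 2"
      if \<psi>: "\<psi> \<in> borel_measurable D" "\<And>z. z \<in> space D \<Longrightarrow> \<bar>\<psi> z\<bar> \<le> \<beta>" for \<psi>
    proof -
      have sq: "\<bar>(\<psi> z)\<^sup>2\<bar> \<le> \<beta>\<^sup>2" if "z \<in> space D" for z
        using power_mono[OF \<psi>(2)[OF that], of 2] by simp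
      have "integrable D (\<lambda>z. (\<psi> z)\<^sup>2)"
        by (rule integrable_of_bounded[OF prob_space_D _ sq]) (use \<psi>(1) in measurable)
      then have v: "(LINT z|D. (\<psi> z)\<^sup>2) \<le> \<beta>\<^sup>2"
        by (rule D.integral_le_const) (use sq in auto)
      have "prob {\<omega> \<in> space M. t \<le> deviation n \<psi> \<omega>}
          \<le> exp (real n * \<beta>\<^sup>2 / (\<beta> * sqrt (real n))\<^sup>2 - t / (\<beta> * sqrt (real n)))"
      proof (rule deviation_tail[OF \<psi>(1) _ _ v])
        fix z assume "z \<in> space D"
        then have "\<bar>\<psi> z\<bar> \<le> \<beta> * 1" using \<psi>(2) by simp
        also have "\<dots> \<le> \<beta> * sqrt (real n)" using \<beta> n by (intro mult_left_mono) auto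
        finally show "\<bar>\<psi> z\<bar> \<le> \<beta> * sqrt (real n)" .
      qed (use \<beta> n in auto)
      also have "real n * \<beta>\<^sup>2 / (\<beta> * sqrt (real n))\<^sup>2 - t / (\<beta> * sqrt (real n)) = - (2 / \<epsilon>)"
        using \<beta> n by (simp add: t_def C_def power_mult_distrib)
      also have "exp (- (2 / \<epsilon>)) \<le> 1 / (2 / \<epsilon>)" using \<epsilon> by (intro exp_minus_le_inverse) auto
      finally show ?thesis by simp
    qed
    define E where "E = {\<omega> \<in> space M. t \<le> deviation n \<phi> \<omega>} \<union> {\<omega> \<in> space M. t \<le> deviation n (\<lambda>z. - \<phi> z) \<omega>}"
    note [measurable] = \<phi>
    have ev: "{\<omega> \<in> space M. t \<le> deviation n \<phi> \<omega>} \<in> events" "{\<omega> \<in> space M. t \<le> deviation n (\<lambda>z. - \<phi> z) \<omega>} \<in> events"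
      by measurable
    have "prob E \<le> \<epsilon> / 2 + \<epsilon> / 2"
      unfolding E_def by (intro order_trans[OF measure_Un_le[OF ev]] add_mono tail) (use b in auto)
    moreover have "E \<in> events" unfolding E_def using ev by auto
    moreover have "\<bar>deviation n \<phi> \<omega>\<bar> \<le> t" if "\<omega> \<in> space M - E" for \<omega>
    proof -
      have "deviation n (\<lambda>z. - \<phi> z) \<omega> = - deviation n \<phi> \<omega>" by (simp add: deviation_def sum_negf)
      then show ?thesis using that by (auto simp: E_def)
    qed
    ultimately show ?thesis unfolding t_def by (intro bexI[of _ E]) auto
  qed
  moreover have "0 \<le> C" using \<beta> \<epsilon> by (simp add: C_def)
  ultimately show ?thesis by blast
qed

text \<open>Common source of both rates: \<open>c\<close> is the gain of the estimator over
  \<open>g1\<close> in the criterion. The comparison is with \<open>g1\<close>, a member of the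
  class equal to \<open>g0\<close> almost everywhere.\<close>

lemma mle_bound:
  fixes Q :: "'a measure" and \<G> :: "('a \<Rightarrow> real) set" and g0 g1 :: "'a \<Rightarrow> real" and \<gamma> :: real
    and M :: "'w measure" and X Y :: "nat \<Rightarrow> 'w \<Rightarrow> 'a" and ghat :: "nat \<Rightarrow> 'w \<Rightarrow> 'a \<Rightarrow> real"
  assumes Q: "prob_space Q" and g0: "g0 \<in> borel_measurable Q"
    and \<G>_meas: "\<And>g. g \<in> \<G> \<Longrightarrow> g \<in> borel_measurable Q"
    and \<G>_range: "\<And>g x. g \<in> \<G> \<Longrightarrow> x \<in> space Q \<Longrightarrow> 0 \<le> g x \<and> g x \<le> K"
    and g1: "g1 \<in> \<G>" and eq: "AE x in Q. g1 x = g0 x" and P: "prob_space (density Q g1)"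
    and \<gamma>: "0 < \<gamma>" "\<gamma> < 2"
    and ent: "\<And>\<delta>. 0 < \<delta> \<Longrightarrow> bracketing_entropy Q \<delta> ((\<lambda>g x. sqrt ((g x + g0 x) / 2)) ` \<G>) \<le> ereal (A * \<delta> powr (- \<gamma>))"
    and iid: "iid_sequence M (density Q g1 \<Otimes>\<^sub>M Q) (\<lambda>i \<omega>. (X i \<omega>, Y i \<omega>))"
    and argmax: "\<And>n. 1 \<le> n \<Longrightarrow> AE \<omega> in M.
           is_arg_max (emp_criterion n (\<lambda>i. X i \<omega>) (\<lambda>i. Y i \<omega>)) (\<lambda>g. g \<in> \<G>) (ghat n \<omega>)"
    and \<epsilon>: "0 < \<epsilon>"
  shows "\<exists>C\<ge>0. \<forall>n\<ge>1. \<exists>E\<in>sets M. measure M E \<le> \<epsilon> \<and> (\<forall>\<omega>\<in>space M - E.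
      hellinger Q g0 (ghat n \<omega>) \<le> C * real n powr (- 1 / (\<gamma> + 2)) \<and>
      (\<exists>c. emp_criterion n (\<lambda>i. X i \<omega>) (\<lambda>i. Y i \<omega>) (ghat n \<omega>)
             = ereal (c + (\<Sum>i<n. ln (g1 (X i \<omega>)) - g1 (Y i \<omega>)) / real n) \<and>
           0 \<le> c \<and> c \<le> C * real n powr (- 2 / (\<gamma> + 2))))"
proof -
  define b where "b = max 1 K"
  define T where "T = (\<lambda>g x. sqrt ((g x + g1 x) / 2)) ` \<G>"
  have b1: "1 \<le> b" by (simp add: b_def)
  have Kb: "K \<le> b\<^sup>2"
  proof -
    have "b * 1 \<le> b * b" using b1 by (intro mult_left_mono) auto
    then show ?thesis by (simp add: b_def power2_eq_square)
  qed
  have dc: "density_class Q g1 b T"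
  proof (rule density_class.intro)
    show "g1 \<in> borel_measurable Q" by (rule \<G>_meas[OF g1])
    show "0 \<le> g1 x" "g1 x \<le> b\<^sup>2" if "x \<in> space Q" for x using \<G>_range[OF g1 that] Kb by auto
    fix s assume "s \<in> T"
    then obtain g where g: "g \<in> \<G>" "s = (\<lambda>x. sqrt ((g x + g1 x) / 2))" by (auto simp: T_def)
    note [measurable] = \<G>_meas[OF g(1)] \<G>_meas[OF g1]
    show "s \<in> borel_measurable Q" unfolding g(2) by measurable
    fix x assume x: "x \<in> space Q"
    note r = \<G>_range[OF g(1) x] \<G>_range[OF g1 x]
    show "0 \<le> s x" "g1 x \<le> 2 * (s x)\<^sup>2" unfolding g(2) using r by simp_all
    have "(g x + g1 x) / 2 \<le> b\<^sup>2" using r Kb by simp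
    then show "s x \<le> b" unfolding g(2) using r b1 by (intro real_le_lsqrt) auto
  qed (rule Q P b1)+
  interpret density_class Q g1 b T by (rule dc)
  interpret iid_sequence M D "\<lambda>i \<omega>. (X i \<omega>, Y i \<omega>)" by (rule iid)
  \<comment> \<open>The given entropy constant may be negative, whereas the uniform bound takes a
    nonnegative one.\<close>
  define A' where "A' = max A 0"
  have "\<exists>N idx \<Delta>. real N \<le> exp (A' * \<delta> powr (- \<gamma>)) \<and> L2_cells \<delta> N idx \<Delta>" if d: "0 < \<delta>" for \<delta>
  proof -
    have "(\<lambda>g x. sqrt ((g x + g0 x) / 2)) ` \<G> \<noteq> {}" using g1 by auto
    then obtain N where N: "real N \<le> exp (A * \<delta> powr (- \<gamma>))"
        "L2_bracket_cover Q \<delta> ((\<lambda>g x. sqrt ((g x + g0 x) / 2)) ` \<G>) N"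
      by (rule bracketing_entropy_cover[OF ent[OF d]])
    have "exp (A * \<delta> powr (- \<gamma>)) \<le> exp (A' * \<delta> powr (- \<gamma>))"
      unfolding exp_le_cancel_iff by (intro mult_right_mono) (auto simp: A'_def)
    moreover have "\<exists>idx \<Delta>. L2_cells \<delta> N idx \<Delta>"
      using L2_cells_of_bracket_cover[OF dc[unfolded T_def] g0 eq N(2)] unfolding T_def .
    ultimately show ?thesis using N(1) order_trans by blast
  qed
  from uniform_likelihood_bound[OF \<gamma> _ this iid \<epsilon>]
  obtain C where C: "0 \<le> C" and bound: "\<And>n. 1 \<le> n \<Longrightarrow> \<exists>E\<in>sets M. measure M E \<le> \<epsilon> \<and> (\<forall>\<omega>\<in>space M - E. \<forall>s\<in>T.
    (\<Sum>i<n. 2 * ln (s (X i \<omega>) / sqrt (g1 (X i \<omega>))) - ((s (Y i \<omega>))\<^sup>2 - g1 (Y i \<omega>)))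
      \<le> - (real n * dist2 s / 16) + C * (real n * real n powr (- 2 / (\<gamma> + 2))))"
    by (auto simp: A'_def)
  \<comment> \<open>\<open>2 * C\<close> serves the criterion. For the Hellinger distance,
    \<open>dist2 s \<le> 16 * C * v\<close> is multiplied by 16 and halved, hence 128.\<close>
  define C' where "C' = 2 * C + sqrt (128 * C)"
  have "\<exists>E\<in>sets M. measure M E \<le> \<epsilon> \<and> (\<forall>\<omega>\<in>space M - E.
      hellinger Q g0 (ghat n \<omega>) \<le> C' * real n powr (- 1 / (\<gamma> + 2)) \<and>
      (\<exists>c. emp_criterion n (\<lambda>i. X i \<omega>) (\<lambda>i. Y i \<omega>) (ghat n \<omega>)
             = ereal (c + (\<Sum>i<n. ln (g1 (X i \<omega>)) - g1 (Y i \<omega>)) / real n) \<and>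
           0 \<le> c \<and> c \<le> C' * real n powr (- 2 / (\<gamma> + 2))))" if n: "1 \<le> n" for n
  proof -
    define v where "v = real n powr (- 2 / (\<gamma> + 2))"
    have v: "0 < v" using n by (simp add: v_def)
    have sqrt_v: "sqrt v = real n powr (- 1 / (\<gamma> + 2))"
    proof -
      have "sqrt v = real n powr ((- 2 / (\<gamma> + 2)) * (1 / 2))"
        unfolding v_def using n by (simp only: powr_half_sqrt[symmetric] powr_ge_zero powr_powr)
      also have "(- 2 / (\<gamma> + 2)) * (1 / 2) = - 1 / (\<gamma> + 2)" using \<gamma> by (simp add: field_simps)
      finally show ?thesis .
    qed
    obtain E1 where E1: "E1 \<in> events" "prob E1 \<le> \<epsilon>" "\<And>\<omega> s. \<omega> \<in> space M - E1 \<Longrightarrow> s \<in> T \<Longrightarrow>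
        (\<Sum>i<n. 2 * ln (s (X i \<omega>) / sqrt (g1 (X i \<omega>))) - ((s (Y i \<omega>))\<^sup>2 - g1 (Y i \<omega>)))
        \<le> - (real n * dist2 s / 16) + C * (real n * v)"
      using bound[OF n] unfolding v_def by blast
    have "AE z in D. 0 < g1 (fst z)"
    proof (rule AE_distrD[OF measurable_fst])
      show "AE x in distr D P fst. 0 < g1 x"
        unfolding prob_space.distr_pair_fst[OF prob_Q] by (rule AE_P_pos)
    qed
    then have "AE \<omega> in M. 0 < g1 (X i \<omega>)" for i
      using AE_distrD[OF Z_measurable[of i], of "\<lambda>z. 0 < g1 (fst z)", unfolded distr_eq] by simp
    then have "AE \<omega> in M. (\<forall>i. 0 < g1 (X i \<omega>)) \<and>
        is_arg_max (emp_criterion n (\<lambda>i. X i \<omega>) (\<lambda>i. Y i \<omega>)) (\<lambda>g. g \<in> \<G>) (ghat n \<omega>)"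
      using argmax[OF n] by (simp add: AE_all_countable)
    then obtain N0 where N0: "{\<omega> \<in> space M. \<not> ((\<forall>i. 0 < g1 (X i \<omega>)) \<and>
        is_arg_max (emp_criterion n (\<lambda>i. X i \<omega>) (\<lambda>i. Y i \<omega>)) (\<lambda>g. g \<in> \<G>) (ghat n \<omega>))} \<subseteq> N0"
        "emeasure M N0 = 0" "N0 \<in> events" by (rule AE_E)
    define E where "E = N0 \<union> E1"
    have "prob E \<le> prob N0 + prob E1" unfolding E_def by (rule measure_Un_le[OF N0(3) E1(1)])
    then have E_le: "prob E \<le> \<epsilon>" using N0(2) E1(2) by (simp add: measure_def)
    have E_ev: "E \<in> events" using N0 E1 by (simp add: E_def)
    have main: "hellinger Q g0 (ghat n \<omega>) \<le> C' * sqrt v \<and>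
      (\<exists>c. emp_criterion n (\<lambda>i. X i \<omega>) (\<lambda>i. Y i \<omega>) (ghat n \<omega>)
             = ereal (c + (\<Sum>i<n. ln (g1 (X i \<omega>)) - g1 (Y i \<omega>)) / real n) \<and> 0 \<le> c \<and> c \<le> C' * v)"
      if \<omega>: "\<omega> \<in> space M - E" for \<omega>
    proof -
      define g where "g = ghat n \<omega>"
      define s where "s x = sqrt ((g x + g1 x) / 2)" for x
      have am: "is_arg_max (emp_criterion n (\<lambda>i. X i \<omega>) (\<lambda>i. Y i \<omega>)) (\<lambda>g. g \<in> \<G>) g"
        and g1_pos: "\<And>i. 0 < g1 (X i \<omega>)" using N0(1) \<omega> unfolding E_def g_def by auto
      note max = arg_max_criterion[OF am g1 n g1_pos]
      have g: "g \<in> \<G>" using am by (simp add: is_arg_max_def)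
      have s: "s \<in> T" using g unfolding T_def s_def[abs_def] by blast
      have sp: "X i \<omega> \<in> space Q" "Y i \<omega> \<in> space Q" for i
        using Z_space[of \<omega> i] \<omega> by (auto simp: space_pair_measure)
      define \<Lambda> where "\<Lambda> = (\<Sum>i<n. ln (g (X i \<omega>)) - g (Y i \<omega>)) - (\<Sum>i<n. ln (g1 (X i \<omega>)) - g1 (Y i \<omega>))"
      have \<Lambda>0: "0 \<le> \<Lambda>" using max(2) by (simp add: \<Lambda>_def)
      have "\<Lambda> / 2 = (\<Sum>i<n. (ln (g (X i \<omega>)) - ln (g1 (X i \<omega>))) / 2 - (g (Y i \<omega>) - g1 (Y i \<omega>)) / 2)"
        unfolding \<Lambda>_def sum_subtractf[symmetric] sum_divide_distrib
        by (intro sum.cong) (auto simp: field_simps)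
      also have "\<dots> \<le> (\<Sum>i<n. 2 * ln (s (X i \<omega>) / sqrt (g1 (X i \<omega>))) - ((s (Y i \<omega>))\<^sup>2 - g1 (Y i \<omega>)))"
      proof (intro sum_mono diff_mono)
        fix i assume "i \<in> {..<n}"
        then show "(ln (g (X i \<omega>)) - ln (g1 (X i \<omega>))) / 2 \<le> 2 * ln (s (X i \<omega>) / sqrt (g1 (X i \<omega>)))"
          unfolding s_def by (intro ln_mean_ge max(1) g1_pos) auto
        have "(s (Y i \<omega>))\<^sup>2 = (g (Y i \<omega>) + g1 (Y i \<omega>)) / 2"
          unfolding s_def using \<G>_range[OF g sp(2)] \<G>_range[OF g1 sp(2)] by simp
        then show "(s (Y i \<omega>))\<^sup>2 - g1 (Y i \<omega>) \<le> (g (Y i \<omega>) - g1 (Y i \<omega>)) / 2" by (simp add: field_simps)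
      qed
      also have "\<dots> \<le> - (real n * dist2 s / 16) + C * (real n * v)"
        using \<omega> s by (intro E1(3)) (auto simp: E_def)
      \<comment> \<open>Both terms on the left are nonnegative, so this one inequality bounds the
        distance and the likelihood gain.\<close>
      finally have le: "\<Lambda> / 2 + real n * dist2 s / 16 \<le> C * (real n * v)" by simp
      have "real n * dist2 s \<le> real n * (16 * C * v)" using le \<Lambda>0 by (simp add: field_simps)
      then have d: "dist2 s \<le> 16 * C * v" using n by simp
      have "0 \<le> real n * dist2 s / 16" using dist2_nonneg[of s] by simp
      then have "\<Lambda> / 2 \<le> C * (real n * v)" using le by linarith
      then have "\<Lambda> \<le> 2 * C * (real n * v)" by simp
      then have "\<Lambda> / real n \<le> 2 * C * v" using n by (simp add: field_simps)
      also have "\<dots> \<le> C' * v" using v C by (intro mult_right_mono) (auto simp: C'_def)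
      finally have \<Lambda>n: "\<Lambda> / real n \<le> C' * v" .
      have crit: "emp_criterion n (\<lambda>i. X i \<omega>) (\<lambda>i. Y i \<omega>) g
          = ereal (\<Lambda> / real n + (\<Sum>i<n. ln (g1 (X i \<omega>)) - g1 (Y i \<omega>)) / real n)"
        using emp_criterion_pos[of n g "\<lambda>i. X i \<omega>" "\<lambda>i. Y i \<omega>", OF max(1) n]
        by (simp add: \<Lambda>_def add_divide_distrib[symmetric])
      note [measurable] = g0 \<G>_meas[OF g] \<G>_meas[OF g1]
      have "(LINT x|Q. (sqrt (g0 x) - sqrt (g x))\<^sup>2) = (LINT x|Q. (sqrt (g1 x) - sqrt (g x))\<^sup>2)"
      proof (rule integral_cong_AE)
        show "AE x in Q. (sqrt (g0 x) - sqrt (g x))\<^sup>2 = (sqrt (g1 x) - sqrt (g x))\<^sup>2"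
          using eq by eventually_elim simp
      qed measurable
      also have "\<dots> \<le> (LINT x|Q. 16 * (s x - sqrt (g1 x))\<^sup>2)"
      proof (rule integral_mono_AE')
        show "AE x in Q. (sqrt (g1 x) - sqrt (g x))\<^sup>2 \<le> 16 * (s x - sqrt (g1 x))\<^sup>2"
          using \<G>_range[OF g] \<G>_range[OF g1] unfolding s_def by (intro AE_I2 sqrt_diff_le_sqrt_mean) auto
      qed (use dist2_integrable[OF s] in auto)
      also have "\<dots> = 16 * dist2 s" by (simp add: dist2_def)
      finally have "1 / 2 * (LINT x|Q. (sqrt (g0 x) - sqrt (g x))\<^sup>2) \<le> 128 * C * v" using d by simp
      then have "hellinger Q g0 g \<le> sqrt (128 * C * v)" unfolding hellinger_def by (rule real_sqrt_le_mono)
      also have "\<dots> = sqrt (128 * C) * sqrt v" by (simp add: real_sqrt_mult)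
      also have "\<dots> \<le> C' * sqrt v" using C v by (intro mult_right_mono) (auto simp: C'_def)
      finally have "hellinger Q g0 g \<le> C' * sqrt v" .
      moreover have "0 \<le> \<Lambda> / real n" using \<Lambda>0 by simp
      ultimately show ?thesis using \<Lambda>n crit unfolding g_def by blast
    qed
    show ?thesis
    proof (rule bexI[OF _ E_ev], rule conjI[OF E_le], rule ballI)
      fix \<omega> assume "\<omega> \<in> space M - E"
      from main[OF this, unfolded sqrt_v, unfolded v_def]
      show "hellinger Q g0 (ghat n \<omega>) \<le> C' * real n powr (- 1 / (\<gamma> + 2)) \<and>
      (\<exists>c. emp_criterion n (\<lambda>i. X i \<omega>) (\<lambda>i. Y i \<omega>) (ghat n \<omega>)
             = ereal (c + (\<Sum>i<n. ln (g1 (X i \<omega>)) - g1 (Y i \<omega>)) / real n) \<and>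
           0 \<le> c \<and> c \<le> C' * real n powr (- 2 / (\<gamma> + 2)))" .
    qed
  qed
  moreover have "0 \<le> C'" using C by (simp add: C'_def)
  ultimately show ?thesis by blast
qed

text \<open>Where \<open>q0\<close> is positive, \<open>p0 = q0 * g1\<close>; where it vanishes,
  absolute continuity makes \<open>p0\<close> vanish almost everywhere too, so the default value of
  the quotient does no harm.\<close>

lemma density_eq_density_ratio:
  fixes p0 q0 :: "'a \<Rightarrow> real"
  assumes p: "p0 \<in> borel_measurable \<mu>" "\<And>x. x \<in> space \<mu> \<Longrightarrow> 0 \<le> p0 x"
    and q: "q0 \<in> borel_measurable \<mu>" "\<And>x. x \<in> space \<mu> \<Longrightarrow> 0 \<le> q0 x"
    and ac: "absolutely_continuous (density \<mu> q0) (density \<mu> p0)"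
    and g1: "g1 \<in> borel_measurable \<mu>" and eq: "AE x in density \<mu> q0. g1 x = p0 x / q0 x"
  shows "density \<mu> p0 = density (density \<mu> q0) g1"
proof -
  note [measurable] = p(1) q(1) g1
  have "AE x in density \<mu> q0. q0 x \<noteq> 0" by (subst AE_density) (auto intro!: AE_I2)
  then have "AE x in density \<mu> p0. q0 x \<noteq> 0"
    by (rule absolutely_continuous_AE[OF _ ac, rotated]) simp
  then have "AE x in \<mu>. 0 < p0 x \<longrightarrow> q0 x \<noteq> 0" by (simp add: AE_density)
  moreover have "AE x in \<mu>. 0 < q0 x \<longrightarrow> g1 x = p0 x / q0 x" using eq by (simp add: AE_density)
  ultimately have "AE x in \<mu>. ennreal (p0 x) = ennreal (q0 x) * ennreal (g1 x)"
    using AE_space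
  proof eventually_elim
    case (elim x)
    show ?case
    proof (cases "0 < q0 x")
      case True
      then have "p0 x = q0 x * g1 x" using elim(2) by simp
      then show ?thesis using True by (simp add: ennreal_mult')
    next
      case False
      then show ?thesis using elim p(2)[of x] q(2)[of x] by (simp add: less_le)
    qed
  qed
  then show ?thesis by (subst density_density_eq) (auto intro!: density_cong)
qed

theorem theorem2:
  fixes \<X> :: "(real ^ 'd) set"
    and \<mu> P Q :: "(real ^ 'd) measure"
    and p0 q0 g0 :: "real ^ 'd \<Rightarrow> real"
    and M :: "'w measure"
    and X Y :: "nat \<Rightarrow> 'w \<Rightarrow> real ^ 'd"
    and \<G> :: "(real ^ 'd \<Rightarrow> real) set"
    and ghat :: "nat \<Rightarrow> 'w \<Rightarrow> real ^ 'd \<Rightarrow> real"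
    and \<gamma> :: real
  assumes "compact \<X>"
    and "\<mu> = restrict_space lborel \<X>"
    and "p0 \<in> borel_measurable \<mu>" and "\<forall>x\<in>\<X>. 0 \<le> p0 x" and "P = density \<mu> p0"
    and "q0 \<in> borel_measurable \<mu>" and "\<forall>x\<in>\<X>. 0 \<le> q0 x" and "Q = density \<mu> q0"
    and "prob_space P" and "prob_space Q"
    and "absolutely_continuous Q P"
    and "measure_support P = measure_support Q"
    and "g0 = (\<lambda>x. p0 x / q0 x)"
    and "prob_space M"
    and "\<forall>i. X i \<in> measurable M (restrict_space borel \<X>) \<and>
             distr M (restrict_space borel \<X>) (X i) = P"
    and "\<forall>i. Y i \<in> measurable M (restrict_space borel \<X>) \<and>
             distr M (restrict_space borel \<X>) (Y i) = Q"
    and "prob_space.indep_vars M (\<lambda>_. restrict_space borel \<X>) (case_sum X Y)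
           (UNIV :: (nat + nat) set)"
    and "\<forall>g\<in>\<G>. g \<in> borel_measurable \<mu> \<and> (\<forall>x\<in>\<X>. 0 \<le> g x)"
    and "\<forall>n\<ge>1. AE \<omega> in M.
           is_arg_max (emp_criterion n (\<lambda>i. X i \<omega>) (\<lambda>i. Y i \<omega>)) (\<lambda>g. g \<in> \<G>) (ghat n \<omega>)"
    and "KL_dens \<mu> p0 q0 < \<infinity>"
    and "\<exists>g\<in>\<G>. AE x in Q. g x = g0 x"
    and "0 < \<gamma>" and "\<gamma> < 2"
    and "\<exists>A::real. \<forall>\<delta>>0.
           bracketing_entropy Q \<delta> ((\<lambda>g x. sqrt ((g x + g0 x) / 2)) ` \<G>)
             \<le> ereal (A * \<delta> powr (- \<gamma>))"
  shows "(\<forall>K2::real. (SUP g\<in>\<G>. SUP x\<in>\<X>. ereal \<bar>g x\<bar>) < ereal K2 \<longrightarrow>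
            bounded_in_prob M (\<lambda>n \<omega>. ereal (hellinger Q g0 (ghat n \<omega>)))
              (\<lambda>n. real n powr (- 1 / (\<gamma> + 2)))) \<and>
         (\<forall>K1 K2::real. 0 < K1 \<and>
            (\<forall>g\<in>\<G>. ereal K1 \<le> (INF x\<in>\<X>. ereal (g x)) \<and>
                    (SUP x\<in>\<X>. ereal (g x)) \<le> ereal K2) \<longrightarrow>
            bounded_in_prob M
              (\<lambda>n \<omega>. \<bar>(emp_criterion n (\<lambda>i. X i \<omega>) (\<lambda>i. Y i \<omega>) (ghat n \<omega>) + 1)
                       - KL_dens \<mu> p0 q0\<bar>)
              (\<lambda>n. real n powr (- 1 / 2)))"
proof -
  note mu = assms(2) and p0 = assms(3,4) and P = assms(5) and q0 = assms(6,7)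
    and Q = assms(8) and prob = assms(9,10) and ac = assms(11) and g0 = assms(13) and M = assms(14)
    and X = assms(15) and Y = assms(16) and indep = assms(17) and \<G> = assms(18) and argmax = assms(19)
    and \<gamma> = assms(22,23)
  have space_mu: "space \<mu> = \<X>" by (simp add: mu space_restrict_space)
  have space_Q: "space Q = \<X>" by (simp add: Q space_mu)
  have sets_Q: "sets Q = sets \<mu>" by (simp add: Q)
  have meas_Q: "borel_measurable Q = borel_measurable \<mu>" by (rule measurable_cong_sets[OF sets_Q refl])
  have nonempty: "\<X> \<noteq> {}" using prob_space.not_empty[OF prob(2)] space_Q by simp
  obtain g1 where g1: "g1 \<in> \<G>" and eq: "AE x in Q. g1 x = g0 x" using assms(21) by blast
  have g1_meas: "g1 \<in> borel_measurable \<mu>" using \<G> g1 by blast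
  have P_eq: "P = density Q g1"
    unfolding P Q
    by (rule density_eq_density_ratio) (use p0 q0 ac[unfolded P Q] g1_meas eq[unfolded Q g0] in \<open>auto simp: space_mu\<close>)
  have g0_meas: "g0 \<in> borel_measurable Q" unfolding g0 meas_Q using p0(1) q0(1) by measurable
  obtain A where ent: "\<And>\<delta>. 0 < \<delta> \<Longrightarrow>
      bracketing_entropy Q \<delta> ((\<lambda>g x. sqrt ((g x + g0 x) / 2)) ` \<G>) \<le> ereal (A * \<delta> powr (- \<gamma>))"
    using assms(24) by blast
  have iid: "iid_sequence M (density Q g1 \<Otimes>\<^sub>M Q) (\<lambda>i \<omega>. (X i \<omega>, Y i \<omega>))"
    unfolding P_eq[symmetric]
    by (rule iid_sequence_pairs[OF M, where R = "restrict_space borel \<X>"]) (use X Y indep in auto)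
  define crit where "crit C n \<omega> \<longleftrightarrow> (\<exists>c. emp_criterion n (\<lambda>i. X i \<omega>) (\<lambda>i. Y i \<omega>) (ghat n \<omega>)
             = ereal (c + (\<Sum>i<n. ln (g1 (X i \<omega>)) - g1 (Y i \<omega>)) / real n) \<and>
           0 \<le> c \<and> c \<le> C * real n powr (- 2 / (\<gamma> + 2)))" for C n \<omega>
  have mle: "\<exists>C\<ge>0. \<forall>n\<ge>1. \<exists>E\<in>sets M. measure M E \<le> \<epsilon> \<and> (\<forall>\<omega>\<in>space M - E.
      hellinger Q g0 (ghat n \<omega>) \<le> C * real n powr (- 1 / (\<gamma> + 2)) \<and>
      crit C n \<omega>)"
    if le: "\<forall>g\<in>\<G>. \<forall>x\<in>\<X>. g x \<le> K" and \<epsilon>: "0 < \<epsilon>" for K \<epsilon>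
    unfolding crit_def
  proof (rule mle_bound[OF prob(2) g0_meas _ _ g1 eq _ \<gamma> ent iid _ \<epsilon>])
    show "g \<in> borel_measurable Q" if "g \<in> \<G>" for g using \<G> that meas_Q by blast
    show "0 \<le> g x \<and> g x \<le> K" if "g \<in> \<G>" "x \<in> space Q" for g x
      using \<G> that le by (simp add: space_Q)
    show "prob_space (density Q g1)" using prob(1) P_eq by simp
  qed (use argmax in auto)
  show ?thesis
  proof (intro conjI allI impI)

    \<comment> \<open>Hellinger rate under a uniform upper bound\<close>
    fix K2 :: real
    assume K2: "(SUP g\<in>\<G>. SUP x\<in>\<X>. ereal \<bar>g x\<bar>) < ereal K2"
    have le: "g x \<le> K2" if "g \<in> \<G>" "x \<in> \<X>" for g x
    proof -
      have "ereal \<bar>g x\<bar> \<le> (SUP x\<in>\<X>. ereal \<bar>g x\<bar>)" by (rule SUP_upper[OF that(2)])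
      also have "\<dots> \<le> (SUP g\<in>\<G>. SUP x\<in>\<X>. ereal \<bar>g x\<bar>)" by (rule SUP_upper[OF that(1)])
      also note K2
      finally show ?thesis by simp
    qed
    show "bounded_in_prob M (\<lambda>n \<omega>. ereal (hellinger Q g0 (ghat n \<omega>))) (\<lambda>n. real n powr (- 1 / (\<gamma> + 2)))"
      unfolding bounded_in_prob_def
    proof (intro allI impI)
      fix \<epsilon> :: real assume \<epsilon>: "0 < \<epsilon>"
      have "\<forall>g\<in>\<G>. \<forall>x\<in>\<X>. g x \<le> K2" using le by blast
      from mle[OF this \<epsilon>] obtain C where C: "\<And>n. 1 \<le> n \<Longrightarrow> \<exists>E\<in>sets M. measure M E \<le> \<epsilon> \<and>
          (\<forall>\<omega>\<in>space M - E. hellinger Q g0 (ghat n \<omega>) \<le> C * real n powr (- 1 / (\<gamma> + 2)))" by meson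
      have hn: "0 \<le> hellinger Q g0 f" for f unfolding hellinger_def by (simp add: integral_nonneg_AE)
      show "\<exists>C. \<forall>n\<ge>1. \<exists>E\<in>sets M. {\<omega> \<in> space M. ereal (C * real n powr (- 1 / (\<gamma> + 2)))
          < \<bar>ereal (hellinger Q g0 (ghat n \<omega>))\<bar>} \<subseteq> E \<and> measure M E \<le> \<epsilon>"
      proof (intro exI[of _ C] allI impI)
        fix n :: nat assume "1 \<le> n"
        from C[OF this] obtain E where "E \<in> sets M" "measure M E \<le> \<epsilon>"
          "\<And>\<omega>. \<omega> \<in> space M - E \<Longrightarrow> hellinger Q g0 (ghat n \<omega>) \<le> C * real n powr (- 1 / (\<gamma> + 2))" by blast
        then show "\<exists>E\<in>sets M. {\<omega> \<in> space M. ereal (C * real n powr (- 1 / (\<gamma> + 2)))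
          < \<bar>ereal (hellinger Q g0 (ghat n \<omega>))\<bar>} \<subseteq> E \<and> measure M E \<le> \<epsilon>"
          using hn by (intro bexI[of _ E]) (force simp: not_le[symmetric])+
      qed
    qed
  next

    \<comment> \<open>Root-n rate of the divergence estimator under two-sided bounds\<close>
    fix K1 K2 :: real
    assume K: "0 < K1 \<and> (\<forall>g\<in>\<G>. ereal K1 \<le> (INF x\<in>\<X>. ereal (g x)) \<and> (SUP x\<in>\<X>. ereal (g x)) \<le> ereal K2)"
    then have K1: "0 < K1" by blast
    have ge: "K1 \<le> g x" and le: "g x \<le> K2" if "g \<in> \<G>" "x \<in> \<X>" for g x
    proof -
      have "ereal K1 \<le> (INF x\<in>\<X>. ereal (g x))" using K that(1) by blast
      also have "\<dots> \<le> ereal (g x)" by (rule INF_lower[OF that(2)])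
      finally show "K1 \<le> g x" by simp
      have "ereal (g x) \<le> (SUP x\<in>\<X>. ereal (g x))" by (rule SUP_upper[OF that(2)])
      also have "\<dots> \<le> ereal K2" using K that(1) by blast
      finally show "g x \<le> K2" by simp
    qed
    define D where "D = density Q g1 \<Otimes>\<^sub>M Q"
    \<comment> \<open>The empirical mean of \<phi> is the criterion at \<open>g1\<close>. It is
      bounded, because \<open>g1\<close> is bounded away from 0 and above.\<close>
    define \<phi> where "\<phi> z = ln (g1 (fst z)) - g1 (snd z)" for z
    define \<kappa> where "\<kappa> = (LINT x|\<mu>. p0 x * ln (p0 x / q0 x))"
    interpret iid_sequence M D "\<lambda>i \<omega>. (X i \<omega>, Y i \<omega>)" unfolding D_def by (rule iid)
    note [measurable] = g1_meas p0(1) q0(1)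
    have g1_Q [measurable]: "g1 \<in> borel_measurable Q" unfolding meas_Q by (rule g1_meas)
    define \<beta> where "\<beta> = \<bar>ln K1\<bar> + \<bar>ln K2\<bar>"
    have ln_le: "\<bar>ln (g1 x)\<bar> \<le> \<beta>" if "x \<in> \<X>" for x
    proof -
      have "ln K1 \<le> ln (g1 x)" "ln (g1 x) \<le> ln K2"
        using ge[OF g1 that] le[OF g1 that] K1 by (auto intro!: ln_mono)
      then show ?thesis unfolding \<beta>_def by linarith
    qed
    have \<phi>_meas: "\<phi> \<in> borel_measurable D"
      unfolding \<phi>_def[abs_def] D_def
      by (intro borel_measurable_diff measurable_compose[OF measurable_fst] measurable_compose[OF measurable_snd]) simp_all
    have K2: "0 < K2" using nonempty ge[OF g1] le[OF g1] K1 by (metis ex_in_conv less_le_trans)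
    have \<phi>_le: "\<bar>\<phi> z\<bar> \<le> \<beta> + K2" if "z \<in> space D" for z
    proof -
      have z: "fst z \<in> \<X>" "snd z \<in> \<X>" using that by (auto simp: D_def space_pair_measure space_Q)
      then show ?thesis using ln_le[OF z(1)] ge[OF g1 z(2)] le[OF g1 z(2)] K1 unfolding \<phi>_def by linarith
    qed
    have int_ln: "integrable P (\<lambda>x. ln (g1 x))"
      by (rule integrable_of_bounded[OF prob(1), of _ \<beta>]) (use ln_le in \<open>auto simp: space_mu P\<close>)
    have int_g1: "integrable Q g1"
      by (rule integrable_of_bounded[OF prob(2) g1_Q, of K2]) (use ge[OF g1] le[OF g1] K1 in \<open>force simp: space_Q\<close>)
    have ratio: "AE x in \<mu>. p0 x * ln (g1 x) = p0 x * ln (p0 x / q0 x)"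
    proof -
      \<comment> \<open>Absolute continuity transfers the equality from \<open>Q\<close> to
        \<open>P\<close>; where \<open>p0\<close> vanishes, both integrands are 0.\<close>
      have "AE x in P. g1 x = g0 x"
        by (rule absolutely_continuous_AE[OF _ ac eq]) (simp add: P Q)
      then have "AE x in \<mu>. 0 < p0 x \<longrightarrow> g1 x = p0 x / q0 x" unfolding P g0 by (simp add: AE_density)
      then show ?thesis using AE_space
      proof eventually_elim
        case (elim x)
        then show ?case using p0(2) space_mu by (cases "p0 x = 0") (auto simp: less_le)
      qed
    qed
    have int_\<mu>: "integrable \<mu> (\<lambda>x. p0 x * ln (g1 x))"
      using int_ln p0(2) unfolding P by (subst (asm) integrable_density) (auto simp: space_mu intro!: AE_I2)
    have KL: "KL_dens \<mu> p0 q0 = ereal \<kappa>"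
      unfolding \<kappa>_def
    proof (rule KL_dens_integrable)
      show "integrable \<mu> (\<lambda>x. p0 x * ln (p0 x / q0 x))"
        by (rule iffD1[OF integrable_cong_AE int_\<mu>]) (use ratio in auto)
    qed
    have \<kappa>_eq: "\<kappa> = (LINT x|P. ln (g1 x))"
    proof -
      have "\<kappa> = (LINT x|\<mu>. p0 x * ln (g1 x))"
        unfolding \<kappa>_def by (rule integral_cong_AE) (use ratio in auto)
      also have "\<dots> = (LINT x|P. ln (g1 x))"
        using p0(2) unfolding P by (subst integral_density) (auto simp: space_mu intro!: AE_I2)
      finally show ?thesis .
    qed
    have g1_int: "(LINT x|Q. g1 x) = 1"
    proof -
      have "0 \<le> g1 x" if "x \<in> \<X>" for x using ge[OF g1 that] K1 by linarith
      then have "AE x in Q. 0 \<le> g1 x" by (intro AE_I2) (simp add: space_Q)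
      then have "(LINT x|density Q g1. (1 :: real)) = (LINT x|Q. g1 x)"
        using integral_density[of "\<lambda>_. 1 :: real" Q g1] by simp
      then show ?thesis using prob_space.prob_space[OF prob(1)] unfolding P_eq by simp
    qed
    \<comment> \<open>The \<open>- 1\<close> is the integral of \<open>g1\<close> under
      \<open>Q\<close>; the \<open>+ 1\<close> in the estimator compensates it.\<close>
    have \<phi>_mean: "(LINT z|D. \<phi> z) = \<kappa> - 1"
    proof -
      have fst: "distr D P fst = P" unfolding D_def P_eq[symmetric] by (rule prob_space.distr_pair_fst[OF prob(2)])
      have snd: "distr D Q snd = Q" unfolding D_def P_eq[symmetric] by (rule distr_pair_snd[OF prob])
      have m: "fst \<in> measurable D P" "snd \<in> measurable D Q" unfolding D_def P_eq[symmetric] by simp_all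
      have ln_P: "(\<lambda>x. ln (g1 x)) \<in> borel_measurable P" unfolding P by measurable
      have "(LINT z|D. \<phi> z) = (LINT z|D. ln (g1 (fst z))) - (LINT z|D. g1 (snd z))"
        unfolding \<phi>_def
      proof (rule Bochner_Integration.integral_diff)
        show "integrable D (\<lambda>z. ln (g1 (fst z)))"
          using integrable_distr_eq[OF m(1) ln_P] int_ln unfolding fst by simp
        show "integrable D (\<lambda>z. g1 (snd z))"
          using integrable_distr_eq[OF m(2) g1_Q] int_g1 unfolding snd by simp
      qed
      also have "\<dots> = (LINT x|P. ln (g1 x)) - (LINT x|Q. g1 x)"
        using integral_distr[OF m(1) ln_P] integral_distr[OF m(2) g1_Q] unfolding fst snd by simp
      finally show ?thesis using \<kappa>_eq g1_int by simp
    qed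
    show "bounded_in_prob M
            (\<lambda>n \<omega>. \<bar>(emp_criterion n (\<lambda>i. X i \<omega>) (\<lambda>i. Y i \<omega>) (ghat n \<omega>) + 1) - KL_dens \<mu> p0 q0\<bar>)
            (\<lambda>n. real n powr (- 1 / 2))"
      unfolding bounded_in_prob_def
    proof (intro allI impI)
      fix \<epsilon> :: real assume "0 < \<epsilon>"
      then have \<epsilon>: "0 < \<epsilon> / 2" by simp
      have "\<forall>g\<in>\<G>. \<forall>x\<in>\<X>. g x \<le> K2" using le by blast
      from mle[OF this \<epsilon>] obtain C1 where C1: "0 \<le> C1" "\<And>n. 1 \<le> n \<Longrightarrow> \<exists>E\<in>sets M. measure M E \<le> \<epsilon> / 2 \<and> (\<forall>\<omega>\<in>space M - E.
        crit C1 n \<omega>)" by metis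
      have "0 < \<beta> + K2" using K2 by (simp add: \<beta>_def add_nonneg_pos)
      from deviation_bounded[OF \<phi>_meas \<phi>_le this \<epsilon>]
      obtain C2 where C2: "\<And>n. 1 \<le> n \<Longrightarrow> \<exists>E\<in>sets M. measure M E \<le> \<epsilon> / 2 \<and>
        (\<forall>\<omega>\<in>space M - E. \<bar>deviation n \<phi> \<omega>\<bar> \<le> C2 * sqrt (real n))" by blast
      show "\<exists>C. \<forall>n\<ge>1. \<exists>E\<in>sets M. {\<omega> \<in> space M. ereal (C * real n powr (- 1 / 2))
          < \<bar>\<bar>(emp_criterion n (\<lambda>i. X i \<omega>) (\<lambda>i. Y i \<omega>) (ghat n \<omega>) + 1) - KL_dens \<mu> p0 q0\<bar>\<bar>} \<subseteq> E \<and> measure M E \<le> \<epsilon>"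
      \<comment> \<open>The error splits into the likelihood gain, with constant \<open>C1\<close>,
        and the fluctuation of the criterion at \<open>g1\<close>, with constant
        \<open>C2\<close>.\<close>
      proof (intro exI[of _ "C1 + C2"] allI impI)
        fix n :: nat assume n: "1 \<le> n"
        obtain E1 where E1: "E1 \<in> sets M" "measure M E1 \<le> \<epsilon> / 2" "\<And>\<omega>. \<omega> \<in> space M - E1 \<Longrightarrow>
          crit C1 n \<omega>" using C1(2)[OF n] by blast
        obtain E2 where E2: "E2 \<in> sets M" "measure M E2 \<le> \<epsilon> / 2"
          "\<And>\<omega>. \<omega> \<in> space M - E2 \<Longrightarrow> \<bar>deviation n \<phi> \<omega>\<bar> \<le> C2 * sqrt (real n)" using C2[OF n] by blast
        have "measure M (E1 \<union> E2) \<le> \<epsilon>"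
          using measure_Un_le[OF E1(1) E2(1)] E1(2) E2(2) by linarith
        moreover have "\<not> ereal ((C1 + C2) * real n powr (- 1 / 2))
          < \<bar>\<bar>(emp_criterion n (\<lambda>i. X i \<omega>) (\<lambda>i. Y i \<omega>) (ghat n \<omega>) + 1) - KL_dens \<mu> p0 q0\<bar>\<bar>"
          if \<omega>: "\<omega> \<in> space M - (E1 \<union> E2)" for \<omega>
        proof -
          define d where "d = deviation n \<phi> \<omega> / real n"
          obtain c where c: "emp_criterion n (\<lambda>i. X i \<omega>) (\<lambda>i. Y i \<omega>) (ghat n \<omega>)
             = ereal (c + (\<Sum>i<n. ln (g1 (X i \<omega>)) - g1 (Y i \<omega>)) / real n)"
            "0 \<le> c" "c \<le> C1 * real n powr (- 2 / (\<gamma> + 2))" using E1(3)[of \<omega>] \<omega> unfolding crit_def by blast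
          have sum_eq: "(\<Sum>i<n. ln (g1 (X i \<omega>)) - g1 (Y i \<omega>)) / real n = d + (\<kappa> - 1)"
            using n unfolding d_def deviation_def \<phi>_mean unfolding \<phi>_def by (simp add: field_simps)
          have Z: "(emp_criterion n (\<lambda>i. X i \<omega>) (\<lambda>i. Y i \<omega>) (ghat n \<omega>) + 1) - KL_dens \<mu> p0 q0 = ereal (c + d)"
            unfolding c(1) KL sum_eq by (simp add: one_ereal_def)
          have "c \<le> C1 * real n powr (- 1 / 2)"
          proof -
            \<comment> \<open>Here \<open>\<gamma> < 2\<close> makes the gain at most of the order
              of the fluctuation.\<close>
            have "- 2 / (\<gamma> + 2) \<le> - 1 / 2" using \<gamma> by (simp add: field_simps)
            then have "real n powr (- 2 / (\<gamma> + 2)) \<le> real n powr (- 1 / 2)" using n by (intro powr_mono) auto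
            then show ?thesis using c(3) C1(1) by (meson mult_left_mono order_trans)
          qed
          moreover have "\<bar>d\<bar> \<le> C2 * real n powr (- 1 / 2)"
          proof -
            have "\<bar>d\<bar> \<le> C2 * sqrt (real n) / real n"
              unfolding d_def abs_divide using E2(3)[of \<omega>] \<omega> by (auto intro!: divide_right_mono)
            also have "\<dots> = C2 * (1 / sqrt (real n))" using n by (simp add: field_simps)
            also have "1 / sqrt (real n) = real n powr (- 1 / 2)"
              using n by (simp add: powr_minus_divide powr_half_sqrt)
            finally show ?thesis .
          qed
          ultimately have "\<bar>c + d\<bar> \<le> (C1 + C2) * real n powr (- 1 / 2)"
            using c(2) by (simp add: distrib_right)
          then show ?thesis unfolding Z by simp
        qed
        ultimately show "\<exists>E\<in>sets M. {\<omega> \<in> space M. ereal ((C1 + C2) * real n powr (- 1 / 2))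
          < \<bar>\<bar>(emp_criterion n (\<lambda>i. X i \<omega>) (\<lambda>i. Y i \<omega>) (ghat n \<omega>) + 1) - KL_dens \<mu> p0 q0\<bar>\<bar>} \<subseteq> E \<and> measure M E \<le> \<epsilon>"
          using E1(1) E2(1) by (intro bexI[of _ "E1 \<union> E2"]) blast+
      qed
    qed
  qed
qed

end
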